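(* Let $(M,g)=(M_1\times M_2,\ g_1\oplus g_2)$ be a direct product of two closed connected Riemannian manifolds, and assume that the scalar curvatures satisfy $R^{g_1}\ge 0$ and $R^{g_2}\ge 0$. Let $f_1,f_2: M\to\mathbb{R}$ be smooth positive functions such that $f_i$ is constant along $M_i$ for $i=1,2$. Then the scalar curvature of $f_1^2g_1\oplus f_2^2g_2$ cannot be nonpositive everywhere and negative somewhere at the same time.
   Context: Closed means compact without boundary. $R^{g_i}$ denotes the scalar curvature of $g_i$ (identically zero if $\dim M_i=1$). A function on $M_1\times M_2$ is constant along $M_i$ if it does not depend on the $M_i$-variable; thus $f_1$ is the pullback of a function on $M_2$ and $f_2$ is the pullback of a function on $M_1$. The metrics $g_i$ are regarded as symmetric 2-tensors on $M$ by pullback. *)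

theory Defs
  imports "HOL-Analysis.Analysis"
begin

section \<open>Smooth maps between normed spaces\<close>

text \<open>Only meaningful for open \<open>S\<close>. The derivative of order \<open>Suc k\<close> is controlled through all
  directional derivatives, which for a finite-dimensional domain is the usual class \<open>C\<^sup>k\<close>.\<close>

primrec Ck_on ::
  "nat \<Rightarrow> 'a::real_normed_vector set \<Rightarrow> ('a \<Rightarrow> 'b::real_normed_vector) \<Rightarrow> bool" where
  "Ck_on 0 S f \<longleftrightarrow> continuous_on S f"
| "Ck_on (Suc k) S f \<longleftrightarrow> (\<forall>x\<in>S. f differentiable (at x)) \<and>
     (\<forall>v. Ck_on k S (\<lambda>x. frechet_derivative f (at x) v))"

definition smooth_on ::
  "'a::real_normed_vector set \<Rightarrow> ('a \<Rightarrow> 'b::real_normed_vector) \<Rightarrow> bool" where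
  "smooth_on S f \<longleftrightarrow> (\<forall>k. Ck_on k S f)"

section \<open>Smooth manifolds\<close>

text \<open>The points of a manifold are all elements of a type \<open>'m\<close>, with the topology of its type
  class; the model space \<open>'a\<close> is Euclidean, so the dimension is \<open>DIM('a)\<close>. The values of
  \<open>cmap\<close> off \<open>cdom\<close>, and of \<open>cinv\<close> off the image of the chart, are irrelevant.\<close>

record ('m, 'a) chart =
  cdom :: "'m set"
  cmap :: "'m \<Rightarrow> 'a"
  cinv :: "'a \<Rightarrow> 'm"

abbreviation cimage :: "('m, 'a) chart \<Rightarrow> 'a set" where
  "cimage c \<equiv> cmap c ` cdom c"

definition is_chart :: "('m::topological_space, 'a::euclidean_space) chart \<Rightarrow> bool" where
  "is_chart c \<longleftrightarrow> open (cdom c) \<and> open (cimage c) \<and>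
     homeomorphism (cdom c) (cimage c) (cmap c) (cinv c)"

text \<open>The smooth structure is given by an atlas. As a piece of bookkeeping, a preferred chart is
  selected around each point; it serves to identify the tangent space at \<open>p\<close> with \<open>'a\<close>.\<close>

record ('m, 'a) manifold =
  atlas :: "('m, 'a) chart set"
  chart_at :: "'m \<Rightarrow> ('m, 'a) chart"

definition smooth_manifold ::
  "('m::{t2_space, second_countable_topology}, 'a::euclidean_space) manifold \<Rightarrow> bool" where
  "smooth_manifold M \<longleftrightarrow>
     (\<forall>c\<in>atlas M. is_chart c) \<and>
     (\<forall>p. chart_at M p \<in> atlas M \<and> p \<in> cdom (chart_at M p)) \<and>
     (\<forall>c\<in>atlas M. \<forall>d\<in>atlas M.
        smooth_on (cmap c ` (cdom c \<inter> cdom d)) (cmap d \<circ> cinv c))"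

definition smooth_function :: "('m, 'a::euclidean_space) manifold \<Rightarrow> ('m \<Rightarrow> real) \<Rightarrow> bool" where
  "smooth_function M f \<longleftrightarrow> (\<forall>c\<in>atlas M. smooth_on (cimage c) (f \<circ> cinv c))"

definition prod_chart ::
  "('m, 'a) chart \<Rightarrow> ('n, 'b) chart \<Rightarrow> ('m \<times> 'n, 'a \<times> 'b) chart" where
  "prod_chart c d =
     \<lparr>cdom = cdom c \<times> cdom d, cmap = map_prod (cmap c) (cmap d),
      cinv = map_prod (cinv c) (cinv d)\<rparr>"

definition prod_manifold ::
  "('m, 'a) manifold \<Rightarrow> ('n, 'b) manifold \<Rightarrow> ('m \<times> 'n, 'a \<times> 'b) manifold" where
  "prod_manifold M N =
     \<lparr>atlas = {prod_chart c d | c d. c \<in> atlas M \<and> d \<in> atlas N},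
      chart_at = (\<lambda>(x, y). prod_chart (chart_at M x) (chart_at N y))\<rparr>"

section \<open>Riemannian metrics\<close>

text \<open>A covariant 2-tensor field \<open>g\<close> is a family of bilinear forms \<open>g p\<close> on the tangent spaces,
  where a vector \<open>v :: 'a\<close> stands for the tangent vector at \<open>p\<close> with components \<open>v\<close> in the
  preferred chart at \<open>p\<close>.\<close>

type_synonym ('m, 'a) tensor2 = "'m \<Rightarrow> 'a \<Rightarrow> 'a \<Rightarrow> real"

text \<open>Coordinate expression of \<open>g\<close> in the chart \<open>c\<close> at the coordinate point \<open>x\<close>: components with
  respect to \<open>c\<close> are carried to components with respect to the preferred chart at the point
  by the differential of the transition map.\<close>

definition metric_in ::
  "('m, 'a::euclidean_space) manifold \<Rightarrow> ('m, 'a) tensor2 \<Rightarrow> ('m, 'a) chart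
     \<Rightarrow> 'a \<Rightarrow> 'a \<Rightarrow> 'a \<Rightarrow> real" where
  "metric_in M g c x v w =
     (let p = cinv c x;
          T = frechet_derivative (cmap (chart_at M p) \<circ> cinv c) (at x)
      in g p (T v) (T w))"

definition riemannian_metric ::
  "('m, 'a::euclidean_space) manifold \<Rightarrow> ('m, 'a) tensor2 \<Rightarrow> bool" where
  "riemannian_metric M g \<longleftrightarrow>
     (\<forall>p. bilinear (g p)) \<and>
     (\<forall>p v w. g p v w = g p w v) \<and>
     (\<forall>p v. v \<noteq> 0 \<longrightarrow> g p v v > 0) \<and>
     (\<forall>c\<in>atlas M. \<forall>v w. smooth_on (cimage c) (\<lambda>x. metric_in M g c x v w))"

definition riemannian_manifold ::
  "('m::{t2_space, second_countable_topology}, 'a::euclidean_space) manifold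
     \<Rightarrow> ('m, 'a) tensor2 \<Rightarrow> bool" where
  "riemannian_manifold M g \<longleftrightarrow> smooth_manifold M \<and> riemannian_metric M g"

text \<open>The tensor \<open>f\<^sub>1\<^sup>2 g\<^sub>1 \<oplus> f\<^sub>2\<^sup>2 g\<^sub>2\<close> on the product. The preferred charts of the product are
  products of preferred charts, so the differentials of the two projections are \<^const>\<open>fst\<close> and
  \<^const>\<open>snd\<close>, and \<open>g\<^sub>1\<close>, \<open>g\<^sub>2\<close> are pulled back along them.\<close>

definition warped_sum ::
  "('m \<times> 'n \<Rightarrow> real) \<Rightarrow> ('m, 'a) tensor2 \<Rightarrow> ('m \<times> 'n \<Rightarrow> real) \<Rightarrow> ('n, 'b) tensor2
     \<Rightarrow> ('m \<times> 'n, 'a \<times> 'b) tensor2" where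
  "warped_sum f1 g1 f2 g2 z v w =
     (f1 z)\<^sup>2 * g1 (fst z) (fst v) (fst w) + (f2 z)\<^sup>2 * g2 (snd z) (snd v) (snd w)"

section \<open>Scalar curvature\<close>

text \<open>Classical coordinate formulas for a metric \<open>G\<close> on a region of \<open>'a\<close>; the indices
  \<open>i, j, k, l, p\<close> range over \<^const>\<open>Basis\<close>, and \<open>partial i F x\<close> is the \<open>i\<close>-th partial derivative.\<close>

definition partial :: "'a::euclidean_space \<Rightarrow> ('a \<Rightarrow> real) \<Rightarrow> 'a \<Rightarrow> real" where
  "partial i F x = frechet_derivative F (at x) i"

text \<open>The entry \<open>g\<^sup>k\<^sup>l\<close> of the inverse matrix: the linear map inverted here has the matrix
  \<open>(g\<^sub>i\<^sub>j)\<close> with respect to \<^const>\<open>Basis\<close>.\<close>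

definition inv_metric :: "('a::euclidean_space \<Rightarrow> 'a \<Rightarrow> 'a \<Rightarrow> real) \<Rightarrow> 'a \<Rightarrow> 'a \<Rightarrow> 'a \<Rightarrow> real" where
  "inv_metric G k l x = inv (\<lambda>v. \<Sum>b\<in>Basis. G x v b *\<^sub>R b) l \<bullet> k"

text \<open>\<open>\<Gamma>\<^sup>k\<^sub>i\<^sub>j = 1/2 g\<^sup>k\<^sup>l (\<partial>\<^sub>i g\<^sub>j\<^sub>l + \<partial>\<^sub>j g\<^sub>i\<^sub>l - \<partial>\<^sub>l g\<^sub>i\<^sub>j)\<close>\<close>

definition christoffel ::
  "('a::euclidean_space \<Rightarrow> 'a \<Rightarrow> 'a \<Rightarrow> real) \<Rightarrow> 'a \<Rightarrow> 'a \<Rightarrow> 'a \<Rightarrow> 'a \<Rightarrow> real" where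
  "christoffel G k i j x =
     (1/2) * (\<Sum>l\<in>Basis. inv_metric G k l x *
        (partial i (\<lambda>y. G y j l) x + partial j (\<lambda>y. G y i l) x - partial l (\<lambda>y. G y i j) x))"

text \<open>The \<open>l\<close>-th component of \<open>R(\<partial>\<^sub>i, \<partial>\<^sub>j) \<partial>\<^sub>k\<close>, where
  \<open>R(X, Y) = [\<nabla>\<^sub>X, \<nabla>\<^sub>Y] - \<nabla>\<^sub>[\<^sub>X\<^sub>,\<^sub>Y\<^sub>]\<close>. With this and the trace below, round spheres have
  positive scalar curvature.\<close>

definition riemann ::
  "('a::euclidean_space \<Rightarrow> 'a \<Rightarrow> 'a \<Rightarrow> real) \<Rightarrow> 'a \<Rightarrow> 'a \<Rightarrow> 'a \<Rightarrow> 'a \<Rightarrow> 'a \<Rightarrow> real" where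
  "riemann G i j k l x =
     partial i (christoffel G l j k) x - partial j (christoffel G l i k) x +
     (\<Sum>p\<in>Basis. christoffel G l i p x * christoffel G p j k x -
                christoffel G l j p x * christoffel G p i k x)"

definition ricci :: "('a::euclidean_space \<Rightarrow> 'a \<Rightarrow> 'a \<Rightarrow> real) \<Rightarrow> 'a \<Rightarrow> 'a \<Rightarrow> 'a \<Rightarrow> real" where
  "ricci G j k x = (\<Sum>i\<in>Basis. riemann G i j k i x)"

text \<open>The scalar curvature at \<open>p\<close>, evaluated in the preferred chart; by tensoriality any other
  chart around \<open>p\<close> gives the same number.\<close>

definition scalar_curvature ::
  "('m, 'a::euclidean_space) manifold \<Rightarrow> ('m, 'a) tensor2 \<Rightarrow> 'm \<Rightarrow> real" where
  "scalar_curvature M g p =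
     (let c = chart_at M p; G = metric_in M g c; x = cmap c p
      in \<Sum>j\<in>Basis. \<Sum>k\<in>Basis. inv_metric G j k x * ricci G j k x)"

end

theory Submission
  imports Defs
begin

text \<open>Since \<open>f\<^sub>1 = w\<close> lives on \<open>M\<^sub>2\<close> and \<open>f\<^sub>2 = u\<close> on \<open>M\<^sub>1\<close>, the scalar curvature \<open>R\<close> of
  \<open>w\<^sup>2 g\<^sub>1 \<oplus> u\<^sup>2 g\<^sub>2\<close> contains no cross terms: with \<open>m = dim M\<^sub>1\<close> and \<open>n = dim M\<^sub>2\<close> one has
  \<open>u\<^sup>2 w\<^sup>2 R(x, y) = A(x) + B(y)\<close>, where
  \<open>A = u\<^sup>2 R\<^sub>1 - 2 n u \<Delta>u - n (n - 1) |\<nabla>u|\<^sup>2\<close> and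
  \<open>B = w\<^sup>2 R\<^sub>2 - 2 m w \<Delta>w - m (m - 1) |\<nabla>w|\<^sup>2\<close>.
  At a maximum of \<open>u\<close> we have \<open>A \<ge> 0\<close>, at a maximum of \<open>w\<close> we have \<open>B \<ge> 0\<close>; so \<open>R \<le> 0\<close> everywhere
  forces \<open>A \<le> 0\<close> and \<open>B \<le> 0\<close> everywhere. Then \<open>2 u \<Delta>u + (n - 1) |\<nabla>u|\<^sup>2 \<ge> 0\<close>, which is a linear elliptic
  inequality for \<open>u\<close> once one factor \<open>\<nabla>u\<close> is absorbed into the coefficients; by the strong maximum principle
  \<open>u\<close> is constant, so \<open>A = u\<^sup>2 R\<^sub>1 = 0\<close>. Likewise \<open>B = 0\<close>, hence \<open>R = 0\<close>.\<close>

section \<open>Calculus of directional derivatives\<close>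

text \<open>The variables separate because each metric is rescaled only by a function of the other
  factor: every Christoffel block of the sum is a function of \<open>x\<close> times a function of
  \<open>y\<close>. Mixed Ricci components may survive, but the trace pairs them with zero entries
  of the inverse metric. Two obstacles shape the proof. The inverse metric is defined by inverting a
  linear map, so its derivatives have to be produced from those of the metric. And
  \<open>scalar_curvature\<close> uses at each point the preferred chart of that point, which may
  jump, while the maximum principle needs one chart on a neighbourhood. The curvature term is
  discarded by its sign at each point before any chart is changed, so the quantities to be
  transported are \<open>laplacian\<close> and \<open>grad_sq\<close>; once \<open>u\<close> is
  constant, the curvature returns as u^2 R_1, again in the preferred chart.\<close>

lemma partial_eqI: "(f has_derivative f') (at x) \<Longrightarrow> partial v f x = f' v"
  unfolding partial_def using frechet_derivative_at by metis

lemma has_derivative_partial: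
  "f differentiable (at x) \<Longrightarrow> (f has_derivative (\<lambda>v. partial v f x)) (at x)"
  unfolding partial_def by (simp add: frechet_derivative_works)

lemma has_derivative_cong_open:
  assumes "open S" "x \<in> S" "\<And>y. y \<in> S \<Longrightarrow> f y = g y"
  shows "(f has_derivative f') (at x) \<longleftrightarrow> (g has_derivative f') (at x)"
  using assms by (metis has_derivative_transform_within_open)

lemma partial_cong:
  assumes "open S" "x \<in> S" "\<And>y. y \<in> S \<Longrightarrow> f y = g y"
  shows "partial v f x = partial v g x"
  unfolding partial_def frechet_derivative_def
  using has_derivative_cong_open[OF assms] assms by simp

lemma differentiable_cong_open:
  assumes "open S" "x \<in> S" "\<And>y. y \<in> S \<Longrightarrow> f y = g y"
  shows "f differentiable (at x) \<longleftrightarrow> g differentiable (at x)"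
  unfolding differentiable_def using has_derivative_cong_open[OF assms] assms by simp

lemma linear_partial: "f differentiable (at x) \<Longrightarrow> linear (\<lambda>v. partial v f x)"
  unfolding partial_def by (simp add: linear_frechet_derivative)

text \<open>At a zero of \<open>f\<close> the product rule asks only for continuity of
  \<open>g\<close>, since the term with a derivative of \<open>g\<close> carries the factor
  \<open>f x\<close>. The inverse metric becomes differentiable this way, with \<open>g\<close> an
  entry of the inverse that is so far known to be continuous.\<close>

lemma has_derivative_mult_zero:
  fixes f g :: "'a::real_normed_vector \<Rightarrow> real"
  assumes f: "(f has_derivative f') (at x)" and "f x = 0" and g: "isCont g x"
  shows "((\<lambda>y. f y * g y) has_derivative (\<lambda>h. f' h * g x)) (at x)"
proof -
  have bl: "bounded_linear f'" using f by (rule has_derivative_bounded_linear)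
  obtain K where K: "\<And>h. norm (f' h) \<le> norm h * K" "K \<ge> 0"
    using bounded_linear.nonneg_bounded[OF bl] by blast
  \<comment> \<open>The relative error of the linear approximation. The difference quotient of the
    product is \<open>q h * g (x + h)\<close> plus the bounded quotient \<open>f' h / norm h\<close>
    times the oscillation of \<open>g\<close>.\<close>
  define q where "q h = (f (x + h) - f x - f' h) / norm h" for h
  have q: "(q \<longlongrightarrow> 0) (at 0)"
  proof -
    have "((\<lambda>h. norm (q h)) \<longlongrightarrow> 0) (at 0)"
      using f unfolding has_derivative_at q_def by (simp add: abs_divide)
    then show ?thesis by (simp only: tendsto_norm_zero_iff)
  qed
  have g0: "((\<lambda>h. g (x + h)) \<longlongrightarrow> g x) (at 0)"
    using g by (simp add: isCont_iff)
  have "((\<lambda>h. q h * g (x+h)) \<longlongrightarrow> 0 * g x) (at 0)" by (intro tendsto_mult q g0)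
  moreover have "((\<lambda>h. (f' h / norm h) * (g (x + h) - g x)) \<longlongrightarrow> 0) (at 0)"
  proof (rule Lim_null_comparison)
    have "norm (f' h / norm h * (g (x + h) - g x)) \<le> K * norm (g (x+h) - g x)" for h
    proof -
      have "norm (f' h / norm h) \<le> K"
        using K(1)[of h] K(2) by (cases "h = 0") (auto simp: divide_simps mult.commute)
      then show ?thesis by (simp only: norm_mult mult_right_mono norm_ge_zero)
    qed
    then show "\<forall>\<^sub>F h in at 0. norm (f' h / norm h * (g (x + h) - g x)) \<le> K * norm (g (x+h) - g x)"
      by simp
    show "((\<lambda>h. K * norm (g (x+h) - g x)) \<longlongrightarrow> 0) (at 0)"
      using tendsto_mult_right_zero[OF tendsto_norm_zero[OF LIM_zero[OF g0]]] by simp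
  qed
  ultimately have "((\<lambda>h. q h * g (x+h) + (f' h / norm h) * (g (x + h) - g x)) \<longlongrightarrow> 0) (at 0)"
    using tendsto_add by fastforce
  then have "((\<lambda>h. (f (x + h) * g (x + h) - f x * g x - f' h * g x) / norm h) \<longlongrightarrow> 0) (at 0)"
    by (rule Lim_transform_eventually)
       (auto simp: q_def eventually_at \<open>f x = 0\<close> diff_divide_distrib algebra_simps intro!: exI[of _ 1])
  then have "((\<lambda>h. norm ((f (x + h) * g (x + h) - f x * g x - f' h * g x) / norm h)) \<longlongrightarrow> 0) (at 0)"
    by (simp only: tendsto_norm_zero_iff)
  then show ?thesis
    unfolding has_derivative_at
    by (auto simp: norm_divide intro: bounded_linear_mult_const[OF bl])
qed

text \<open>A product rule for a varying linear form applied to a varying vector; expanding the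
  vector over \<open>Basis\<close> reduces it to finitely many real products. Later \<open>L\<close>
  is the differential of a transition map applied to a fixed vector.\<close>

lemma has_derivative_linear_apply:
  fixes H :: "'a::euclidean_space \<Rightarrow> 'b::euclidean_space \<Rightarrow> real"
  assumes S: "open S" "x \<in> S" and lin: "\<And>y. y \<in> S \<Longrightarrow> linear (H y)"
    and H: "\<And>b. b \<in> Basis \<Longrightarrow> (\<lambda>y. H y b) differentiable (at x)"
    and L: "(L has_derivative L') (at x)"
  shows "((\<lambda>y. H y (L y)) has_derivative
            (\<lambda>v. partial v (\<lambda>y. H y (L x)) x + H x (L' v))) (at x)"
proof -
  have exp: "H y w = (\<Sum>b\<in>Basis. H y b * (w \<bullet> b))" if "y \<in> S" for y w
  proof -
    have "H y w = H y (\<Sum>b\<in>Basis. (w \<bullet> b) *\<^sub>R b)" by (simp add: euclidean_representation)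
    also have "\<dots> = (\<Sum>b\<in>Basis. H y b * (w \<bullet> b))"
      using lin[OF that] by (simp add: linear_sum linear_scale mult.commute)
    finally show ?thesis .
  qed
  have dH: "((\<lambda>y. H y b) has_derivative (\<lambda>v. partial v (\<lambda>y. H y b) x)) (at x)"
    if "b \<in> Basis" for b using has_derivative_partial[OF H[OF that]] .
  have "((\<lambda>y. \<Sum>b\<in>Basis. H y b * (L x \<bullet> b)) has_derivative
      (\<lambda>v. \<Sum>b\<in>Basis. partial v (\<lambda>y. H y b) x * (L x \<bullet> b))) (at x)"
    by (auto intro!: derivative_eq_intros dH)
  then have "((\<lambda>y. H y (L x)) has_derivative
      (\<lambda>v. \<Sum>b\<in>Basis. partial v (\<lambda>y. H y b) x * (L x \<bullet> b))) (at x)"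
    by (subst has_derivative_cong_open[OF S exp[of _ "L x"]])
  from partial_eqI[OF this] have p: "partial v (\<lambda>y. H y (L x)) x =
      (\<Sum>b\<in>Basis. partial v (\<lambda>y. H y b) x * (L x \<bullet> b))" for v .
  have "((\<lambda>y. \<Sum>b\<in>Basis. H y b * (L y \<bullet> b)) has_derivative
      (\<lambda>v. \<Sum>b\<in>Basis. H x b * (L' v \<bullet> b) + partial v (\<lambda>y. H y b) x * (L x \<bullet> b))) (at x)"
    by (auto intro!: derivative_eq_intros dH L)
  then have "((\<lambda>y. H y (L y)) has_derivative
      (\<lambda>v. \<Sum>b\<in>Basis. H x b * (L' v \<bullet> b) + partial v (\<lambda>y. H y b) x * (L x \<bullet> b))) (at x)"
    by (subst has_derivative_cong_open[OF S exp])
  then show ?thesis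
    by (simp add: p exp[OF S(2), of "L' _"] sum.distrib add.commute)
qed

text \<open>The second difference of \<open>f\<close> over a small parallelogram equals h^2 times
  either mixed derivative at some nearby point, by the mean value theorem applied twice; continuity
  at \<open>x\<close> identifies the two limits. Coordinate changes need this for the second
  derivative of a transition map.\<close>

lemma symmetric_second_derivative:
  fixes f :: "'a::euclidean_space \<Rightarrow> real"
  assumes S: "open S" "x \<in> S"
    and f: "\<And>y. y \<in> S \<Longrightarrow> f differentiable (at y)"
    and fu: "\<And>y. y \<in> S \<Longrightarrow> partial u f differentiable (at y)"
    and fv: "\<And>y. y \<in> S \<Longrightarrow> partial v f differentiable (at y)"
    and c: "isCont (partial v (partial u f)) x" "isCont (partial u (partial v f)) x"
  shows "partial v (partial u f) x = partial u (partial v f) x"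
proof -
  have mvt: "\<exists>z. \<bar>z\<bar> \<le> 1 \<and> 0 \<le> z \<and> g (y + h *\<^sub>R w) - g y = h * partial w g (y + (z * h) *\<^sub>R w)"
    if "h > 0" and g: "\<And>t. 0 \<le> t \<Longrightarrow> t \<le> h \<Longrightarrow> g differentiable (at (y + t *\<^sub>R w))"
    for h y w and g :: "'a \<Rightarrow> real"
  proof -
    have d: "((\<lambda>t. g (y + t *\<^sub>R w)) has_field_derivative partial w g (y + t *\<^sub>R w)) (at t)"
      if "0 \<le> t" "t \<le> h" for t
    proof -
      have "((\<lambda>t. g (y + t *\<^sub>R w)) has_derivative (\<lambda>s. partial (s *\<^sub>R w) g (y + t *\<^sub>R w))) (at t)"
      proof -
        have "((\<lambda>t. y + t *\<^sub>R w) has_derivative (\<lambda>s. s *\<^sub>R w)) (at t)"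
          by (auto intro!: derivative_eq_intros)
        from has_derivative_compose[OF this, of g "\<lambda>v. partial v g (y + t *\<^sub>R w)"]
        show ?thesis using has_derivative_partial[OF g[OF that]] by simp
      qed
      moreover have "partial (s *\<^sub>R w) g (y + t *\<^sub>R w) = partial w g (y + t *\<^sub>R w) * s" for s
        using linear_scale[OF linear_partial[OF g[OF that]]] by simp
      ultimately show ?thesis by (simp add: has_field_derivative_def)
    qed
    obtain z where z: "0 < z" "z < h"
      "g (y + h *\<^sub>R w) - g (y + 0 *\<^sub>R w) = (h - 0) * partial w g (y + z *\<^sub>R w)"
      using MVT2[of 0 h "\<lambda>t. g (y + t *\<^sub>R w)" "\<lambda>t. partial w g (y + t *\<^sub>R w)"] d \<open>h > 0\<close> by blast
    show ?thesis
      using z \<open>h > 0\<close> by (intro exI[of _ "z / h"]) (auto simp: field_simps)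
  qed
  obtain r where r: "r > 0" "ball x r \<subseteq> S" using S openE by blast
  have main: "\<exists>z. norm (z - x) \<le> h * (norm a + norm b) \<and>
      f (x + h *\<^sub>R a + h *\<^sub>R b) - f (x + h *\<^sub>R a) - f (x + h *\<^sub>R b) + f x
        = h * h * partial b (partial a f) z"
    if h: "h > 0" "h * (norm a + norm b) < r"
      and fa: "\<And>y. y \<in> S \<Longrightarrow> partial a f differentiable (at y)" for h a b
  proof -
    have inS: "x + s *\<^sub>R a + t *\<^sub>R b \<in> S" and
      nrm: "norm (s *\<^sub>R a + t *\<^sub>R b) \<le> h * (norm a + norm b)"
      if "0 \<le> s" "s \<le> h" "0 \<le> t" "t \<le> h" for s t
    proof -
      have "norm (s *\<^sub>R a + t *\<^sub>R b) \<le> s * norm a + t * norm b"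
        using norm_triangle_ineq[of "s *\<^sub>R a" "t *\<^sub>R b"] that by simp
      also have "\<dots> \<le> h * (norm a + norm b)"
        using that by (simp add: distrib_left add_mono mult_right_mono)
      finally show 1: "norm (s *\<^sub>R a + t *\<^sub>R b) \<le> h * (norm a + norm b)" .
      have "dist x (x + s *\<^sub>R a + t *\<^sub>R b) = norm (s *\<^sub>R a + t *\<^sub>R b)"
        by (simp add: dist_norm norm_minus_commute algebra_simps)
      then show "x + s *\<^sub>R a + t *\<^sub>R b \<in> S" using 1 h r by auto
    qed
    let ?g = "\<lambda>y. f (y + h *\<^sub>R b) - f y"
    have gd: "(?g has_derivative (\<lambda>w. partial w f (y + h *\<^sub>R b) - partial w f y)) (at y)"
      if "y \<in> S" "y + h *\<^sub>R b \<in> S" for y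
    proof -
      have "((\<lambda>t. t + h *\<^sub>R b) has_derivative (\<lambda>s. s)) (at y)"
        by (auto intro!: derivative_eq_intros)
      from has_derivative_compose[OF this, of f "\<lambda>v. partial v f (y + h *\<^sub>R b)"]
      have "((\<lambda>y. f (y + h *\<^sub>R b)) has_derivative (\<lambda>w. partial w f (y + h *\<^sub>R b))) (at y)"
        using has_derivative_partial[OF f[OF that(2)]] by simp
      then show ?thesis
        using has_derivative_diff has_derivative_partial[OF f[OF that(1)]] by blast
    qed
    have in2: "x + t *\<^sub>R a \<in> S" "x + t *\<^sub>R a + h *\<^sub>R b \<in> S" if "0 \<le> t" "t \<le> h" for t
      using inS[of t 0] inS[of t h] that h by auto
    have "?g differentiable (at (x + t *\<^sub>R a))" if "0 \<le> t" "t \<le> h" for t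
      using gd[OF in2[OF that]] unfolding differentiable_def by blast
    from mvt[OF h(1), of ?g x a, OF this] obtain z1 where z1: "\<bar>z1\<bar> \<le> 1" "0 \<le> z1"
      "?g (x + h *\<^sub>R a) - ?g x = h * partial a ?g (x + (z1 * h) *\<^sub>R a)" by blast
    have z1h: "0 \<le> z1 * h" "z1 * h \<le> h"
      using z1 h by (auto simp: mult_left_le_one_le)
    have e: "partial a ?g (x + (z1 * h) *\<^sub>R a)
      = partial a f (x + (z1 * h) *\<^sub>R a + h *\<^sub>R b) - partial a f (x + (z1 * h) *\<^sub>R a)"
      using partial_eqI[OF gd[OF in2[OF z1h]]] .
    have "partial a f differentiable (at (x + (z1 * h) *\<^sub>R a + t *\<^sub>R b))" if "0 \<le> t" "t \<le> h" for t
      using fa inS[OF z1h that] by blast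
    from mvt[OF h(1) this] obtain z2 where z2: "\<bar>z2\<bar> \<le> 1" "0 \<le> z2"
      "partial a f (x + (z1 * h) *\<^sub>R a + h *\<^sub>R b) - partial a f (x + (z1 * h) *\<^sub>R a)
        = h * partial b (partial a f) (x + (z1 * h) *\<^sub>R a + (z2 * h) *\<^sub>R b)" by blast
    have z2h: "0 \<le> z2 * h" "z2 * h \<le> h"
      using z2 h by (auto simp: mult_left_le_one_le)
    show ?thesis
      using nrm[OF z1h z2h] z1(3) z2(3) e
      by (intro exI[of _ "x + (z1 * h) *\<^sub>R a + (z2 * h) *\<^sub>R b"]) (auto simp: algebra_simps)
  qed
  show ?thesis
  proof (rule ccontr)
    assume ne: "partial v (partial u f) x \<noteq> partial u (partial v f) x"
    \<comment> \<open>Half the gap: a common value cannot lie within \<open>e\<close> of both mixed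
      derivatives at \<open>x\<close>.\<close>
    define e where "e = \<bar>partial v (partial u f) x - partial u (partial v f) x\<bar> / 2"
    have "e > 0" using ne by (simp add: e_def)
    obtain d1 where d1: "d1 > 0"
      "\<And>z. norm (z - x) < d1 \<Longrightarrow> \<bar>partial v (partial u f) z - partial v (partial u f) x\<bar> < e"
      using c(1) \<open>e > 0\<close> unfolding continuous_at_eps_delta dist_norm real_norm_def by blast
    obtain d2 where d2: "d2 > 0"
      "\<And>z. norm (z - x) < d2 \<Longrightarrow> \<bar>partial u (partial v f) z - partial u (partial v f) x\<bar> < e"
      using c(2) \<open>e > 0\<close> unfolding continuous_at_eps_delta dist_norm real_norm_def by blast
    \<comment> \<open>The summand 1 keeps the denominator of \<open>h\<close> positive when both
      directions are zero.\<close>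
    define n where "n = norm u + norm v + 1"
    define h where "h = min r (min d1 d2) / (2 * n)"
    have n: "n > 0" by (simp add: n_def add_nonneg_pos)
    have h: "h > 0" using n r d1 d2 by (simp add: h_def)
    have "h * n = min r (min d1 d2) / 2" using n by (simp add: h_def)
    moreover have "h * (norm u + norm v) \<le> h * n" using h by (simp add: n_def)
    ultimately have hb: "h * (norm u + norm v) < r" "h * (norm u + norm v) < d1"
      "h * (norm u + norm v) < d2" using r(1) d1(1) d2(1) by (auto simp: min_def split: if_splits)
    obtain z where z: "norm (z - x) \<le> h * (norm u + norm v)"
      "f (x + h *\<^sub>R u + h *\<^sub>R v) - f (x + h *\<^sub>R u) - f (x + h *\<^sub>R v) + f x
        = h * h * partial v (partial u f) z"
      using main[OF h hb(1) fu] by blast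
    obtain z' where z': "norm (z' - x) \<le> h * (norm v + norm u)"
      "f (x + h *\<^sub>R v + h *\<^sub>R u) - f (x + h *\<^sub>R v) - f (x + h *\<^sub>R u) + f x
        = h * h * partial u (partial v f) z'"
      using main[of h v u, OF h _ fv] hb(1) by (auto simp: add.commute)
    have "h * h * partial v (partial u f) z = h * h * partial u (partial v f) z'"
      using z(2) z'(2) by (simp add: algebra_simps)
    then have "partial v (partial u f) z = partial u (partial v f) z'" using h by simp
    moreover have "\<bar>partial v (partial u f) z - partial v (partial u f) x\<bar> < e"
      using d1 z hb by force
    moreover have "\<bar>partial u (partial v f) z' - partial u (partial v f) x\<bar> < e"
      using d2 z' hb by (force simp: add.commute)
    ultimately show False unfolding e_def abs_if by (auto simp: field_simps split: if_splits)
  qed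
qed


section \<open>Inverse metrics\<close>

definition inner_form :: "('a::euclidean_space \<Rightarrow> 'a \<Rightarrow> real) \<Rightarrow> bool" where
  "inner_form B \<longleftrightarrow> bilinear B \<and> (\<forall>v w. B v w = B w v) \<and> (\<forall>v. v \<noteq> 0 \<longrightarrow> B v v > 0)"

text \<open>The musical isomorphism raising an index. Covectors are represented by vectors through
  the Euclidean inner product, so \<open>sharp B l\<close> is the \<open>B\<close>-gradient of the
  functional \<open>\<lambda>w. l \<bullet> w\<close>.\<close>

definition sharp :: "('a::euclidean_space \<Rightarrow> 'a \<Rightarrow> real) \<Rightarrow> 'a \<Rightarrow> 'a" where
  "sharp B = inv (\<lambda>v. \<Sum>b\<in>Basis. B v b *\<^sub>R b)"

lemma inv_metric_eq_sharp: "inv_metric G k l x = sharp (G x) l \<bullet> k"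
  by (simp add: inv_metric_def sharp_def)

lemma inner_formD:
  assumes "inner_form B"
  shows "bilinear B" "\<And>v w. B v w = B w v" "\<And>v. v \<noteq> 0 \<Longrightarrow> B v v > 0"
    "\<And>v. linear (B v)" "\<And>w. linear (\<lambda>v. B v w)"
  using assms by (auto simp: inner_form_def bilinear_def)

lemma bilinear_sum_left:
  assumes "bilinear B" shows "B (\<Sum>i\<in>I. c i *\<^sub>R e i) w = (\<Sum>i\<in>I. c i * (B (e i) w :: real))"
proof -
  have l: "linear (\<lambda>v. B v w)" using assms by (simp add: bilinear_def)
  show ?thesis by (simp add: linear_sum[OF l] linear_scale[OF l])
qed

lemma bilinear_sum_right:
  assumes "bilinear B" shows "B w (\<Sum>i\<in>I. c i *\<^sub>R e i) = (\<Sum>i\<in>I. c i * (B w (e i) :: real))"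
proof -
  have l: "linear (B w)" using assms by (simp add: bilinear_def)
  show ?thesis by (simp add: linear_sum[OF l] linear_scale[OF l])
qed

lemma flat_inner:
  assumes "bilinear (B :: 'a::euclidean_space \<Rightarrow> 'a \<Rightarrow> real)"
  shows "(\<Sum>b\<in>Basis. B v b *\<^sub>R b) \<bullet> w = B v w"
proof -
  have "B v w = B v (\<Sum>b\<in>Basis. (w \<bullet> b) *\<^sub>R b)" by (simp add: euclidean_representation)
  also have "\<dots> = (\<Sum>b\<in>Basis. (w \<bullet> b) * B v b)" by (rule bilinear_sum_right[OF assms])
  finally show ?thesis by (simp add: inner_sum_left inner_commute[of w] mult.commute)
qed

text \<open>Positive definiteness makes the index-lowering map injective, hence bijective in finite
  dimension, so the \<open>inv\<close> in \<open>sharp\<close> is a genuine two-sided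
  inverse.\<close>

lemma
  assumes B: "inner_form B"
  shows sharp: "B (sharp B l) w = l \<bullet> w"
    and sharp_unique: "(\<And>b. b \<in> Basis \<Longrightarrow> B z b = l \<bullet> b) \<Longrightarrow> sharp B l = z"
    and linear_sharp: "linear (sharp B)"
proof -
  let ?A = "\<lambda>v. \<Sum>b\<in>Basis. B v b *\<^sub>R b"
  note bil = inner_formD(1)[OF B]
  have A: "?A v \<bullet> w = B v w" for v w by (rule flat_inner[OF bil])
  have lin: "linear ?A"
  proof (rule linearI)
    show "?A (x + y) = ?A x + ?A y" for x y
      by (simp add: linear_add[OF inner_formD(5)[OF B]] scaleR_add_left sum.distrib)
    show "?A (r *\<^sub>R x) = r *\<^sub>R ?A x" for r x
      by (simp add: linear_scale[OF inner_formD(5)[OF B]] scaleR_sum_right)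
  qed
  have inj: "inj ?A"
    unfolding linear_injective_0[OF lin]
  proof (intro allI impI)
    fix v assume "?A v = 0"
    then have "B v v = 0" using A[of v v] by simp
    then show "v = 0" using inner_formD(3)[OF B, of v] by fastforce
  qed
  have surj: "surj ?A" using lin inj by (rule linear_inj_imp_surj)
  have 1: "?A (sharp B l) = l" for l unfolding sharp_def using surj by (rule surj_f_inv_f)
  have 2: "sharp B (?A v) = v" for v unfolding sharp_def using inj by (rule inv_f_f)
  show "B (sharp B l) w = l \<bullet> w" using A[of "sharp B l" w] 1[of l] by simp
  show "sharp B l = z" if "\<And>b. b \<in> Basis \<Longrightarrow> B z b = l \<bullet> b"
  proof -
    have "?A z = l"
    proof (rule euclidean_eqI)
      show "?A z \<bullet> b = l \<bullet> b" if "b \<in> Basis" for b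
        using A[of z b] \<open>\<And>b. b \<in> Basis \<Longrightarrow> B z b = l \<bullet> b\<close>[OF that] by (simp only:)
    qed
    then show ?thesis using 2 by blast
  qed
  show "linear (sharp B)"
  proof (rule linearI)
    show "sharp B (x + y) = sharp B x + sharp B y" for x y
      using 1[of x] 1[of y] 2[of "sharp B x + sharp B y"] linear_add[OF lin] by simp
    show "sharp B (r *\<^sub>R x) = r *\<^sub>R sharp B x" for r x
      using 1[of x] 2[of "r *\<^sub>R sharp B x"] linear_scale[OF lin] by simp
  qed
qed

lemma sharp_sym: "inner_form B \<Longrightarrow> sharp B k \<bullet> l = sharp B l \<bullet> k"
  using sharp[of B k "sharp B l"] sharp[of B l "sharp B k"] inner_formD(2)[of B "sharp B k" "sharp B l"]
  by (simp add: inner_commute)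

lemma inv_metric_sym: "inner_form (G x) \<Longrightarrow> inv_metric G k l x = inv_metric G l k x"
  by (simp add: inv_metric_eq_sharp sharp_sym)

lemma sum_inv_metric_mult:
  assumes B: "inner_form (G x)"
  shows "(\<Sum>l\<in>Basis. inv_metric G k l x * G x l m) = k \<bullet> m"
proof -
  have "(\<Sum>l\<in>Basis. inv_metric G k l x * G x l m) = (\<Sum>l\<in>Basis. (G x m l *\<^sub>R sharp (G x) l) \<bullet> k)"
    by (simp add: inv_metric_eq_sharp inner_formD(2)[OF B, of m] mult.commute)
  also have "\<dots> = sharp (G x) (\<Sum>l\<in>Basis. G x m l *\<^sub>R l) \<bullet> k"
    by (simp add: linear_sum[OF linear_sharp[OF B]] linear_scale[OF linear_sharp[OF B]]
        inner_sum_left del: inner_sum_left_Basis)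
  also have "\<dots> = m \<bullet> k"
    by (subst sharp_unique[OF B, of m]) (simp_all add: flat_inner[OF inner_formD(1)[OF B]])
  finally show ?thesis by (simp add: inner_commute)
qed

lemma sum_metric_mult_inv:
  assumes B: "inner_form (G x)"
  shows "(\<Sum>l\<in>Basis. G x m l * inv_metric G l k x) = k \<bullet> m"
proof -
  have "(\<Sum>l\<in>Basis. G x m l * inv_metric G l k x) = (\<Sum>l\<in>Basis. inv_metric G k l x * G x l m)"
    by (rule sum.cong) (simp_all add: inner_formD(2)[OF B, of m] inv_metric_sym[of G x, OF B, of _ k] mult.commute)
  then show ?thesis using sum_inv_metric_mult[of G x k m, OF B] by simp
qed

text \<open>The constant is the minimum of the quadratic form on the unit sphere; homogeneity
  extends the bound to all vectors.\<close>

lemma inner_form_lower_bound: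
  assumes B: "inner_form B"
  shows "\<exists>c>0. \<forall>v. B v v \<ge> c * (norm v)\<^sup>2"
proof -
  have bb: "bounded_bilinear B"
    using inner_formD(1)[OF B] by (simp add: bilinear_conv_bounded_bilinear)
  have "continuous_on (sphere 0 1) (\<lambda>v. B v v)"
    by (intro bounded_bilinear.continuous_on[OF bb] continuous_on_id)
  then obtain v0 where v0: "v0 \<in> sphere 0 1" "\<And>v. v \<in> sphere 0 1 \<Longrightarrow> B v0 v0 \<le> B v v"
    using continuous_attains_inf[of "sphere 0 1" "\<lambda>v. B v v"] by (auto simp: sphere_eq_empty)
  have "B v v \<ge> B v0 v0 * (norm v)\<^sup>2" for v
  proof (cases "v = 0")
    case True then show ?thesis by (simp add: linear_0[OF inner_formD(4)[OF B]])
  next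
    case False
    let ?u = "v /\<^sub>R norm v"
    have "B v0 v0 \<le> B ?u ?u" using False by (intro v0(2)) simp
    also have "B ?u ?u = B v v / (norm v)\<^sup>2"
      by (simp add: linear_scale[OF inner_formD(4)[OF B]] linear_scale[OF inner_formD(5)[OF B]]
          power2_eq_square divide_inverse)
    finally show ?thesis using False by (simp add: field_simps)
  qed
  moreover have "B v0 v0 > 0" using v0(1) by (intro inner_formD(3)[OF B]) auto
  ultimately show ?thesis by blast
qed

text \<open>Two rounds of differentiability serve the Christoffel symbols and their first
  derivatives. The vectors range over the whole space and not only over \<open>Basis\<close>, so
  that images under a differential can be inserted directly.\<close>

definition metric_on :: "'a::euclidean_space set \<Rightarrow> ('a \<Rightarrow> 'a \<Rightarrow> 'a \<Rightarrow> real) \<Rightarrow> bool" where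
  "metric_on S G \<longleftrightarrow> open S \<and> (\<forall>x\<in>S. inner_form (G x) \<and>
     (\<forall>v w. (\<lambda>y. G y v w) differentiable (at x) \<and>
       (\<forall>u. partial u (\<lambda>y. G y v w) differentiable (at x))))"

lemma metric_onD:
  assumes "metric_on S G"
  shows "open S" "x \<in> S \<Longrightarrow> inner_form (G x)"
    "x \<in> S \<Longrightarrow> (\<lambda>y. G y v w) differentiable (at x)"
    "x \<in> S \<Longrightarrow> partial u (\<lambda>y. G y v w) differentiable (at x)"
  using assms by (auto simp: metric_on_def)

text \<open>Close to \<open>x\<close> the coefficients differ from those at \<open>x\<close> by less
  than half the lower bound of \<open>G x\<close>, so half of that bound persists; Cauchy-Schwarz
  converts it into a bound for the inverse. This a priori bound comes before any continuity of the
  inverse.\<close>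

lemma sharp_locally_bounded:
  assumes G: "metric_on S G" and x: "x \<in> S"
  shows "\<exists>K. \<forall>\<^sub>F y in at x. \<forall>l. norm (sharp (G y) l) \<le> K * norm l"
proof -
  obtain c where c: "c > 0" "\<And>v. G x v v \<ge> c * (norm v)\<^sup>2"
    using inner_form_lower_bound[OF metric_onD(2)[OF G x]] by blast
  define e where "e y = (\<Sum>i\<in>Basis. \<Sum>j\<in>Basis. \<bar>G y i j - G x i j\<bar>)" for y
  have "(e \<longlongrightarrow> (\<Sum>i\<in>(Basis::'a set). \<Sum>j\<in>(Basis::'a set). \<bar>G x i j - G x i j\<bar>)) (at x)"
    unfolding e_def
    using differentiable_imp_continuous_within[OF metric_onD(3)[OF G x]]
    by (intro tendsto_intros) (simp add: continuous_within)
  then have "(e \<longlongrightarrow> 0) (at x)" by simp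
  then have "\<forall>\<^sub>F y in at x. e y < c / 2" using c(1) by (intro order_tendstoD) auto
  moreover have "\<forall>\<^sub>F y in at x. y \<in> S"
    using metric_onD(1)[OF G] x by (auto simp: eventually_at_topological)
  ultimately have "\<forall>\<^sub>F y in at x. \<forall>l. norm (sharp (G y) l) \<le> (2 / c) * norm l"
  proof eventually_elim
    case (elim y)
    note B = metric_onD(2)[OF G elim(2)] and Bx = metric_onD(2)[OF G x]
    have exp: "B v v = (\<Sum>i\<in>Basis. \<Sum>j\<in>Basis. (v \<bullet> i) * (v \<bullet> j) * B i j)"
      if "bilinear B" for v :: 'a and B :: "'a \<Rightarrow> 'a \<Rightarrow> real"
    proof -
      have "B v v = B (\<Sum>i\<in>Basis. (v \<bullet> i) *\<^sub>R i) (\<Sum>j\<in>Basis. (v \<bullet> j) *\<^sub>R j)"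
        by (simp add: euclidean_representation)
      also have "\<dots> = (\<Sum>i\<in>Basis. (v \<bullet> i) * B i (\<Sum>j\<in>Basis. (v \<bullet> j) *\<^sub>R j))"
        by (rule bilinear_sum_left[OF that])
      finally show ?thesis
        by (simp only: bilinear_sum_right[OF that] sum_distrib_left mult.assoc)
    qed
    have low: "G y v v \<ge> c / 2 * (norm v)\<^sup>2" for v
    proof -
      have "\<bar>G y v v - G x v v\<bar> = \<bar>\<Sum>i\<in>Basis. \<Sum>j\<in>Basis. (v \<bullet> i) * (v \<bullet> j) * (G y i j - G x i j)\<bar>"
        by (simp add: exp[OF inner_formD(1)[OF B], of v] exp[OF inner_formD(1)[OF Bx], of v]
            right_diff_distrib sum_subtractf)
      also have "\<dots> \<le> (\<Sum>i\<in>Basis. \<Sum>j\<in>Basis. \<bar>(v \<bullet> i) * (v \<bullet> j) * (G y i j - G x i j)\<bar>)"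
        by (rule order_trans[OF sum_abs sum_mono[OF sum_abs]])
      also have "\<dots> \<le> (\<Sum>i\<in>Basis. \<Sum>j\<in>Basis. (norm v)\<^sup>2 * \<bar>G y i j - G x i j\<bar>)"
        by (intro sum_mono)
           (auto simp: abs_mult power2_eq_square Basis_le_norm intro!: mult_right_mono mult_mono)
      also have "\<dots> = (norm v)\<^sup>2 * e y" by (simp add: e_def sum_distrib_left)
      also have "\<dots> \<le> (norm v)\<^sup>2 * (c / 2)" using elim(1) by (intro mult_left_mono) auto
      finally have "\<bar>G y v v - G x v v\<bar> \<le> c / 2 * (norm v)\<^sup>2" by (simp add: mult.commute)
      moreover have "c * (norm v)\<^sup>2 = c / 2 * (norm v)\<^sup>2 + c / 2 * (norm v)\<^sup>2" by simp
      ultimately show ?thesis using c(2)[of v] by linarith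
    qed
    show ?case
    proof
      fix l
      let ?z = "sharp (G y) l"
      have "c / 2 * (norm ?z)\<^sup>2 \<le> l \<bullet> ?z" using low[of ?z] sharp[OF B] by simp
      also have "\<dots> \<le> norm l * norm ?z" by (rule norm_cauchy_schwarz)
      finally have "(c / 2 * norm ?z) * norm ?z \<le> norm l * norm ?z" by (simp add: power2_eq_square)
      then have "c / 2 * norm ?z \<le> norm l" by (cases "?z = 0") auto
      then show "norm ?z \<le> (2 / c) * norm l" using c(1) by (simp add: field_simps)
    qed
  qed
  then show ?thesis by blast
qed

text \<open>The resolvent identity B^-1 - A^-1 = - A^-1 (B - A) B^-1 in coordinates, with A the
  metric at \<open>x\<close> and B the metric at \<open>y\<close>.\<close>

lemma inv_metric_diff:
  assumes B: "inner_form (G x)" "inner_form (G y)"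
  shows "inv_metric G k l y - inv_metric G k l x
    = - (\<Sum>p\<in>Basis. \<Sum>q\<in>Basis. inv_metric G k p x * (G y p q - G x p q) * inv_metric G q l y)"
proof -
  have "(\<Sum>p\<in>Basis. \<Sum>q\<in>Basis. inv_metric G k p x * (G y p q - G x p q) * inv_metric G q l y)
    = (\<Sum>p\<in>Basis. inv_metric G k p x * (\<Sum>q\<in>Basis. G y p q * inv_metric G q l y))
    - (\<Sum>q\<in>Basis. (\<Sum>p\<in>Basis. inv_metric G k p x * G x p q) * inv_metric G q l y)"
    (is "_ = ?a - ?b")
    by (simp add: sum_distrib_left sum_distrib_right algebra_simps sum_subtractf)
       (subst (2) sum.swap, simp)
  moreover have "?a = inv_metric G k l x"
  proof -
    have "?a = (\<Sum>p\<in>Basis. inv_metric G k p x * (l \<bullet> p))"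
      by (simp only: sum_metric_mult_inv[of G y, OF B(2)])
    also have "\<dots> = (\<Sum>p\<in>Basis. (sharp (G x) k \<bullet> p) * (l \<bullet> p))"
      by (simp only: inv_metric_eq_sharp sharp_sym[OF B(1), of k])
    also have "\<dots> = sharp (G x) k \<bullet> l" by (rule euclidean_inner[symmetric])
    finally show ?thesis by (simp only: inv_metric_eq_sharp sharp_sym[OF B(1), of k])
  qed
  moreover have "?b = inv_metric G k l y"
  proof -
    have "?b = (\<Sum>q\<in>Basis. (k \<bullet> q) * inv_metric G q l y)"
      by (simp only: sum_inv_metric_mult[of G x, OF B(1)])
    also have "\<dots> = (\<Sum>q\<in>Basis. (k \<bullet> q) * (sharp (G y) l \<bullet> q))"
      by (simp only: inv_metric_eq_sharp)
    also have "\<dots> = k \<bullet> sharp (G y) l" by (rule euclidean_inner[symmetric])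
    finally show ?thesis by (simp only: inv_metric_eq_sharp inner_commute)
  qed
  ultimately show ?thesis by simp
qed

text \<open>The resolvent identity is used twice: together with the local bound it gives continuity
  of the inverse, and then differentiability, because the middle factor vanishes at \<open>x\<close>
  and continuity of the last factor is enough for the product rule.\<close>

lemma inv_metric_has_derivative:
  assumes G: "metric_on S G" and x: "x \<in> S"
  shows "((\<lambda>y. inv_metric G k l y) has_derivative (\<lambda>v. - (\<Sum>p\<in>Basis. \<Sum>q\<in>Basis.
      inv_metric G k p x * partial v (\<lambda>y. G y p q) x * inv_metric G q l x))) (at x)"
proof -
  note Gx = metric_onD(2)[OF G x]
  obtain K where K: "\<forall>\<^sub>F y in at x. \<forall>l. norm (sharp (G y) l) \<le> K * norm l"
    using sharp_locally_bounded[OF G x] by blast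
  have inS: "\<forall>\<^sub>F y in at x. y \<in> S"
    using metric_onD(1)[OF G] x by (auto simp: eventually_at_topological)
  have cont: "isCont (inv_metric G k l) x" for k l
  proof -
    have "((\<lambda>y. \<Sum>p\<in>Basis. \<Sum>q\<in>Basis. inv_metric G k p x * ((G y p q - G x p q) * inv_metric G q l y))
        \<longlongrightarrow> (\<Sum>p\<in>(Basis::'a set). \<Sum>q\<in>(Basis::'a set). inv_metric G k p x * 0)) (at x)"
    proof (intro tendsto_intros)
      fix p q :: 'a assume pq: "p \<in> Basis" "q \<in> Basis"
      show "((\<lambda>y. (G y p q - G x p q) * inv_metric G q l y) \<longlongrightarrow> 0) (at x)"
      proof (rule Lim_null_comparison)
        show "\<forall>\<^sub>F y in at x. norm ((G y p q - G x p q) * inv_metric G q l y)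
            \<le> \<bar>G y p q - G x p q\<bar> * (K * norm l)"
          using K
        proof eventually_elim
          case (elim y)
          have "\<bar>inv_metric G q l y\<bar> \<le> norm (sharp (G y) l)"
            unfolding inv_metric_eq_sharp using pq Basis_le_norm by blast
          also have "\<dots> \<le> K * norm l" using elim by blast
          finally show ?case by (simp add: abs_mult mult_left_mono)
        qed
        have "((\<lambda>y. G y p q) \<longlongrightarrow> G x p q) (at x)"
          using differentiable_imp_continuous_within[OF metric_onD(3)[OF G x]]
          by (simp add: continuous_within)
        from tendsto_mult_left_zero[OF tendsto_rabs_zero[OF LIM_zero[OF this]]]
        show "((\<lambda>y. \<bar>G y p q - G x p q\<bar> * (K * norm l)) \<longlongrightarrow> 0) (at x)" .
      qed
    qed
    then have "((\<lambda>y. \<Sum>p\<in>Basis. \<Sum>q\<in>Basis. inv_metric G k p x * ((G y p q - G x p q) * inv_metric G q l y))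
        \<longlongrightarrow> 0) (at x)" by simp
    from tendsto_minus[OF this]
    have "((\<lambda>y. - (\<Sum>p\<in>Basis. \<Sum>q\<in>Basis. inv_metric G k p x * (G y p q - G x p q) * inv_metric G q l y))
        \<longlongrightarrow> 0) (at x)" by (simp add: mult.assoc)
    moreover have "\<forall>\<^sub>F y in at x. - (\<Sum>p\<in>Basis. \<Sum>q\<in>Basis. inv_metric G k p x * (G y p q - G x p q)
        * inv_metric G q l y) = inv_metric G k l y - inv_metric G k l x"
      by (rule eventually_mono[OF inS])
         (simp add: inv_metric_diff[of G x, OF Gx metric_onD(2)[OF G]])
    ultimately have "((\<lambda>y. inv_metric G k l y - inv_metric G k l x) \<longlongrightarrow> 0) (at x)"
      by (rule Lim_transform_eventually)
    then show ?thesis by (simp add: isCont_def LIM_zero_iff)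
  qed
  have "((\<lambda>y. (G y p q - G x p q) * inv_metric G q l y) has_derivative
      (\<lambda>v. partial v (\<lambda>y. G y p q) x * inv_metric G q l x)) (at x)" for p q
    by (rule has_derivative_mult_zero)
       (auto intro!: derivative_eq_intros has_derivative_partial metric_onD(3)[OF G x] cont)
  then have "((\<lambda>y. inv_metric G k l x - (\<Sum>p\<in>Basis. \<Sum>q\<in>Basis. inv_metric G k p x *
        ((G y p q - G x p q) * inv_metric G q l y))) has_derivative
      (\<lambda>v. - (\<Sum>p\<in>Basis. \<Sum>q\<in>Basis. inv_metric G k p x *
        (partial v (\<lambda>y. G y p q) x * inv_metric G q l x)))) (at x)"
    by (intro has_derivative_diff[OF has_derivative_const, simplified] has_derivative_sum
        has_derivative_mult_right)
  then have "((\<lambda>y. inv_metric G k l y) has_derivative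
      (\<lambda>v. - (\<Sum>p\<in>Basis. \<Sum>q\<in>Basis. inv_metric G k p x *
        (partial v (\<lambda>y. G y p q) x * inv_metric G q l x)))) (at x)"
  proof (rule has_derivative_transform_within_open[OF _ metric_onD(1)[OF G] x])
    fix y assume "y \<in> S"
    from inv_metric_diff[of G x, OF Gx metric_onD(2)[OF G this], of k l]
    show "inv_metric G k l x - (\<Sum>p\<in>Basis. \<Sum>q\<in>Basis. inv_metric G k p x *
        ((G y p q - G x p q) * inv_metric G q l y)) = inv_metric G k l y"
      by (simp add: mult.assoc)
  qed
  then show ?thesis by (simp add: mult.assoc)
qed

section \<open>Scalar curvature of doubly warped sums\<close>

text \<open>The Christoffel symbols of the first kind. Free of the inverse metric, they are linear
  in all three slots and meaningful for arbitrary vectors, which makes their behaviour under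
  coordinate changes computable.\<close>

definition koszul :: "('a::euclidean_space \<Rightarrow> 'a \<Rightarrow> 'a \<Rightarrow> real) \<Rightarrow> 'a \<Rightarrow> 'a \<Rightarrow> 'a \<Rightarrow> 'a \<Rightarrow> real" where
  "koszul G i j l x =
     (1/2) * (partial i (\<lambda>y. G y j l) x + partial j (\<lambda>y. G y i l) x - partial l (\<lambda>y. G y i j) x)"

lemma christoffel_koszul:
  "christoffel G k i j x = (\<Sum>l\<in>Basis. inv_metric G k l x * koszul G i j l x)"
  by (simp add: christoffel_def koszul_def sum_distrib_left mult.left_commute)

definition grad_comp :: "('a::euclidean_space \<Rightarrow> 'a \<Rightarrow> 'a \<Rightarrow> real) \<Rightarrow> ('a \<Rightarrow> real) \<Rightarrow> 'a \<Rightarrow> 'a \<Rightarrow> real" where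
  "grad_comp G F k x = (\<Sum>l\<in>Basis. inv_metric G k l x * partial l F x)"

definition hess :: "('a::euclidean_space \<Rightarrow> 'a \<Rightarrow> 'a \<Rightarrow> real) \<Rightarrow> ('a \<Rightarrow> real) \<Rightarrow> 'a \<Rightarrow> 'a \<Rightarrow> 'a \<Rightarrow> real" where
  "hess G F j k x = partial j (partial k F) x - (\<Sum>i\<in>Basis. christoffel G i j k x * partial i F x)"

definition laplacian :: "('a::euclidean_space \<Rightarrow> 'a \<Rightarrow> 'a \<Rightarrow> real) \<Rightarrow> ('a \<Rightarrow> real) \<Rightarrow> 'a \<Rightarrow> real" where
  "laplacian G F x = (\<Sum>j\<in>Basis. \<Sum>k\<in>Basis. inv_metric G j k x * hess G F j k x)"

definition grad_sq :: "('a::euclidean_space \<Rightarrow> 'a \<Rightarrow> 'a \<Rightarrow> real) \<Rightarrow> ('a \<Rightarrow> real) \<Rightarrow> 'a \<Rightarrow> real" where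
  "grad_sq G F x = (\<Sum>j\<in>Basis. \<Sum>k\<in>Basis. inv_metric G j k x * (partial j F x * partial k F x))"

definition scal :: "('a::euclidean_space \<Rightarrow> 'a \<Rightarrow> 'a \<Rightarrow> real) \<Rightarrow> 'a \<Rightarrow> real" where
  "scal G x = (\<Sum>j\<in>Basis. \<Sum>k\<in>Basis. inv_metric G j k x * ricci G j k x)"

definition twice_differentiable_on :: "'a::euclidean_space set \<Rightarrow> ('a \<Rightarrow> real) \<Rightarrow> bool" where
  "twice_differentiable_on S F \<longleftrightarrow>
     (\<forall>x\<in>S. F differentiable (at x) \<and> (\<forall>v. partial v F differentiable (at x)))"

lemma twice_differentiable_onD:
  assumes "twice_differentiable_on S F" "x \<in> S"
  shows "F differentiable (at x)" "partial v F differentiable (at x)"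
  using assms by (auto simp: twice_differentiable_on_def)

lemma grad_sq_eq: "grad_sq G F x = (\<Sum>j\<in>Basis. partial j F x * grad_comp G F j x)"
  by (simp add: grad_sq_def grad_comp_def sum_distrib_left mult.left_commute mult.assoc)

lemma inv_metric_differentiable:
  "metric_on S G \<Longrightarrow> x \<in> S \<Longrightarrow> inv_metric G k l differentiable (at x)"
  using inv_metric_has_derivative unfolding differentiable_def by blast

lemma christoffel_differentiable:
  assumes "metric_on S G" "x \<in> S"
  shows "christoffel G k i j differentiable (at x)"
  unfolding christoffel_def[abs_def] using assms
  by (intro differentiable_mult differentiable_const differentiable_sum ballI finite_Basis
      inv_metric_differentiable differentiable_add differentiable_diff metric_onD(4))

lemma grad_comp_differentiable:
  assumes "metric_on S G" "twice_differentiable_on S F" "x \<in> S"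
  shows "grad_comp G F k differentiable (at x)"
  unfolding grad_comp_def[abs_def] using assms
  by (intro differentiable_mult differentiable_sum ballI finite_Basis
      inv_metric_differentiable twice_differentiable_onD(2))

text \<open>Compatibility of the Levi-Civita connection with the metric, in lowered indices: in the
  sum of the two Koszul expressions all other terms cancel by symmetry of \<open>G\<close>.\<close>

lemma partial_metric:
  assumes G: "metric_on S G" and x: "x \<in> S"
  shows "partial i (\<lambda>y. G y j l) x = koszul G i j l x + koszul G i l j x"
proof -
  have "partial u (\<lambda>y. G y v w) x = partial u (\<lambda>y. G y w v) x" for u v w
    by (rule partial_cong[OF metric_onD(1)[OF G] x]) (simp add: inner_formD(2)[OF metric_onD(2)[OF G]])
  from this[of i l j] this[of j i l] this[of l i j] show ?thesis by (simp add: koszul_def field_simps)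
qed

text \<open>The inverse metric is parallel as well; inserting metric compatibility into the
  derivative of the inverse gives one Christoffel sum for each upper index.\<close>

lemma partial_inv_metric:
  assumes G: "metric_on S G" and x: "x \<in> S"
  shows "partial i (inv_metric G k l) x =
    - (\<Sum>p\<in>Basis. christoffel G k i p x * inv_metric G p l x)
    - (\<Sum>p\<in>Basis. christoffel G l i p x * inv_metric G k p x)"
proof -
  note B = metric_onD(2)[OF G x]
  have "partial i (inv_metric G k l) x = - (\<Sum>p\<in>Basis. \<Sum>q\<in>Basis.
      inv_metric G k p x * partial i (\<lambda>y. G y p q) x * inv_metric G q l x)"
    by (rule partial_eqI[OF inv_metric_has_derivative[OF G x]])
  also have "\<dots> = - (\<Sum>p\<in>Basis. \<Sum>q\<in>Basis. inv_metric G k p x * koszul G i q p x * inv_metric G q l x)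
     - (\<Sum>p\<in>Basis. \<Sum>q\<in>Basis. inv_metric G k p x * koszul G i p q x * inv_metric G q l x)"
    by (simp add: partial_metric[OF G x] algebra_simps sum.distrib)
  also have "(\<Sum>p\<in>Basis. \<Sum>q\<in>Basis. inv_metric G k p x * koszul G i q p x * inv_metric G q l x)
     = (\<Sum>q\<in>Basis. christoffel G k i q x * inv_metric G q l x)"
    by (subst sum.swap) (simp add: christoffel_koszul sum_distrib_right)
  also have "(\<Sum>p\<in>Basis. \<Sum>q\<in>Basis. inv_metric G k p x * koszul G i p q x * inv_metric G q l x)
     = (\<Sum>p\<in>Basis. christoffel G l i p x * inv_metric G k p x)"
    by (simp add: christoffel_koszul sum_distrib_left sum_distrib_right inv_metric_sym[of G x _ l, OF B]
        mult.commute mult.left_commute)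
  finally show ?thesis .
qed

text \<open>Trace of the Hessian equals divergence of the gradient. Of the two sums from
  differentiating the inverse metric, one cancels the connection term of the divergence and the
  other is the connection term of the Hessian. The Ricci computation produces the divergence
  form.\<close>

lemma laplacian_divergence:
  assumes G: "metric_on S G" and F: "twice_differentiable_on S F" and x: "x \<in> S"
  shows "laplacian G F x = (\<Sum>k\<in>Basis. partial k (grad_comp G F k) x
      + (\<Sum>p\<in>Basis. christoffel G k k p x * grad_comp G F p x))"
proof -
  have d: "partial k (grad_comp G F k) x = (\<Sum>l\<in>Basis. inv_metric G k l x * partial k (partial l F) x
      + partial k (inv_metric G k l) x * partial l F x)" for k
    unfolding grad_comp_def[abs_def]
    by (rule partial_eqI[OF has_derivative_sum])
       (intro has_derivative_mult has_derivative_partial inv_metric_differentiable[OF G x]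
          twice_differentiable_onD(2)[OF F x])
  have "(\<Sum>k\<in>Basis. \<Sum>l\<in>Basis. partial k (inv_metric G k l) x * partial l F x)
    = - (\<Sum>k\<in>Basis. \<Sum>l\<in>Basis. \<Sum>p\<in>Basis. christoffel G k k p x * inv_metric G p l x * partial l F x)
      - (\<Sum>k\<in>Basis. \<Sum>l\<in>Basis. \<Sum>p\<in>Basis. christoffel G l k p x * inv_metric G k p x * partial l F x)"
    by (simp add: partial_inv_metric[OF G x] sum_distrib_right left_diff_distrib sum_subtractf sum_negf)
  also have "(\<Sum>k\<in>Basis. \<Sum>l\<in>Basis. \<Sum>p\<in>Basis. christoffel G k k p x * inv_metric G p l x * partial l F x)
    = (\<Sum>k\<in>Basis. \<Sum>p\<in>Basis. christoffel G k k p x * grad_comp G F p x)"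
    by (rule sum.cong[OF refl], subst sum.swap) (simp add: grad_comp_def sum_distrib_left mult.assoc)
  also have "(\<Sum>k\<in>Basis. \<Sum>l\<in>Basis. \<Sum>p\<in>Basis. christoffel G l k p x * inv_metric G k p x * partial l F x)
    = (\<Sum>k\<in>Basis. \<Sum>p\<in>Basis. inv_metric G k p x * (\<Sum>l\<in>Basis. christoffel G l k p x * partial l F x))"
    by (rule sum.cong[OF refl], subst sum.swap) (simp add: sum_distrib_left ac_simps)
  finally show ?thesis
    by (simp add: d laplacian_def hess_def sum.distrib right_diff_distrib sum_subtractf)
qed

text \<open>Embeddings \<open>e1\<close>, \<open>e2\<close> and projections \<open>p1\<close>, \<open>p2\<close> stand for a product decomposition, so that the
  two factors can be interchanged and every block has to be computed only once.\<close>

locale split_metric =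
  fixes e1 :: "'a::euclidean_space \<Rightarrow> 'e::euclidean_space" and p1 :: "'e \<Rightarrow> 'a"
    and e2 :: "'b::euclidean_space \<Rightarrow> 'e" and p2 :: "'e \<Rightarrow> 'b"
    and G :: "'e \<Rightarrow> 'e \<Rightarrow> 'e \<Rightarrow> real"
    and G1 :: "'a \<Rightarrow> 'a \<Rightarrow> 'a \<Rightarrow> real" and G2 :: "'b \<Rightarrow> 'b \<Rightarrow> 'b \<Rightarrow> real"
    and U :: "'a \<Rightarrow> real" and W :: "'b \<Rightarrow> real" and S :: "'a set" and T :: "'b set"
  assumes lin: "linear e1" "linear p1" "linear e2" "linear p2"
    and proj: "\<And>v. p1 (e1 v) = v" "\<And>v. p2 (e1 v) = 0" "\<And>v. p2 (e2 v) = v" "\<And>v. p1 (e2 v) = 0"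
    and decomp: "\<And>v. v = e1 (p1 v) + e2 (p2 v)"
    and inner: "\<And>v w. e1 v \<bullet> w = v \<bullet> p1 w" "\<And>v w. e2 v \<bullet> w = v \<bullet> p2 w"
    and sum_Basis: "\<And>f :: 'e \<Rightarrow> real. sum f Basis = (\<Sum>i\<in>Basis. f (e1 i)) + (\<Sum>i\<in>Basis. f (e2 i))"
    and G1: "metric_on S G1" and G2: "metric_on T G2"
    and U: "twice_differentiable_on S U" and W: "twice_differentiable_on T W"
    and U_pos: "\<And>s. s \<in> S \<Longrightarrow> U s > 0" and W_pos: "\<And>t. t \<in> T \<Longrightarrow> W t > 0"
    and G: "\<And>z v w. p1 z \<in> S \<Longrightarrow> p2 z \<in> T \<Longrightarrow>
       G z v w = (W (p2 z))\<^sup>2 * G1 (p1 z) (p1 v) (p1 w) + (U (p1 z))\<^sup>2 * G2 (p2 z) (p2 v) (p2 w)"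
begin

lemma swap: "split_metric e2 p2 e1 p1 G G2 G1 W U T S"
proof (rule split_metric.intro)
  show "v = e2 (p2 v) + e1 (p1 v)" for v using decomp[of v] by (simp only: add.commute)
  show "sum f Basis = (\<Sum>i\<in>Basis. f (e2 i)) + (\<Sum>i\<in>Basis. f (e1 i))" for f :: "'e \<Rightarrow> real"
    using sum_Basis[of f] by (simp only: add.commute)
  show "G z v w = (U (p1 z))\<^sup>2 * G2 (p2 z) (p2 v) (p2 w) + (W (p2 z))\<^sup>2 * G1 (p1 z) (p1 v) (p1 w)"
    if "p2 z \<in> T" "p1 z \<in> S" for z v w
    using G[OF that(2,1), of v w] by (simp only: add.commute)
qed (rule lin proj inner G1 G2 U W U_pos W_pos | assumption)+

section \<open>Blocks of the metric, the connection and the curvature\<close>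

definition Z :: "'e set" where "Z = {z. p1 z \<in> S \<and> p2 z \<in> T}"

lemma open_Z: "open Z"
proof -
  have "Z = p1 -` S \<inter> p2 -` T" by (auto simp: Z_def)
  moreover have "open (p1 -` S)" "open (p2 -` T)"
    using continuous_open_vimage linear_continuous_at[OF lin(2)[unfolded linear_conv_bounded_linear]]
      linear_continuous_at[OF lin(4)[unfolded linear_conv_bounded_linear]]
      metric_onD(1)[OF G1] metric_onD(1)[OF G2] by blast+
  ultimately show ?thesis by auto
qed

text \<open>All nonzero blocks below are products of a function on one factor and a function on the
  other, so this is the one differentiation rule that the block computation relies on.\<close>

lemma has_derivative_separated:
  assumes a: "a differentiable (at (p1 z))" and b: "b differentiable (at (p2 z))"
  shows "((\<lambda>y. a (p1 y) * b (p2 y)) has_derivative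
    (\<lambda>v. a (p1 z) * partial (p2 v) b (p2 z) + partial (p1 v) a (p1 z) * b (p2 z))) (at z)"
proof -
  have 1: "(p1 has_derivative p1) (at z)" "(p2 has_derivative p2) (at z)"
    using lin by (auto intro!: bounded_linear_imp_has_derivative simp: linear_conv_bounded_linear)
  show ?thesis
    using has_derivative_mult[OF has_derivative_compose[OF 1(1) has_derivative_partial[OF a]]
        has_derivative_compose[OF 1(2) has_derivative_partial[OF b]]] .
qed

lemma partial_zero: "f differentiable (at x) \<Longrightarrow> partial 0 f x = 0"
  using linear_0[OF linear_partial] by blast

lemma partial_separated:
  assumes "a differentiable (at (p1 z))" "b differentiable (at (p2 z))"
  shows "partial (e1 i) (\<lambda>y. a (p1 y) * b (p2 y)) z = partial i a (p1 z) * b (p2 z)"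
    and "partial (e2 c) (\<lambda>y. a (p1 y) * b (p2 y)) z = a (p1 z) * partial c b (p2 z)"
  by (subst partial_eqI[OF has_derivative_separated[OF assms]], simp add: proj partial_zero assms)+

lemma inner_form_G:
  assumes "z \<in> Z"
  shows "inner_form (G z)"
proof -
  have st: "p1 z \<in> S" "p2 z \<in> T" using assms by (auto simp: Z_def)
  note B1 = metric_onD(2)[OF G1 st(1)] and B2 = metric_onD(2)[OF G2 st(2)]
  have lin1: "linear (\<lambda>w. G z v w)" for v
    unfolding G[OF st]
    by (rule linearI) (simp_all add: linear_add[OF lin(2)] linear_add[OF lin(4)] linear_scale[OF lin(2)]
        linear_scale[OF lin(4)] linear_add[OF inner_formD(4)[OF B1]] linear_add[OF inner_formD(4)[OF B2]]
        linear_scale[OF inner_formD(4)[OF B1]] linear_scale[OF inner_formD(4)[OF B2]] algebra_simps)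
  have sym: "G z v w = G z w v" for v w
    by (simp add: G[OF st] inner_formD(2)[OF B1, of "p1 v"] inner_formD(2)[OF B2, of "p2 v"])
  have "linear (\<lambda>w. G z w v)" for v using lin1[of v] sym by simp
  moreover have "G z v v > 0" if "v \<noteq> 0" for v
  proof -
    have "0 \<le> G1 (p1 z) (p1 v) (p1 v)" "0 \<le> G2 (p2 z) (p2 v) (p2 v)"
      using inner_formD(3)[OF B1, of "p1 v"] inner_formD(3)[OF B2, of "p2 v"]
      by (cases "p1 v = 0"; cases "p2 v = 0"; force simp: linear_0[OF inner_formD(4)[OF B1]]
          linear_0[OF inner_formD(4)[OF B2]])+
    moreover have "0 < G1 (p1 z) (p1 v) (p1 v) \<or> 0 < G2 (p2 z) (p2 v) (p2 v)"
    proof -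
      have "p1 v \<noteq> 0 \<or> p2 v \<noteq> 0"
        using decomp[of v] that linear_0[OF lin(1)] linear_0[OF lin(3)] by force
      then show ?thesis using inner_formD(3)[OF B1, of "p1 v"] inner_formD(3)[OF B2, of "p2 v"] by blast
    qed
    ultimately show ?thesis
      unfolding G[OF st] using U_pos[OF st(1)] W_pos[OF st(2)]
      by (auto intro: add_pos_nonneg add_nonneg_pos)
  qed
  ultimately show ?thesis using lin1 sym by (auto simp: inner_form_def bilinear_def)
qed

lemma inv_metric_blocks:
  assumes "z \<in> Z"
  shows "inv_metric G (e1 k) (e1 i) z = inv_metric G1 k i (p1 z) / (W (p2 z))\<^sup>2"
    and "inv_metric G (e2 c) (e1 i) z = 0"
    and "inv_metric G (e1 i) (e2 c) z = 0"
proof -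
  have st: "p1 z \<in> S" "p2 z \<in> T" using assms by (auto simp: Z_def)
  note B1 = metric_onD(2)[OF G1 st(1)] and B2 = metric_onD(2)[OF G2 st(2)]
  have Wn: "W (p2 z) \<noteq> 0" using W_pos[OF st(2)] by simp
  \<comment> \<open>Raising an index within the first factor and dividing by its scale is tested as
    a candidate; uniqueness of \<open>sharp\<close> does the inversion.\<close>
  have sh: "sharp (G z) (e1 i) = e1 (sharp (G1 (p1 z)) i /\<^sub>R (W (p2 z))\<^sup>2)" for i
    using Wn
    by (intro sharp_unique[OF inner_form_G[OF assms]])
       (simp add: G[OF st] proj inner linear_0[OF inner_formD(5)[OF B2]]
         linear_scale[OF inner_formD(5)[OF B1]] sharp[OF B1])
  show "inv_metric G (e1 k) (e1 i) z = inv_metric G1 k i (p1 z) / (W (p2 z))\<^sup>2"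
    by (simp add: inv_metric_eq_sharp sh inner proj divide_inverse mult.commute)
  show 2: "inv_metric G (e2 c) (e1 i) z = 0"
    by (simp add: inv_metric_eq_sharp sh inner proj)
  then show "inv_metric G (e1 i) (e2 c) z = 0"
    using inv_metric_sym[of G z, OF inner_form_G[OF assms]] by simp
qed

lemma partial_G:
  assumes "z \<in> Z"
  shows "partial (e1 i) (\<lambda>y. G y (e1 j) (e1 l)) z = partial i (\<lambda>y. G1 y j l) (p1 z) * (W (p2 z))\<^sup>2"
    and "partial (e2 c) (\<lambda>y. G y (e1 j) (e1 l)) z
      = 2 * (G1 (p1 z) j l * (W (p2 z) * partial c W (p2 z)))"
    and "partial u (\<lambda>y. G y (e1 j) (e2 c)) z = 0"
    and "partial u (\<lambda>y. G y (e2 c) (e1 j)) z = 0"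
proof -
  have st: "p1 z \<in> S" "p2 z \<in> T" using assms by (auto simp: Z_def)
  have 1: "G y (e1 j) (e1 l) = G1 (p1 y) j l * (W (p2 y))\<^sup>2"
    and 2: "G y (e1 j) (e2 c) = 0" and 3: "G y (e2 c) (e1 j) = 0" if "y \<in> Z" for y j l c
  proof -
    have st: "p1 y \<in> S" "p2 y \<in> T" using that by (auto simp: Z_def)
    note B1 = metric_onD(2)[OF G1 st(1)] and B2 = metric_onD(2)[OF G2 st(2)]
    show "G y (e1 j) (e1 l) = G1 (p1 y) j l * (W (p2 y))\<^sup>2"
      "G y (e1 j) (e2 c) = 0" "G y (e2 c) (e1 j) = 0"
      by (simp_all add: G[OF st] proj linear_0[OF inner_formD(4)[OF B1]] linear_0[OF inner_formD(5)[OF B1]]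
         linear_0[OF inner_formD(4)[OF B2]] linear_0[OF inner_formD(5)[OF B2]])
  qed
  have dG: "(\<lambda>y. G1 y j l) differentiable (at (p1 z))" by (rule metric_onD(3)[OF G1 st(1)])
  have dW: "W differentiable (at (p2 z))" by (rule twice_differentiable_onD(1)[OF W st(2)])
  have W2: "((\<lambda>t. (W t)\<^sup>2) has_derivative (\<lambda>v. 2 * (W (p2 z) * partial v W (p2 z)))) (at (p2 z))"
    using has_derivative_mult[OF has_derivative_partial[OF dW] has_derivative_partial[OF dW]]
    by (simp add: power2_eq_square mult_ac)
  then have dW2: "(\<lambda>t. (W t)\<^sup>2) differentiable (at (p2 z))" unfolding differentiable_def by blast
  have cg: "partial u (\<lambda>y. G y (e1 j) (e1 l)) z = partial u (\<lambda>y. G1 (p1 y) j l * (W (p2 y))\<^sup>2) z" for u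
    by (rule partial_cong[OF open_Z assms 1])
  show "partial (e1 i) (\<lambda>y. G y (e1 j) (e1 l)) z = partial i (\<lambda>y. G1 y j l) (p1 z) * (W (p2 z))\<^sup>2"
    unfolding cg by (rule partial_separated(1)[OF dG dW2])
  show "partial (e2 c) (\<lambda>y. G y (e1 j) (e1 l)) z
      = 2 * (G1 (p1 z) j l * (W (p2 z) * partial c W (p2 z)))"
    unfolding cg partial_separated(2)[OF dG dW2] partial_eqI[OF W2] by simp
  have pz: "partial u (\<lambda>y. 0) z = 0" for u by (simp add: partial_def)
  show "partial u (\<lambda>y. G y (e1 j) (e2 c)) z = 0"
    by (rule trans[OF partial_cong[OF open_Z assms] pz], rule 2)
  show "partial u (\<lambda>y. G y (e2 c) (e1 j)) z = 0"
    by (rule trans[OF partial_cong[OF open_Z assms] pz], rule 3)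
qed

text \<open>The second block is the second fundamental form of the slices along the first factor:
  half the gradient of W^2, with the factor U^-2 because the normal directions are scaled by
  \<open>U\<close>. The diagonal form of the last two says that moving between slices rescales them
  homothetically.\<close>

lemma christoffel_blocks:
  assumes z: "z \<in> Z" and "k \<in> Basis" "i \<in> Basis"
  shows "christoffel G (e1 k) (e1 i) (e1 j) z = christoffel G1 k i j (p1 z)"
    and "christoffel G (e2 c) (e1 i) (e1 j) z
      = - (G1 (p1 z) i j / (U (p1 z))\<^sup>2) * (W (p2 z) * grad_comp G2 W c (p2 z))"
    and "christoffel G (e1 k) (e1 i) (e2 c) z = (k \<bullet> i) * (partial c W (p2 z) / W (p2 z))"
    and "christoffel G (e1 k) (e2 c) (e1 i) z = (k \<bullet> i) * (partial c W (p2 z) / W (p2 z))"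
proof -
  interpret sw: split_metric e2 p2 e1 p1 G G2 G1 W U T S by (rule swap)
  have z': "z \<in> sw.Z" using z by (auto simp: Z_def sw.Z_def)
  have st: "p1 z \<in> S" "p2 z \<in> T" using z by (auto simp: Z_def)
  have n: "W (p2 z) \<noteq> 0" "U (p1 z) \<noteq> 0" using W_pos[OF st(2)] U_pos[OF st(1)] by auto
  note B1 = metric_onD(2)[OF G1 st(1)]
  note simps = christoffel_koszul koszul_def sum_Basis inv_metric_blocks[OF z] sw.inv_metric_blocks[OF z']
    partial_G[OF z] sw.partial_G[OF z']
  show "christoffel G (e1 k) (e1 i) (e1 j) z = christoffel G1 k i j (p1 z)"
    using n by (auto simp: simps field_simps intro!: sum.cong)
  show "christoffel G (e2 c) (e1 i) (e1 j) z
      = - (G1 (p1 z) i j / (U (p1 z))\<^sup>2) * (W (p2 z) * grad_comp G2 W c (p2 z))"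
    by (simp add: simps grad_comp_def sum_distrib_left sum_negf mult_ac)
  have "christoffel G (e1 k) (e1 i) (e2 c) z
      = (\<Sum>l\<in>Basis. inv_metric G1 k l (p1 z) * G1 (p1 z) i l) * (partial c W (p2 z) / W (p2 z))"
    using n by (simp add: simps sum_distrib_left sum_distrib_right power2_eq_square mult_ac)
  also have "(\<Sum>l\<in>Basis. inv_metric G1 k l (p1 z) * G1 (p1 z) i l) = k \<bullet> i"
    by (simp add: inner_formD(2)[OF B1, of i] sum_inv_metric_mult[of G1, OF B1])
  finally show 3: "christoffel G (e1 k) (e1 i) (e2 c) z = (k \<bullet> i) * (partial c W (p2 z) / W (p2 z))" .
  have "christoffel G (e1 k) (e2 c) (e1 i) z = christoffel G (e1 k) (e1 i) (e2 c) z"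
    by (simp add: simps)
  then show "christoffel G (e1 k) (e2 c) (e1 i) z = (k \<bullet> i) * (partial c W (p2 z) / W (p2 z))"
    using 3 by simp
qed

end

lemma sum_Basis_delta:
  fixes f :: "'c::euclidean_space \<Rightarrow> real"
  assumes "k \<in> Basis"
  shows "(\<Sum>i\<in>Basis. f i * (i \<bullet> k)) = f k" "(\<Sum>i\<in>Basis. f i * (k \<bullet> i)) = f k"
  using assms by (simp_all add: inner_Basis sum.If_cases if_distrib sum.delta cong: if_cong)

context split_metric
begin

text \<open>These are the three kinds of derivatives that enter a diagonal Ricci block. The last one
  differentiates a logarithmic derivative of \<open>U\<close>, hence its quadratic
  correction.\<close>

lemma partial_christoffel_blocks:
  assumes z: "z \<in> Z" and "k \<in> Basis" "i \<in> Basis"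
  shows "partial (e1 l) (christoffel G (e1 k) (e1 i) (e1 j)) z = partial l (christoffel G1 k i j) (p1 z)"
    and "partial (e2 d) (christoffel G (e2 c) (e1 i) (e1 j)) z
      = - (G1 (p1 z) i j / (U (p1 z))\<^sup>2) * (partial d W (p2 z) * grad_comp G2 W c (p2 z)
          + W (p2 z) * partial d (grad_comp G2 W c) (p2 z))"
    and "c \<in> Basis \<Longrightarrow> c' \<in> Basis \<Longrightarrow> partial (e1 j) (christoffel G (e2 c) (e2 c') (e1 i)) z
      = (c \<bullet> c') * (partial j (partial i U) (p1 z) / U (p1 z)
          - partial j U (p1 z) * partial i U (p1 z) / (U (p1 z))\<^sup>2)"
proof -
  interpret sw: split_metric e2 p2 e1 p1 G G2 G1 W U T S by (rule swap)
  have Z': "sw.Z = Z" by (auto simp: Z_def sw.Z_def)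
  have st: "p1 z \<in> S" "p2 z \<in> T" using z by (auto simp: Z_def)
  have n: "U (p1 z) \<noteq> 0" using U_pos[OF st(1)] by simp
  have dU: "U differentiable (at (p1 z))" by (rule twice_differentiable_onD(1)[OF U st(1)])
  have dUi: "partial i U differentiable (at (p1 z))" by (rule twice_differentiable_onD(2)[OF U st(1)])
  have dW: "W differentiable (at (p2 z))" by (rule twice_differentiable_onD(1)[OF W st(2)])
  have dg: "grad_comp G2 W c differentiable (at (p2 z))" by (rule grad_comp_differentiable[OF G2 W st(2)])
  have one: "(\<lambda>t::'b. 1::real) differentiable (at (p2 z))" by simp
  \<comment> \<open>Multiplying by 1 presents a function on one factor as a separated
    product.\<close>
  have "partial (e1 l) (christoffel G (e1 k) (e1 i) (e1 j)) z
    = partial (e1 l) (\<lambda>y. christoffel G1 k i j (p1 y) * 1) z"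
    by (rule partial_cong[OF open_Z z]) (simp add: christoffel_blocks assms)
  also have "\<dots> = partial l (christoffel G1 k i j) (p1 z)"
    using partial_separated(1)[OF christoffel_differentiable[OF G1 st(1)] one] by simp
  finally show "partial (e1 l) (christoffel G (e1 k) (e1 i) (e1 j)) z = partial l (christoffel G1 k i j) (p1 z)" .
  have "partial (e2 d) (christoffel G (e2 c) (e1 i) (e1 j)) z
    = partial (e2 d) (\<lambda>y. (- (G1 (p1 y) i j / (U (p1 y))\<^sup>2)) * (W (p2 y) * grad_comp G2 W c (p2 y))) z"
    by (rule partial_cong[OF open_Z z]) (simp only: christoffel_blocks(2)[OF _ assms(2,3)])
  also have "\<dots> = - (G1 (p1 z) i j / (U (p1 z))\<^sup>2) * partial d (\<lambda>t. W t * grad_comp G2 W c t) (p2 z)"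
  proof (rule partial_separated(2))
    show "(\<lambda>s. - (G1 s i j / (U s)\<^sup>2)) differentiable at (p1 z)"
      using n by (intro differentiable_minus differentiable_divide metric_onD(3)[OF G1 st(1)]
          differentiable_power dU) simp
    show "(\<lambda>t. W t * grad_comp G2 W c t) differentiable at (p2 z)"
      by (intro differentiable_mult dW dg)
  qed
  also have "partial d (\<lambda>t. W t * grad_comp G2 W c t) (p2 z) = partial d W (p2 z) * grad_comp G2 W c (p2 z)
          + W (p2 z) * partial d (grad_comp G2 W c) (p2 z)"
    using partial_eqI[OF has_derivative_mult[OF has_derivative_partial[OF dW] has_derivative_partial[OF dg]]]
    by simp
  finally show "partial (e2 d) (christoffel G (e2 c) (e1 i) (e1 j)) z
      = - (G1 (p1 z) i j / (U (p1 z))\<^sup>2) * (partial d W (p2 z) * grad_comp G2 W c (p2 z)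
          + W (p2 z) * partial d (grad_comp G2 W c) (p2 z))" .
  have dq: "((\<lambda>s. (c \<bullet> c') * (partial i U s / U s)) has_derivative
      (\<lambda>v. (c \<bullet> c') * (partial v (partial i U) (p1 z) / U (p1 z)
          - partial v U (p1 z) * partial i U (p1 z) / (U (p1 z))\<^sup>2))) (at (p1 z))"
    using has_derivative_mult_right[OF has_derivative_divide'[OF has_derivative_partial[OF dUi]
          has_derivative_partial[OF dU] n], of "c \<bullet> c'"] n
    by (simp add: diff_divide_distrib power2_eq_square mult.commute)
  then have dq': "(\<lambda>s. (c \<bullet> c') * (partial i U s / U s)) differentiable (at (p1 z))"
    unfolding differentiable_def by blast
  show "partial (e1 j) (christoffel G (e2 c) (e2 c') (e1 i)) z
      = (c \<bullet> c') * (partial j (partial i U) (p1 z) / U (p1 z)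
          - partial j U (p1 z) * partial i U (p1 z) / (U (p1 z))\<^sup>2)"
    if "c \<in> Basis" "c' \<in> Basis"
  proof -
    have "partial (e1 j) (christoffel G (e2 c) (e2 c') (e1 i)) z
      = partial (e1 j) (\<lambda>y. ((c \<bullet> c') * (partial i U (p1 y) / U (p1 y))) * 1) z"
      using that by (intro partial_cong[OF open_Z z]) (simp add: sw.christoffel_blocks Z' assms)
    also have "\<dots> = (c \<bullet> c') * (partial j (partial i U) (p1 z) / U (p1 z)
            - partial j U (p1 z) * partial i U (p1 z) / (U (p1 z))\<^sup>2)"
      unfolding partial_separated(1)[OF dq' one] partial_eqI[OF dq] by (rule mult_1_right)
  finally show ?thesis .
  qed
qed

text \<open>The trace runs over two kinds of directions. Those of the same factor
  (\<open>r1\<close>) give the intrinsic Ricci tensor and a Gauss-equation term in the gradient of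
  \<open>W\<close>; those of the other factor (\<open>r2\<close>) give the Hessian of
  \<open>U\<close> and the divergence of the gradient of \<open>W\<close>.\<close>

lemma ricci_block:
  assumes z: "z \<in> Z" and jk: "j \<in> Basis" "k \<in> Basis"
  shows "ricci G (e1 j) (e1 k) z = ricci G1 j k (p1 z)
    - real DIM('b) / U (p1 z) * hess G1 U j k (p1 z)
    - G1 (p1 z) j k / (U (p1 z))\<^sup>2 * (W (p2 z) * laplacian G2 W (p2 z)
        + (real DIM('a) - 1) * grad_sq G2 W (p2 z))"
proof -
  interpret sw: split_metric e2 p2 e1 p1 G G2 G1 W U T S by (rule swap)
  have Z': "sw.Z = Z" by (auto simp: Z_def sw.Z_def)
  have st: "p1 z \<in> S" "p2 z \<in> T" using z by (auto simp: Z_def)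
  define u w N where "u = U (p1 z)" and "w = W (p2 z)" and "N = grad_sq G2 W (p2 z)"
  define g where "g i j = G1 (p1 z) i j" for i j
  define Ui where "Ui i = partial i U (p1 z)" for i
  define Wc where "Wc c = partial c W (p2 z)" for c
  define V where "V c = grad_comp G2 W c (p2 z)" for c
  define C1 where "C1 k i j = christoffel G1 k i j (p1 z)" for k i j
  define C2 where "C2 k i j = christoffel G2 k i j (p2 z)" for k i j
  have n: "u \<noteq> 0" "w \<noteq> 0" using U_pos[OF st(1)] W_pos[OF st(2)] by (auto simp: u_def w_def)
  note abbr = u_def[symmetric] w_def[symmetric] g_def[symmetric] Ui_def[symmetric] Wc_def[symmetric]
    V_def[symmetric] C1_def[symmetric] C2_def[symmetric]
  have N: "(\<Sum>c\<in>Basis. Wc c * V c) = N"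
    by (simp add: Wc_def V_def N_def grad_sq_eq)
  note D = partial_christoffel_blocks[OF z, unfolded abbr]
  note C = christoffel_blocks[OF z, unfolded abbr]
  note sC = sw.christoffel_blocks[unfolded Z', OF z, unfolded abbr]
  have r1: "riemann G (e1 i) (e1 j) (e1 k) (e1 i) z = riemann G1 i j k i (p1 z)
      - g j k / u\<^sup>2 * N + (i \<bullet> j) * (g i k / u\<^sup>2 * N)" if i: "i \<in> Basis" for i
  proof -
    have "(\<Sum>c\<in>Basis. (i \<bullet> i) * (Wc c / w) * (- (g j k / u\<^sup>2) * (w * V c))
        - (i \<bullet> j) * (Wc c / w) * (- (g i k / u\<^sup>2) * (w * V c)))
      = (\<Sum>c\<in>Basis. - (g j k / u\<^sup>2) * (Wc c * V c) + (i \<bullet> j) * (g i k / u\<^sup>2) * (Wc c * V c))"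
      using n i by (intro sum.cong refl) (simp add: inner_same_Basis mult_ac)
    also have "\<dots> = - g j k / u\<^sup>2 * N + (i \<bullet> j) * (g i k / u\<^sup>2 * N)"
      unfolding N[symmetric] by (simp add: sum.distrib sum_distrib_left sum_negf sum_subtractf mult.assoc)
    finally show ?thesis
      using i jk
      by (simp add: riemann_def sum_Basis D C sC abbr)
  qed
  have r2: "riemann G (e2 c) (e1 j) (e1 k) (e2 c) z
      = - g j k * w / u\<^sup>2 * (partial c (grad_comp G2 W c) (p2 z) + (\<Sum>e\<in>Basis. C2 c c e * V e))
        - hess G1 U j k (p1 z) / u" if c: "c \<in> Basis" for c
  proof -
    have 1: "(\<Sum>p\<in>Basis. Ui p / u * C1 p j k - (- (g j p / u\<^sup>2) * (w * V c)) * ((p \<bullet> k) * (Wc c / w)))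
      = (\<Sum>p\<in>Basis. C1 p j k * Ui p) / u + g j k / u\<^sup>2 * (V c * Wc c)"
    proof -
      have "(\<Sum>p\<in>Basis. Ui p / u * C1 p j k - (- (g j p / u\<^sup>2) * (w * V c)) * ((p \<bullet> k) * (Wc c / w)))
        = (\<Sum>p\<in>Basis. C1 p j k * Ui p) / u + (\<Sum>p\<in>Basis. g j p * (p \<bullet> k)) * (V c * Wc c / u\<^sup>2)"
        using n by (simp add: sum.distrib sum_divide_distrib sum_distrib_left sum_distrib_right sum_subtractf mult_ac sum_negf)
      then show ?thesis by (simp add: sum_Basis_delta jk)
    qed
    have 2: "(\<Sum>e\<in>Basis. C2 c c e * (- (g j k / u\<^sup>2) * (w * V e)) - (c \<bullet> e) * (Ui j / u) * ((e \<bullet> c) * (Ui k / u)))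
      = - (g j k * w / u\<^sup>2) * (\<Sum>e\<in>Basis. C2 c c e * V e) - Ui j * Ui k / u\<^sup>2"
    proof -
      have "(\<Sum>e\<in>Basis. (c \<bullet> e) * (Ui j / u) * ((e \<bullet> c) * (Ui k / u)))
         = (\<Sum>e\<in>Basis. (c \<bullet> e) * (Ui j / u) * (Ui k / u) * (e \<bullet> c))" by (simp add: mult_ac)
      also have "\<dots> = Ui j * Ui k / u\<^sup>2"
        by (subst sum_Basis_delta(1)[OF c]) (simp add: inner_same_Basis[OF c] power2_eq_square)
      finally show ?thesis by (simp add: sum_subtractf sum_distrib_left sum_divide_distrib mult_ac sum_negf)
    qed
    \<comment> \<open>Two cancellations are prepared here: \<open>Wc c * V c\<close> and
      \<open>Ui j * Ui k\<close> each occur once from a derivative of a Christoffel symbol and once,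
      with opposite sign, from the quadratic terms.\<close>
    have "riemann G (e2 c) (e1 j) (e1 k) (e2 c) z =
      - (g j k / u\<^sup>2) * (Wc c * V c + w * partial c (grad_comp G2 W c) (p2 z))
      - (partial j (partial k U) (p1 z) / u - Ui j * Ui k / u\<^sup>2)
      + ((\<Sum>p\<in>Basis. C1 p j k * Ui p) / u + g j k / u\<^sup>2 * (V c * Wc c))
      + (- (g j k * w / u\<^sup>2) * (\<Sum>e\<in>Basis. C2 c c e * V e) - Ui j * Ui k / u\<^sup>2)"
      using c jk unfolding 1[symmetric] 2[symmetric]
      by (simp add: riemann_def sum_Basis D C sC abbr inner_same_Basis)
    also have "\<dots> = - g j k * w / u\<^sup>2 * (partial c (grad_comp G2 W c) (p2 z) + (\<Sum>e\<in>Basis. C2 c c e * V e))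
        - (partial j (partial k U) (p1 z) - (\<Sum>p\<in>Basis. C1 p j k * Ui p)) / u"
      by (simp add: algebra_simps diff_divide_distrib add_divide_distrib)
    finally show ?thesis by (simp add: hess_def abbr)
  qed
  have lap: "(\<Sum>c\<in>Basis. partial c (grad_comp G2 W c) (p2 z) + (\<Sum>e\<in>Basis. C2 c c e * V e))
      = laplacian G2 W (p2 z)"
    by (simp add: laplacian_divergence[OF G2 W st(2)] C2_def V_def)
  have "ricci G (e1 j) (e1 k) z = (\<Sum>i\<in>Basis. riemann G1 i j k i (p1 z)
      - g j k / u\<^sup>2 * N + (i \<bullet> j) * (g i k / u\<^sup>2 * N))
      + (\<Sum>c\<in>Basis. - g j k * w / u\<^sup>2 * (partial c (grad_comp G2 W c) (p2 z) + (\<Sum>e\<in>Basis. C2 c c e * V e))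
        - hess G1 U j k (p1 z) / u)"
    by (simp add: ricci_def sum_Basis r1 r2)
  also have "(\<Sum>c\<in>Basis. - g j k * w / u\<^sup>2 * (partial c (grad_comp G2 W c) (p2 z) + (\<Sum>e\<in>Basis. C2 c c e * V e))
        - hess G1 U j k (p1 z) / u)
     = - g j k * w / u\<^sup>2 * laplacian G2 W (p2 z) - real DIM('b) * (hess G1 U j k (p1 z) / u)"
    by (simp only: sum_subtractf sum_distrib_left[symmetric] lap sum_constant)
  \<comment> \<open>The diagonal term \<open>i = j\<close> returns one copy of the gradient term,
    which turns the factor \<open>DIM('a)\<close> into \<open>DIM('a) - 1\<close>.\<close>
  also have "(\<Sum>i\<in>Basis. riemann G1 i j k i (p1 z) - g j k / u\<^sup>2 * N + (i \<bullet> j) * (g i k / u\<^sup>2 * N))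
     = ricci G1 j k (p1 z) - real DIM('a) * (g j k / u\<^sup>2 * N) + g j k / u\<^sup>2 * N"
    using sum_Basis_delta(1)[OF jk(1), of "\<lambda>i. g i k / u\<^sup>2 * N"]
    by (simp add: ricci_def sum.distrib sum_subtractf mult.commute)
  finally show ?thesis
    by (simp add: abbr N_def[symmetric] algebra_simps add_divide_distrib)
qed

lemma scal_block:
  assumes z: "z \<in> Z"
  shows "(\<Sum>j\<in>Basis. \<Sum>k\<in>Basis. inv_metric G (e1 j) (e1 k) z * ricci G (e1 j) (e1 k) z)
    = (scal G1 (p1 z) - real DIM('b) / U (p1 z) * laplacian G1 U (p1 z)
       - real DIM('a) / (U (p1 z))\<^sup>2 * (W (p2 z) * laplacian G2 W (p2 z)
          + (real DIM('a) - 1) * grad_sq G2 W (p2 z))) / (W (p2 z))\<^sup>2"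
proof -
  have st: "p1 z \<in> S" "p2 z \<in> T" using z by (auto simp: Z_def)
  note B1 = metric_onD(2)[OF G1 st(1)]
  define E where "E = (W (p2 z) * laplacian G2 W (p2 z) + (real DIM('a) - 1) * grad_sq G2 W (p2 z)) / (U (p1 z))\<^sup>2"
  define h where "h = real DIM('b) / U (p1 z)"
  have tr: "(\<Sum>j\<in>Basis. \<Sum>k\<in>Basis. inv_metric G1 j k (p1 z) * G1 (p1 z) j k) = real DIM('a)"
  proof -
    have "(\<Sum>j\<in>Basis. \<Sum>k\<in>Basis. inv_metric G1 j k (p1 z) * G1 (p1 z) j k)
      = (\<Sum>j\<in>(Basis::'a set). j \<bullet> j)"
      by (intro sum.cong refl)
         (simp add: inner_formD(2)[OF B1] sum_inv_metric_mult[of G1, OF B1, symmetric])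
    then show ?thesis by (simp add: inner_same_Basis)
  qed
  have "(\<Sum>j\<in>Basis. \<Sum>k\<in>Basis. inv_metric G (e1 j) (e1 k) z * ricci G (e1 j) (e1 k) z)
    = (\<Sum>j\<in>Basis. \<Sum>k\<in>Basis. (inv_metric G1 j k (p1 z) * ricci G1 j k (p1 z)
        - h * (inv_metric G1 j k (p1 z) * hess G1 U j k (p1 z))
        - E * (inv_metric G1 j k (p1 z) * G1 (p1 z) j k)) / (W (p2 z))\<^sup>2)"
  proof (intro sum.cong refl)
    fix j k :: 'a assume jk: "j \<in> Basis" "k \<in> Basis"
    have "ricci G (e1 j) (e1 k) z = ricci G1 j k (p1 z) - h * hess G1 U j k (p1 z) - E * G1 (p1 z) j k"
      by (simp add: ricci_block[OF z jk] h_def E_def)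
    then show "inv_metric G (e1 j) (e1 k) z * ricci G (e1 j) (e1 k) z
      = (inv_metric G1 j k (p1 z) * ricci G1 j k (p1 z)
        - h * (inv_metric G1 j k (p1 z) * hess G1 U j k (p1 z))
        - E * (inv_metric G1 j k (p1 z) * G1 (p1 z) j k)) / (W (p2 z))\<^sup>2"
      by (simp add: inv_metric_blocks[OF z] right_diff_distrib mult.left_commute diff_divide_distrib)
  qed
  also have "\<dots> = (scal G1 (p1 z) - h * laplacian G1 U (p1 z) - E * real DIM('a)) / (W (p2 z))\<^sup>2"
    unfolding tr[symmetric] scal_def laplacian_def
    by (simp only: sum_divide_distrib[symmetric] sum_subtractf sum_distrib_left)
  finally show ?thesis by (simp add: h_def E_def mult.commute)
qed

text \<open>The two diagonal blocks are mirror images of each other. Each of them contains the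
  Laplacian of \<open>U\<close>, once as trace of the Hessian and once as divergence, hence the
  factor 2; the same holds for \<open>W\<close>. Multiplying by U^2 W^2 clears exactly the
  denominators that coupled the variables.\<close>

theorem scal_split:
  assumes z: "z \<in> Z"
  shows "(U (p1 z))\<^sup>2 * (W (p2 z))\<^sup>2 * scal G z
    = ((U (p1 z))\<^sup>2 * scal G1 (p1 z) - 2 * real DIM('b) * U (p1 z) * laplacian G1 U (p1 z)
        - real DIM('b) * (real DIM('b) - 1) * grad_sq G1 U (p1 z))
    + ((W (p2 z))\<^sup>2 * scal G2 (p2 z) - 2 * real DIM('a) * W (p2 z) * laplacian G2 W (p2 z)
        - real DIM('a) * (real DIM('a) - 1) * grad_sq G2 W (p2 z))"
proof -
  interpret sw: split_metric e2 p2 e1 p1 G G2 G1 W U T S by (rule swap)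
  have z': "z \<in> sw.Z" using z by (auto simp: Z_def sw.Z_def)
  have st: "p1 z \<in> S" "p2 z \<in> T" using z by (auto simp: Z_def)
  have n: "U (p1 z) \<noteq> 0" "W (p2 z) \<noteq> 0" using U_pos[OF st(1)] W_pos[OF st(2)] by auto
  define P where "P = (\<Sum>j\<in>Basis. \<Sum>k\<in>Basis. inv_metric G (e1 j) (e1 k) z * ricci G (e1 j) (e1 k) z)"
  define Q where "Q = (\<Sum>j\<in>Basis. \<Sum>k\<in>Basis. inv_metric G (e2 j) (e2 k) z * ricci G (e2 j) (e2 k) z)"
  have PQ: "scal G z = P + Q"
    by (simp add: scal_def sum_Basis sum.distrib inv_metric_blocks(2,3)[OF z] P_def Q_def)
  have aux: "u\<^sup>2 * w\<^sup>2 * ((R - b / u * l - a / u\<^sup>2 * X) / w\<^sup>2) = u\<^sup>2 * R - b * u * l - a * X"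
    if "u \<noteq> 0" "w \<noteq> 0" for u w R b l a X :: real
    using that by (simp add: field_simps power2_eq_square)
  have "(U (p1 z))\<^sup>2 * (W (p2 z))\<^sup>2 * scal G z = (U (p1 z))\<^sup>2 * (W (p2 z))\<^sup>2 * P + (W (p2 z))\<^sup>2 * (U (p1 z))\<^sup>2 * Q"
    by (simp add: PQ algebra_simps)
  also have "(U (p1 z))\<^sup>2 * (W (p2 z))\<^sup>2 * P = (U (p1 z))\<^sup>2 * scal G1 (p1 z)
      - real DIM('b) * U (p1 z) * laplacian G1 U (p1 z)
      - real DIM('a) * (W (p2 z) * laplacian G2 W (p2 z) + (real DIM('a) - 1) * grad_sq G2 W (p2 z))"
    unfolding P_def scal_block[OF z] by (rule aux[OF n])
  also have "(W (p2 z))\<^sup>2 * (U (p1 z))\<^sup>2 * Q = (W (p2 z))\<^sup>2 * scal G2 (p2 z)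
      - real DIM('a) * W (p2 z) * laplacian G2 W (p2 z)
      - real DIM('b) * (U (p1 z) * laplacian G1 U (p1 z) + (real DIM('b) - 1) * grad_sq G1 U (p1 z))"
    unfolding Q_def sw.scal_block[OF z'] by (rule aux[OF n(2,1)])
  finally show ?thesis by (simp add: algebra_simps)
qed

end

section \<open>Coordinate invariance of the Laplacian\<close>

lemma linear_partial_param:
  fixes H :: "'a::euclidean_space \<Rightarrow> 'b::euclidean_space \<Rightarrow> real"
  assumes "open S" "x \<in> S" and lin: "\<And>y. y \<in> S \<Longrightarrow> linear (H y)"
    and H: "\<And>b. (\<lambda>y. H y b) differentiable (at x)"
  shows "linear (\<lambda>b. partial v (\<lambda>y. H y b) x)"
proof (rule linearI)
  fix b c r
  have "partial v (\<lambda>y. H y (b + c)) x = partial v (\<lambda>y. H y b + H y c) x"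
    by (rule partial_cong[OF assms(1,2)]) (simp add: linear_add[OF lin])
  also have "\<dots> = partial v (\<lambda>y. H y b) x + partial v (\<lambda>y. H y c) x"
    by (rule partial_eqI[OF has_derivative_add[OF has_derivative_partial has_derivative_partial]]) (rule H)+
  finally show "partial v (\<lambda>y. H y (b + c)) x = partial v (\<lambda>y. H y b) x + partial v (\<lambda>y. H y c) x" .
  have "partial v (\<lambda>y. H y (r *\<^sub>R b)) x = partial v (\<lambda>y. r * H y b) x"
    by (rule partial_cong[OF assms(1,2)]) (simp add: linear_scale[OF lin])
  also have "\<dots> = r *\<^sub>R partial v (\<lambda>y. H y b) x"
    unfolding real_scaleR_def
    by (rule partial_eqI[OF has_derivative_mult_right[OF has_derivative_partial]]) (rule H)
  finally show "partial v (\<lambda>y. H y (r *\<^sub>R b)) x = r *\<^sub>R partial v (\<lambda>y. H y b) x" .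
qed

lemma
  assumes G: "metric_on S G" and x: "x \<in> S"
  shows linear_koszul1: "linear (\<lambda>i. koszul G i j l x)"
    and linear_koszul2: "linear (\<lambda>j. koszul G i j l x)"
    and linear_koszul3: "linear (\<lambda>l. koszul G i j l x)"
proof -
  have a: "linear (\<lambda>v. partial u (\<lambda>y. G y v w) x)" for u w
    by (rule linear_partial_param[OF metric_onD(1)[OF G] x])
       (auto intro: inner_formD(5)[OF metric_onD(2)[OF G]] metric_onD(3)[OF G x])
  have b: "linear (\<lambda>w. partial u (\<lambda>y. G y v w) x)" for u v
    by (rule linear_partial_param[OF metric_onD(1)[OF G] x])
       (auto intro: inner_formD(4)[OF metric_onD(2)[OF G]] metric_onD(3)[OF G x])
  have c: "linear (\<lambda>u. partial u (\<lambda>y. G y v w) x)" for v w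
    by (rule linear_partial[OF metric_onD(3)[OF G x]])
  note simps = koszul_def linear_add[OF a] linear_add[OF b] linear_add[OF c] linear_scale[OF a]
    linear_scale[OF b] linear_scale[OF c] field_simps
  show "linear (\<lambda>i. koszul G i j l x)" by (rule linearI) (simp_all add: simps)
  show "linear (\<lambda>j. koszul G i j l x)" by (rule linearI) (simp_all add: simps)
  show "linear (\<lambda>l. koszul G i j l x)" by (rule linearI) (simp_all add: simps)
qed

section \<open>Gradient, Hessian and trace evaluated on arbitrary vectors\<close>

definition gradv :: "('a::euclidean_space \<Rightarrow> 'a \<Rightarrow> 'a \<Rightarrow> real) \<Rightarrow> ('a \<Rightarrow> real) \<Rightarrow> 'a \<Rightarrow> 'a" where
  "gradv G F x = (\<Sum>l\<in>Basis. grad_comp G F l x *\<^sub>R l)"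

lemma metric_gradv:
  assumes B: "inner_form (G x)" and F: "F differentiable (at x)"
  shows "G x (gradv G F x) w = partial w F x"
proof -
  have 1: "G x (gradv G F x) b = partial b F x" if b: "b \<in> Basis" for b
  proof -
    have "G x (gradv G F x) b = (\<Sum>l\<in>Basis. (\<Sum>k\<in>Basis. inv_metric G l k x * partial k F x) * G x l b)"
      unfolding gradv_def grad_comp_def by (rule bilinear_sum_left[OF inner_formD(1)[OF B]])
    also have "\<dots> = (\<Sum>l\<in>Basis. \<Sum>k\<in>Basis. inv_metric G k l x * G x l b * partial k F x)"
      unfolding sum_distrib_right
      by (intro sum.cong refl) (metis inv_metric_sym[of G x, OF B] mult.assoc mult.commute)
    also have "\<dots> = (\<Sum>k\<in>Basis. (\<Sum>l\<in>Basis. inv_metric G k l x * G x l b) * partial k F x)"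
      by (subst sum.swap) (simp add: sum_distrib_right)
    also have "\<dots> = partial b F x"
      unfolding sum_inv_metric_mult[of G x, OF B]
      using sum_Basis_delta(1)[OF b, of "\<lambda>k. partial k F x"] by (simp only: mult.commute)
    finally show ?thesis .
  qed
  have "G x (gradv G F x) w = G x (gradv G F x) (\<Sum>b\<in>Basis. (w \<bullet> b) *\<^sub>R b)"
    by (simp add: euclidean_representation)
  also have "\<dots> = (\<Sum>b\<in>Basis. (w \<bullet> b) * partial b F x)"
    unfolding bilinear_sum_right[OF inner_formD(1)[OF B]] using 1 by simp
  also have "\<dots> = partial (\<Sum>b\<in>Basis. (w \<bullet> b) *\<^sub>R b) F x"
    by (simp only: linear_sum[OF linear_partial[OF F]] linear_scale[OF linear_partial[OF F]] real_scaleR_def)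
  finally show ?thesis by (simp add: euclidean_representation)
qed

lemma gradv_unique:
  assumes B: "inner_form (G x)" and F: "F differentiable (at x)"
    and v: "\<And>w. G x v w = partial w F x"
  shows "v = gradv G F x"
proof (rule ccontr)
  assume "v \<noteq> gradv G F x"
  then have "G x (v - gradv G F x) (v - gradv G F x) > 0" by (intro inner_formD(3)[OF B]) simp
  then show False
    by (simp add: linear_diff[OF inner_formD(5)[OF B]] v metric_gradv[of G x, OF B F])
qed

text \<open>The covariant Hessian as a bilinear form. Contracting Christoffel symbols with dF is
  rewritten as \<open>koszul\<close> with the gradient in its last slot, which confines the inverse
  metric to the gradient.\<close>

definition hessv :: "('a::euclidean_space \<Rightarrow> 'a \<Rightarrow> 'a \<Rightarrow> real) \<Rightarrow> ('a \<Rightarrow> real) \<Rightarrow> 'a \<Rightarrow> 'a \<Rightarrow> 'a \<Rightarrow> real" where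
  "hessv G F x v w = partial v (partial w F) x - koszul G v w (gradv G F x) x"

lemma hess_eq_hessv:
  assumes G: "metric_on S G" and x: "x \<in> S"
  shows "hess G F j k x = hessv G F x j k"
proof -
  note B = metric_onD(2)[OF G x]
  have "(\<Sum>i\<in>Basis. christoffel G i j k x * partial i F x)
    = (\<Sum>i\<in>Basis. \<Sum>l\<in>Basis. inv_metric G l i x * koszul G j k l x * partial i F x)"
    by (simp add: christoffel_koszul sum_distrib_right) (simp add: inv_metric_sym[of G x, OF B])
  also have "\<dots> = (\<Sum>l\<in>Basis. grad_comp G F l x * koszul G j k l x)"
    by (subst sum.swap) (simp add: grad_comp_def sum_distrib_left sum_distrib_right mult_ac)
  also have "\<dots> = koszul G j k (gradv G F x) x"
    by (simp add: gradv_def linear_sum[OF linear_koszul3[OF G x]] linear_scale[OF linear_koszul3[OF G x]])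
  finally show ?thesis by (simp add: hess_def hessv_def)
qed

lemma bilinear_hessv:
  assumes G: "metric_on S G" and x: "x \<in> S" and F: "twice_differentiable_on S F"
  shows "bilinear (hessv G F x)"
proof -
  have a: "linear (\<lambda>v. partial v (partial w F) x)" for w
    by (rule linear_partial[OF twice_differentiable_onD(2)[OF F x]])
  have b: "linear (\<lambda>w. partial v (partial w F) x)" for v
    by (rule linear_partial_param[OF metric_onD(1)[OF G] x])
       (auto intro: linear_partial twice_differentiable_onD[OF F] x)
  show ?thesis
    unfolding bilinear_def hessv_def
    by (intro conjI allI linear_compose_sub a b linear_koszul1[OF G x] linear_koszul2[OF G x])
qed

text \<open>The metric trace of \<open>H\<close> with respect to \<open>B\<close>; both the
  Laplacian and the squared gradient norm are instances.\<close>

definition tr_form :: "('a::euclidean_space \<Rightarrow> 'a \<Rightarrow> real) \<Rightarrow> ('a \<Rightarrow> 'a \<Rightarrow> real) \<Rightarrow> real" where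
  "tr_form B H = (\<Sum>j\<in>Basis. \<Sum>k\<in>Basis. (sharp B k \<bullet> j) * H j k)"

lemma tr_form_sharp:
  assumes "bilinear H"
  shows "tr_form B H = (\<Sum>k\<in>Basis. H (sharp B k) k)"
proof -
  have "H (sharp B k) k = (\<Sum>j\<in>Basis. (sharp B k \<bullet> j) * H j k)" for k
    by (subst euclidean_representation[of "sharp B k", symmetric]) (rule bilinear_sum_left[OF assms])
  then show ?thesis unfolding tr_form_def by (subst sum.swap) simp
qed

text \<open>\<open>T\<close> is an isometry from \<open>B'\<close> to \<open>B\<close>, so the
  inverse forms are related by conjugation with \<open>T\<close> and its transpose; this is
  \<open>sh\<close>, and substituting it moves the trace from one side to the other.\<close>

lemma tr_form_linear_image:
  fixes T :: "'a::euclidean_space \<Rightarrow> 'a"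
  assumes B: "inner_form B" and B': "inner_form B'" and H: "bilinear H" and T: "linear T" "surj T"
    and eq: "\<And>v w. B' v w = B (T v) (T w)"
  shows "tr_form B' (\<lambda>v w. H (T v) (T w)) = tr_form B H"
proof -
  have bil: "bilinear (\<lambda>v w. H (T v) (T w))"
    using H linear_compose[OF T(1)] by (auto simp: bilinear_def o_def)
  let ?Q = "\<lambda>k. T (sharp B' k)"
  have Q: "B (?Q k) (T w) = k \<bullet> w" for k w using sharp[OF B', of k w] eq by simp
  have sh: "sharp B l = (\<Sum>k\<in>Basis. (T k \<bullet> l) *\<^sub>R ?Q k)" for l
  proof (rule sharp_unique[OF B])
    fix b
    obtain w where w: "b = T w" using T(2) by blast
    have "B (\<Sum>k\<in>Basis. (T k \<bullet> l) *\<^sub>R ?Q k) (T w) = (\<Sum>k\<in>Basis. (T k \<bullet> l) * B (?Q k) (T w))"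
      by (rule bilinear_sum_left[OF inner_formD(1)[OF B]])
    also have "\<dots> = (\<Sum>k\<in>Basis. (w \<bullet> k) *\<^sub>R T k) \<bullet> l"
      by (simp add: Q inner_sum_left inner_commute[of w] mult.commute)
    also have "(\<Sum>k\<in>Basis. (w \<bullet> k) *\<^sub>R T k) = T w"
      by (subst (2) euclidean_representation[of w, symmetric])
         (simp add: linear_sum[OF T(1)] linear_scale[OF T(1)] del: euclidean_representation)
    finally show "B (\<Sum>k\<in>Basis. (T k \<bullet> l) *\<^sub>R ?Q k) b = l \<bullet> b" by (simp add: w inner_commute)
  qed
  have "tr_form B' (\<lambda>v w. H (T v) (T w)) = (\<Sum>k\<in>Basis. H (?Q k) (T k))"
    by (rule tr_form_sharp[OF bil])
  also have "\<dots> = (\<Sum>k\<in>Basis. \<Sum>l\<in>Basis. (T k \<bullet> l) * H (?Q k) l)"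
    by (intro sum.cong refl, subst (2) euclidean_representation[of "T _", symmetric])
       (rule bilinear_sum_right[OF H])
  also have "\<dots> = (\<Sum>l\<in>Basis. H (sharp B l) l)"
    unfolding sh bilinear_sum_left[OF H] by (rule sum.swap)
  finally show ?thesis by (simp add: tr_form_sharp[OF H])
qed

lemma laplacian_tr_form:
  assumes "metric_on S G" "x \<in> S"
  shows "laplacian G F x = tr_form (G x) (hessv G F x)"
  by (simp add: laplacian_def tr_form_def hess_eq_hessv[OF assms] inv_metric_eq_sharp)

lemma grad_sq_tr_form: "grad_sq G F x = tr_form (G x) (\<lambda>v w. partial v F x * partial w F x)"
  by (simp add: grad_sq_def tr_form_def inv_metric_eq_sharp)

text \<open>\<open>f\<close> stands for a transition map, \<open>D\<close> for its differential on a
  neighbourhood, and \<open>D2\<close> for its second derivative at the one point \<open>x\<close>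
  at which the operators are compared.\<close>

locale coordinate_change =
  fixes S' S :: "'a::euclidean_space set" and f :: "'a \<Rightarrow> 'a"
    and G' G :: "'a \<Rightarrow> 'a \<Rightarrow> 'a \<Rightarrow> real" and F :: "'a \<Rightarrow> real" and x :: 'a
    and D :: "'a \<Rightarrow> 'a \<Rightarrow> 'a" and D2 :: "'a \<Rightarrow> 'a \<Rightarrow> 'a"
  assumes G': "metric_on S' G'" and G: "metric_on S G" and F: "twice_differentiable_on S F"
    and f: "\<And>y. y \<in> S' \<Longrightarrow> f y \<in> S" and x: "x \<in> S'"
    and D: "\<And>y. y \<in> S' \<Longrightarrow> (f has_derivative D y) (at y)"
    and D2: "\<And>v. ((\<lambda>y. D y v) has_derivative (\<lambda>u. D2 u v)) (at x)"
    and D2_sym: "\<And>u v. D2 u v = D2 v u"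
    and surj: "surj (D x)"
    and pullback: "\<And>y v w. y \<in> S' \<Longrightarrow> G' y v w = G (f y) (D y v) (D y w)"
begin

lemma linear_D: "y \<in> S' \<Longrightarrow> linear (D y)"
  using has_derivative_linear[OF D] .

lemma partial_comp:
  assumes "y \<in> S'" "h differentiable (at (f y))"
  shows "((\<lambda>y. h (f y)) has_derivative (\<lambda>v. partial (D y v) h (f y))) (at y)"
  by (rule has_derivative_compose[OF D[OF assms(1)] has_derivative_partial[OF assms(2)]])

lemma partial_pullback_fun: "y \<in> S' \<Longrightarrow> partial v (\<lambda>y. F (f y)) y = partial (D y v) F (f y)"
  by (rule partial_eqI[OF partial_comp[OF _ twice_differentiable_onD(1)[OF F f]]])

lemma gradv_pullback: "D x (gradv G' (\<lambda>y. F (f y)) x) = gradv G F (f x)"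
proof (rule gradv_unique[of G "f x", OF metric_onD(2)[OF G f[OF x]] twice_differentiable_onD(1)[OF F f[OF x]]])
  fix w
  obtain v where v: "w = D x v" using surj by blast
  have "(\<lambda>y. F (f y)) differentiable (at x)"
    using partial_comp[OF x twice_differentiable_onD(1)[OF F f[OF x]]] unfolding differentiable_def by blast
  then show "G (f x) (D x (gradv G' (\<lambda>y. F (f y)) x)) w = partial w F (f x)"
    using metric_gradv[of G' x, OF metric_onD(2)[OF G' x]] partial_pullback_fun[OF x, of v]
    by (simp add: v pullback[OF x, symmetric])
qed

lemma partial_pullback_metric:
  "partial u (\<lambda>y. G' y v w) x = partial (D x u) (\<lambda>y. G y (D x v) (D x w)) (f x)
     + G (f x) (D2 u v) (D x w) + G (f x) (D x v) (D2 u w)"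
proof -
  note S' = metric_onD(1)[OF G'] x
  have B: "inner_form (G (f y))" if "y \<in> S'" for y using metric_onD(2)[OF G f[OF that]] .
  have d0: "((\<lambda>y. G (f y) a b) has_derivative (\<lambda>u. partial (D x u) (\<lambda>y. G y a b) (f x))) (at x)" for a b
    by (rule partial_comp[OF x metric_onD(3)[OF G f[OF x]]])
  have d0': "(\<lambda>y. G (f y) a b) differentiable (at x)" for a b
    using d0 unfolding differentiable_def by blast
  have d1: "((\<lambda>y. G (f y) a (D y w)) has_derivative
      (\<lambda>u. partial u (\<lambda>y. G (f y) a (D x w)) x + G (f x) a (D2 u w))) (at x)" for a
    by (rule has_derivative_linear_apply[OF S' inner_formD(4)[OF B] d0' D2])
  have d1': "(\<lambda>y. G (f y) a (D y w)) differentiable (at x)" for a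
    using d1 unfolding differentiable_def by blast
  have d2: "((\<lambda>y. G (f y) (D y v) (D y w)) has_derivative
      (\<lambda>u. partial u (\<lambda>y. G (f y) (D x v) (D y w)) x + G (f x) (D2 u v) (D x w))) (at x)"
    by (rule has_derivative_linear_apply[OF S' inner_formD(5)[OF B] d1' D2])
  have "partial u (\<lambda>y. G' y v w) x = partial u (\<lambda>y. G (f y) (D y v) (D y w)) x"
    by (rule partial_cong[OF S' pullback])
  also have "\<dots> = partial u (\<lambda>y. G (f y) (D x v) (D y w)) x + G (f x) (D2 u v) (D x w)"
    by (rule partial_eqI[OF d2])
  also have "partial u (\<lambda>y. G (f y) (D x v) (D y w)) x
     = partial (D x u) (\<lambda>y. G y (D x v) (D x w)) (f x) + G (f x) (D x v) (D2 u w)"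
    by (simp add: partial_eqI[OF d1] partial_eqI[OF d0])
  finally show ?thesis by simp
qed

text \<open>The non-tensorial transformation law. Of the six terms containing \<open>D2\<close>,
  four cancel in pairs by symmetry of \<open>D2\<close> and of \<open>G\<close>; the remaining two
  coincide and absorb the factor 1/2.\<close>

lemma koszul_pullback:
  "koszul G' u v w x = koszul G (D x u) (D x v) (D x w) (f x) + G (f x) (D2 u v) (D x w)"
proof -
  have s: "G (f x) a b = G (f x) b a" for a b
    by (rule inner_formD(2)[OF metric_onD(2)[OF G f[OF x]]])
  show ?thesis
    using s[of "D x v" "D2 u w"] s[of "D x u" "D2 v w"]
    by (simp add: koszul_def partial_pullback_metric D2_sym[of w] D2_sym[of v u] field_simps)
qed

text \<open>The second derivative of the composition carries the extra term dF(D2 u v), and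
  \<open>koszul\<close> with the gradient inserted carries the same quantity, so their difference is
  tensorial.\<close>

lemma hessv_pullback: "hessv G' (\<lambda>y. F (f y)) x u v = hessv G F (f x) (D x u) (D x v)"
proof -
  note S' = metric_onD(1)[OF G'] x
  note fx = f[OF x]
  have d0: "((\<lambda>y. partial a F (f y)) has_derivative (\<lambda>u. partial (D x u) (partial a F) (f x))) (at x)" for a
    by (rule partial_comp[OF x twice_differentiable_onD(2)[OF F fx]])
  have d0': "(\<lambda>y. partial a F (f y)) differentiable (at x)" for a
    using d0 unfolding differentiable_def by blast
  have d1: "((\<lambda>y. partial (D y v) F (f y)) has_derivative
      (\<lambda>u. partial u (\<lambda>y. partial (D x v) F (f y)) x + partial (D2 u v) F (f x))) (at x)"
    by (rule has_derivative_linear_apply[OF S' linear_partial d0' D2])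
       (rule twice_differentiable_onD(1)[OF F f])
  have "partial u (partial v (\<lambda>y. F (f y))) x = partial u (\<lambda>y. partial (D y v) F (f y)) x"
    by (rule partial_cong[OF S' partial_pullback_fun])
  also have "\<dots> = partial (D x u) (partial (D x v) F) (f x) + partial (D2 u v) F (f x)"
    by (simp add: partial_eqI[OF d1] partial_eqI[OF d0])
  finally have 1: "partial u (partial v (\<lambda>y. F (f y))) x
      = partial (D x u) (partial (D x v) F) (f x) + partial (D2 u v) F (f x)" .
  have "G (f x) (D2 u v) (gradv G F (f x)) = partial (D2 u v) F (f x)"
    using metric_gradv[of G "f x", OF metric_onD(2)[OF G fx] twice_differentiable_onD(1)[OF F fx]]
      inner_formD(2)[OF metric_onD(2)[OF G fx]] by metis
  then show ?thesis by (simp add: hessv_def 1 koszul_pullback gradv_pullback)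
qed

lemma laplacian_pullback: "laplacian G' (\<lambda>y. F (f y)) x = laplacian G F (f x)"
  unfolding laplacian_tr_form[OF G' x] laplacian_tr_form[OF G f[OF x]]
  using tr_form_linear_image[OF metric_onD(2)[OF G f[OF x]] metric_onD(2)[OF G' x]
      bilinear_hessv[OF G f[OF x] F] linear_D[OF x] surj pullback[OF x]]
  by (simp add: hessv_pullback[abs_def])

lemma grad_sq_pullback: "grad_sq G' (\<lambda>y. F (f y)) x = grad_sq G F (f x)"
proof -
  have l: "linear (\<lambda>v. partial v F (f x))"
    by (rule linear_partial[OF twice_differentiable_onD(1)[OF F f[OF x]]])
  have "bilinear (\<lambda>v w. partial v F (f x) * partial w F (f x))"
    unfolding bilinear_def
    by (auto intro!: linearI simp: linear_add[OF l] linear_scale[OF l] algebra_simps)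
  from tr_form_linear_image[OF metric_onD(2)[OF G f[OF x]] metric_onD(2)[OF G' x] this
      linear_D[OF x] surj pullback[OF x]]
  show ?thesis by (simp add: grad_sq_tr_form partial_pullback_fun[OF x])
qed

end

section \<open>Strong maximum principle\<close>

text \<open>The trace of a product of two positive semidefinite matrices is nonnegative. A rank one
  piece of \<open>P\<close> accounts for its whole row \<open>a\<close> and pairs with
  \<open>H\<close> to a value of the quadratic form of \<open>H\<close>; what remains of
  \<open>P\<close> lives on the smaller index set, so no diagonalisation is involved.\<close>

lemma sum_mult_psd_nonneg:
  fixes P H :: "'i \<Rightarrow> 'i \<Rightarrow> real"
  assumes "finite I" and "\<And>i j. P i j = P j i"
    and "\<And>c. (\<Sum>i\<in>I. \<Sum>j\<in>I. P i j * (c i * c j)) \<ge> 0"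
    and "\<And>c. (\<Sum>i\<in>I. \<Sum>j\<in>I. H i j * (c i * c j)) \<ge> 0"
  shows "(\<Sum>i\<in>I. \<Sum>j\<in>I. P i j * H i j) \<ge> 0"
  using assms
proof (induction I arbitrary: P rule: finite_induct) \<comment> \<open>splitting off a Schur complement\<close>
  case (insert a I)
  note fin = insert.hyps(1,2)
  have psd_H: "(\<Sum>i\<in>I. \<Sum>j\<in>I. H i j * (c i * c j)) \<ge> 0" for c
  proof -
    define c' where "c' = c(a := 0)"
    have "c' a = 0" by (simp add: c'_def)
    moreover have "(\<Sum>i\<in>I. \<Sum>j\<in>I. H i j * (c' i * c' j)) = (\<Sum>i\<in>I. \<Sum>j\<in>I. H i j * (c i * c j))"
      using fin by (intro sum.cong refl) (auto simp: c'_def)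
    ultimately show ?thesis using insert.prems(3)[of c'] fin by simp
  qed
  have expand: "(\<Sum>i\<in>insert a I. \<Sum>j\<in>insert a I. P i j * (c i * c j))
      = P a a * (c a * c a) + 2 * c a * (\<Sum>j\<in>I. P a j * c j) + (\<Sum>i\<in>I. \<Sum>j\<in>I. P i j * (c i * c j))" for c
  proof -
    have "(\<Sum>i\<in>I. P i a * (c i * c a)) = c a * (\<Sum>j\<in>I. P a j * c j)"
      unfolding sum_distrib_left
      by (intro sum.cong refl) (simp add: insert.prems(1)[of a] mult_ac)
    moreover have "(\<Sum>j\<in>I. P a j * (c a * c j)) = c a * (\<Sum>j\<in>I. P a j * c j)"
      unfolding sum_distrib_left by (intro sum.cong refl) (simp add: mult_ac)
    ultimately show ?thesis using fin by (simp add: sum.distrib)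
  qed
  show ?case
  proof (cases "P a a = 0")
    case True
    have zero: "P a j = 0" if j: "j \<in> I" for j
    proof (rule ccontr)
      assume ne: "P a j \<noteq> 0"
      \<comment> \<open>A zero pivot forces a zero row: otherwise the form at e_j + t e_a is affine
        in \<open>t\<close>, and this \<open>t\<close> gives it the value -1.\<close>
      define t where "t = - (P j j + 1) / (2 * P a j)"
      have "a \<noteq> j" using fin j by auto
      let ?c = "(\<lambda>i. if i = j then 1 else 0)(a := t)"
      have "(\<Sum>k\<in>I. P a k * ?c k) = (\<Sum>k\<in>I. if k = j then P a k else 0)"
        using fin by (intro sum.cong) auto
      also have "\<dots> = P a j" using fin j by simp
      finally have 1: "(\<Sum>k\<in>I. P a k * ?c k) = P a j" .
      have "(\<Sum>i\<in>I. \<Sum>k\<in>I. P i k * (?c i * ?c k)) = (\<Sum>i\<in>I. if i = j then P j j else 0)"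
      proof (intro sum.cong refl)
        fix i assume i: "i \<in> I"
        have "(\<Sum>k\<in>I. P i k * (?c i * ?c k)) = (\<Sum>k\<in>I. if k = j then (if i = j then P j j else 0) else 0)"
          using fin i by (intro sum.cong) auto
        then show "(\<Sum>k\<in>I. P i k * (?c i * ?c k)) = (if i = j then P j j else 0)"
          using fin j by simp
      qed
      also have "\<dots> = P j j" using fin j by simp
      finally have 2: "(\<Sum>i\<in>I. \<Sum>k\<in>I. P i k * (?c i * ?c k)) = P j j" .
      have "0 \<le> P a a * (?c a * ?c a) + 2 * ?c a * P a j + P j j"
        using insert.prems(2)[of ?c] unfolding expand 1 2 .
      also have "\<dots> = 2 * t * P a j + P j j" using True by simp
      also have "\<dots> = -1" using ne by (simp add: t_def field_simps)
      finally show False by simp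
    qed
    then have zero': "P j a = 0" if "j \<in> I" for j using insert.prems(1)[of j a] that by simp
    have "(\<Sum>i\<in>I. \<Sum>j\<in>I. P i j * H i j) \<ge> 0"
    proof (rule insert.IH[OF insert.prems(1)])
      show "(\<Sum>i\<in>I. \<Sum>j\<in>I. P i j * (c i * c j)) \<ge> 0" for c
        using insert.prems(2)[of c] zero True unfolding expand by simp
    qed (rule psd_H)
    then show ?thesis using fin zero zero' True by simp
  next
    case False
    let ?e = "(\<lambda>i. 0)(a := 1 :: real)"
    have "P a a \<ge> 0"
    proof -
      have "(\<Sum>j\<in>I. P a j * ?e j) = 0" "(\<Sum>i\<in>I. \<Sum>j\<in>I. P i j * (?e i * ?e j)) = 0"
        using fin by (auto intro!: sum.neutral)
      then show ?thesis using insert.prems(2)[of ?e] unfolding expand by simp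
    qed
    then have pos: "P a a > 0" using False by simp
    define Q where "Q i j = P i j - P a i * P a j / P a a" for i j
    have Qa: "Q a j = 0" "Q j a = 0" for j
      using False insert.prems(1)[of j a] by (simp_all add: Q_def)
    have "(\<Sum>i\<in>I. \<Sum>j\<in>I. Q i j * H i j) \<ge> 0"
    proof (rule insert.IH)
      show "Q i j = Q j i" for i j by (simp add: Q_def insert.prems(1)[of i j] mult.commute)
      show "(\<Sum>i\<in>I. \<Sum>j\<in>I. Q i j * (c i * c j)) \<ge> 0" for c
      proof -
        define s where "s = (\<Sum>j\<in>I. P a j * c j)"
        \<comment> \<open>This value of the coordinate \<open>a\<close> minimises the quadratic form
          of \<open>P\<close> with the other coordinates fixed; the minimum is the form of the Schur
          complement \<open>Q\<close>.\<close>
        let ?c = "c(a := - s / P a a)"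
        have 1: "(\<Sum>j\<in>I. P a j * ?c j) = s"
          unfolding s_def using fin by (intro sum.cong) auto
        have 2: "(\<Sum>i\<in>I. \<Sum>j\<in>I. P i j * (?c i * ?c j)) = (\<Sum>i\<in>I. \<Sum>j\<in>I. P i j * (c i * c j))"
          using fin by (intro sum.cong refl) auto
        have "0 \<le> P a a * (?c a * ?c a) + 2 * ?c a * s + (\<Sum>i\<in>I. \<Sum>j\<in>I. P i j * (c i * c j))"
          using insert.prems(2)[of ?c] unfolding expand 1 2 .
        also have "\<dots> = (\<Sum>i\<in>I. \<Sum>j\<in>I. P i j * (c i * c j)) - s * s / P a a"
          using pos by (simp add: field_simps)
        also have "s * s / P a a = (\<Sum>i\<in>I. \<Sum>j\<in>I. P a i * P a j / P a a * (c i * c j))"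
          by (simp add: s_def sum_product sum_divide_distrib mult_ac)
        finally show ?thesis
          by (simp add: Q_def left_diff_distrib sum_subtractf)
      qed
    qed (rule psd_H)
    moreover have "(\<Sum>i\<in>insert a I. \<Sum>j\<in>insert a I. P i j * H i j)
      = (\<Sum>i\<in>insert a I. \<Sum>j\<in>insert a I. Q i j * H i j)
        + (\<Sum>i\<in>insert a I. \<Sum>j\<in>insert a I. H i j * (P a i * P a j)) / P a a"
      by (simp only: Q_def left_diff_distrib sum_subtractf sum_divide_distrib) (simp add: mult_ac)
    moreover have "(\<Sum>i\<in>insert a I. \<Sum>j\<in>insert a I. Q i j * H i j) = (\<Sum>i\<in>I. \<Sum>j\<in>I. Q i j * H i j)"
      using fin by (simp add: Qa)
    moreover have "(\<Sum>i\<in>insert a I. \<Sum>j\<in>insert a I. H i j * (P a i * P a j)) / P a a \<ge> 0"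
      using insert.prems(3)[of "P a"] pos by simp
    ultimately show ?thesis by linarith
  qed
qed simp

text \<open>Restriction to a line through \<open>x\<close>. A positive second derivative at the
  single point 0 already makes the first derivative positive just to the right of it, and the mean
  value theorem then gives a value above the maximum.\<close>

lemma interior_max_derivatives:
  assumes S: "open S" and F: "twice_differentiable_on S F" and x: "x \<in> S"
    and max: "\<And>y. y \<in> S \<Longrightarrow> F y \<le> F x"
  shows "partial v F x = 0" "partial v (partial v F) x \<le> 0"
proof -
  define p where "p t = x + t *\<^sub>R v" for t :: real
  have p0: "p 0 = x" by (simp add: p_def)
  have dp: "(p has_derivative (\<lambda>s. s *\<^sub>R v)) (at t)" for t
    unfolding p_def[abs_def] by (auto intro!: derivative_eq_intros)
  obtain e where e: "e > 0" "ball x e \<subseteq> S" using S x openE by blast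
  define d where "d = e / (norm v + 1)"
  have "norm v + 1 > 0" by (simp add: add_nonneg_pos)
  then have d0: "d > 0" "d * (norm v + 1) = e" using e(1) by (simp_all add: d_def)
  have "p t \<in> S" if t: "\<bar>t\<bar> < d" for t
  proof -
    have "\<bar>t\<bar> * norm v \<le> d * norm v" using t by (intro mult_right_mono) auto
    also have "\<dots> < e" using d0 by (simp add: distrib_left)
    finally show ?thesis using e(2) by (auto simp: p_def dist_norm)
  qed
  note d = d0(1) this
  have dd: "((\<lambda>t. h (p t)) has_real_derivative partial v h (p t)) (at t)" if "h differentiable (at (p t))" for h t
  proof -
    have "((\<lambda>t. h (p t)) has_derivative (\<lambda>s. partial (s *\<^sub>R v) h (p t))) (at t)"
      by (rule has_derivative_compose[OF dp has_derivative_partial[OF that]])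
    moreover have "partial (s *\<^sub>R v) h (p t) = partial v h (p t) * s" for s
      by (simp add: linear_scale[OF linear_partial[OF that]])
    ultimately show ?thesis by (simp add: has_field_derivative_def)
  qed
  have d1: "((\<lambda>t. F (p t)) has_real_derivative partial v F (p t)) (at t)" if "\<bar>t\<bar> < d" for t
    by (rule dd[OF twice_differentiable_onD(1)[OF F d(2)[OF that]]])
  have d2: "((\<lambda>t. partial v F (p t)) has_real_derivative partial v (partial v F) (p 0)) (at 0)"
    by (rule dd[OF twice_differentiable_onD(2)[OF F d(2)]]) (use d(1) in simp)
  have z: "partial v F (p 0) = 0"
    by (rule DERIV_local_max[OF d1 d(1)]) (use d max p0 in \<open>auto simp: dist_real_def\<close>)
  then show "partial v F x = 0" by (simp add: p0)
  show "partial v (partial v F) x \<le> 0"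
  proof (rule ccontr)
    assume "\<not> ?thesis"
    then have "partial v (partial v F) (p 0) > 0" by (simp add: p0)
    from DERIV_pos_inc_right[OF d2 this] obtain e where e: "e > 0"
      "\<And>h. h > 0 \<Longrightarrow> h < e \<Longrightarrow> partial v F (p 0) < partial v F (p (0 + h))" by auto
    define r where "r = min d e / 2"
    have r: "r > 0" "r < d" "r < e" using d(1) e(1) by (auto simp: r_def)
    obtain t where t: "0 < t" "t < r" "F (p r) - F (p 0) = (r - 0) * partial v F (p t)"
      using MVT2[OF r(1), of "\<lambda>t. F (p t)" "\<lambda>t. partial v F (p t)"] d1 r by auto
    have "partial v F (p t) > 0" using e(2)[of t] t r z by simp
    then have "r * partial v F (p t) > 0" using r by simp
    then have "F (p r) > F (p 0)" using t by simp
    then show False using max[OF d(2)[of r]] r p0 by simp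
  qed
qed

text \<open>At a maximum the negated Hessian is positive semidefinite, so the trace inequality
  applies to it and the coefficient matrix.\<close>

lemma second_order_nonpos_at_max:
  fixes a :: "'a::euclidean_space \<Rightarrow> 'a \<Rightarrow> real"
  assumes S: "open S" and F: "twice_differentiable_on S F" and x: "x \<in> S"
    and max: "\<And>y. y \<in> S \<Longrightarrow> F y \<le> F x"
    and sym: "\<And>j k. a j k = a k j"
    and psd: "\<And>c. (\<Sum>j\<in>Basis. \<Sum>k\<in>Basis. a j k * (c j * c k)) \<ge> 0"
  shows "(\<Sum>j\<in>Basis. \<Sum>k\<in>Basis. a j k * partial j (partial k F) x) \<le> 0"
proof -
  have lin1: "linear (\<lambda>v. partial v (partial w F) x)" for w
    by (rule linear_partial[OF twice_differentiable_onD(2)[OF F x]])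
  have lin2: "linear (\<lambda>w. partial v (partial w F) x)" for v
    by (rule linear_partial_param[OF S x]) (auto intro: linear_partial twice_differentiable_onD[OF F] x)
  have bil: "bilinear (\<lambda>v w. partial v (partial w F) x)"
    unfolding bilinear_def using lin1 lin2 by auto
  have "(\<Sum>j\<in>Basis. \<Sum>k\<in>Basis. a j k * - partial j (partial k F) x) \<ge> 0"
  proof (rule sum_mult_psd_nonneg[OF finite_Basis sym psd])
    fix c :: "'a \<Rightarrow> real"
    let ?v = "\<Sum>j\<in>Basis. c j *\<^sub>R j"
    have "partial ?v (partial ?v F) x = (\<Sum>j\<in>Basis. c j * partial j (partial ?v F) x)"
      by (rule bilinear_sum_left[OF bil])
    also have "\<dots> = (\<Sum>j\<in>Basis. \<Sum>k\<in>Basis. partial j (partial k F) x * (c j * c k))"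
      by (simp only: bilinear_sum_right[OF bil] sum_distrib_left) (simp add: mult_ac)
    finally show "(\<Sum>j\<in>Basis. \<Sum>k\<in>Basis. - partial j (partial k F) x * (c j * c k)) \<ge> 0"
      using interior_max_derivatives(2)[OF S F x max, of ?v] by (simp add: sum_negf)
  qed
  then show ?thesis by (simp add: sum_negf)
qed

text \<open>The Hopf barrier: in the second derivative the rank one part carries \<alpha>^2 and the
  rest is linear in \<alpha>, so away from \<open>z\<close> a large \<alpha> makes an elliptic
  operator positive on it.\<close>

lemma gaussian_derivatives:
  fixes z :: "'a::euclidean_space" and \<alpha> :: real
  defines "h \<equiv> \<lambda>x. exp (- (\<alpha> * ((x - z) \<bullet> (x - z))))"
  shows "partial v h x = - 2 * \<alpha> * ((x - z) \<bullet> v) * h x"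
    and "partial v (partial w h) x
      = (4 * \<alpha>\<^sup>2 * (((x - z) \<bullet> v) * ((x - z) \<bullet> w)) - 2 * \<alpha> * (v \<bullet> w)) * h x"
    and "twice_differentiable_on S h"
proof -
  have d1: "(h has_derivative (\<lambda>v. - 2 * \<alpha> * ((x - z) \<bullet> v) * h x)) (at x)" for x
    unfolding h_def
    by (rule derivative_eq_intros refl)+ (auto simp: inner_commute algebra_simps)
  have p1: "partial v h = (\<lambda>x. - 2 * \<alpha> * ((x - z) \<bullet> v) * h x)" for v
    using partial_eqI[OF d1] by blast
  then show "partial v h x = - 2 * \<alpha> * ((x - z) \<bullet> v) * h x" by simp
  have d2: "(partial w h has_derivative
      (\<lambda>v. (4 * \<alpha>\<^sup>2 * (((x - z) \<bullet> v) * ((x - z) \<bullet> w)) - 2 * \<alpha> * (v \<bullet> w)) * h x)) (at x)" for w x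
    unfolding p1
    by (rule derivative_eq_intros d1 refl)+ (auto simp: algebra_simps power2_eq_square)
  show "partial v (partial w h) x
      = (4 * \<alpha>\<^sup>2 * (((x - z) \<bullet> v) * ((x - z) \<bullet> w)) - 2 * \<alpha> * (v \<bullet> w)) * h x"
    by (rule partial_eqI[OF d2])
  show "twice_differentiable_on S h"
    unfolding twice_differentiable_on_def differentiable_def using d1 d2 by blast
qed

lemma twice_differentiable_on_add_scaled:
  assumes "twice_differentiable_on S F" "twice_differentiable_on S h" "open S"
  shows "twice_differentiable_on S (\<lambda>x. F x + \<epsilon> * h x)"
    and "x \<in> S \<Longrightarrow> partial v (\<lambda>x. F x + \<epsilon> * h x) x = partial v F x + \<epsilon> * partial v h x"
    and "x \<in> S \<Longrightarrow> partial v (partial w (\<lambda>x. F x + \<epsilon> * h x)) x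
       = partial v (partial w F) x + \<epsilon> * partial v (partial w h) x"
proof -
  note d = has_derivative_partial[OF twice_differentiable_onD(1)[OF assms(1)]]
    has_derivative_partial[OF twice_differentiable_onD(1)[OF assms(2)]]
    has_derivative_partial[OF twice_differentiable_onD(2)[OF assms(1)]]
    has_derivative_partial[OF twice_differentiable_onD(2)[OF assms(2)]]
  have 1: "((\<lambda>x. F x + \<epsilon> * h x) has_derivative (\<lambda>v. partial v F x + \<epsilon> * partial v h x)) (at x)"
    if "x \<in> S" for x
    by (intro has_derivative_add has_derivative_mult_right d that)
  then show p: "partial v (\<lambda>x. F x + \<epsilon> * h x) x = partial v F x + \<epsilon> * partial v h x" if "x \<in> S" for x v
    using partial_eqI that by blast
  have "((\<lambda>x. partial w F x + \<epsilon> * partial w h x) has_derivative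
      (\<lambda>v. partial v (partial w F) x + \<epsilon> * partial v (partial w h) x)) (at x)"
    if "x \<in> S" for x w
    by (intro has_derivative_add has_derivative_mult_right d that)
  then have 2: "(partial w (\<lambda>x. F x + \<epsilon> * h x) has_derivative
      (\<lambda>v. partial v (partial w F) x + \<epsilon> * partial v (partial w h) x)) (at x)"
    if "x \<in> S" for x w
    by (rule has_derivative_transform_within_open[OF _ assms(3) that p[symmetric]]) (use that in auto)
  then show "partial v (partial w (\<lambda>x. F x + \<epsilon> * h x)) x
       = partial v (partial w F) x + \<epsilon> * partial v (partial w h) x" if "x \<in> S" for x
    using partial_eqI that by blast
  show "twice_differentiable_on S (\<lambda>x. F x + \<epsilon> * h x)"
    using 1 2 unfolding twice_differentiable_on_def differentiable_def by blast
qed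

lemma twice_differentiable_on_subset:
  "twice_differentiable_on S F \<Longrightarrow> S' \<subseteq> S \<Longrightarrow> twice_differentiable_on S' F"
  by (auto simp: twice_differentiable_on_def)

text \<open>If the set were not open, some ball free of maximum points would touch it at a point \<open>y\<close>; adding
  a small multiple of a Gaussian centred in that ball then creates an interior maximum near \<open>y\<close>
  at which the operator is positive.\<close>

theorem strong_maximum_principle:
  fixes a :: "'a::euclidean_space \<Rightarrow> 'a \<Rightarrow> 'a \<Rightarrow> real" and b :: "'a \<Rightarrow> 'a \<Rightarrow> real"
  assumes S: "open S" and F: "twice_differentiable_on S F"
    and a_cont: "\<And>j k. continuous_on S (a j k)" and b_cont: "\<And>j. continuous_on S (b j)"
    and a_sym: "\<And>j k x. x \<in> S \<Longrightarrow> a j k x = a k j x"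
    and a_pos: "\<And>x v. x \<in> S \<Longrightarrow> v \<noteq> 0 \<Longrightarrow>
      (\<Sum>j\<in>Basis. \<Sum>k\<in>Basis. a j k x * ((v \<bullet> j) * (v \<bullet> k))) > 0"
    and L: "\<And>x. x \<in> S \<Longrightarrow> (\<Sum>j\<in>Basis. \<Sum>k\<in>Basis. a j k x * partial j (partial k F) x)
      + (\<Sum>j\<in>Basis. b j x * partial j F x) \<ge> 0"
    and m: "\<And>x. x \<in> S \<Longrightarrow> F x \<le> m"
  shows "open {x\<in>S. F x = m}"
proof (unfold open_contains_ball, intro ballI)
  fix x0 assume "x0 \<in> {x\<in>S. F x = m}"
  then have x0: "x0 \<in> S" "F x0 = m" by auto
  obtain r0 where r0: "r0 > 0" "cball x0 r0 \<subseteq> S" using S x0 open_contains_cball by blast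
  \<comment> \<open>With half the radius, the tangent ball constructed below remains inside
    \<open>cball x0 r0\<close>, where maximum points are recorded in \<open>K\<close>.\<close>
  define r where "r = r0 / 2"
  have r: "r > 0" using r0 by (simp add: r_def)
  have contF: "continuous_on S F"
    using twice_differentiable_onD(1)[OF F] S
    by (simp add: continuous_on_eq_continuous_at differentiable_imp_continuous_within)
  have "F x1 = m" if x1: "x1 \<in> ball x0 r" for x1
  proof (rule ccontr)
    assume ne: "F x1 \<noteq> m"
    define K where "K = {x\<in>cball x0 r0. F x = m}"
    have "closed K" unfolding K_def
      by (rule continuous_closed_preimage_constant[OF continuous_on_subset[OF contF r0(2)] closed_cball])
    moreover have "bounded K" by (rule bounded_subset[OF bounded_cball[of x0 r0]]) (auto simp: K_def)
    ultimately have "compact K" by (simp add: compact_eq_bounded_closed)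
    moreover have x0K: "x0 \<in> K" using x0 r0 by (auto simp: K_def)
    ultimately obtain y where y: "y \<in> K" "\<And>k. k \<in> K \<Longrightarrow> dist x1 y \<le> dist x1 k"
      using continuous_attains_inf[of K "\<lambda>k. dist x1 k"] continuous_on_dist[OF continuous_on_const continuous_on_id]
      by blast
    have yS: "y \<in> S" "F y = m" using y r0 by (auto simp: K_def)
    \<comment> \<open>The ball around \<open>z\<close> of radius \<open>R\<close> is half as large
      as the one around \<open>x1\<close> through \<open>y\<close> and internally tangent to it at
      \<open>y\<close>. Its closure therefore meets the maximum points in \<open>y\<close> alone;
      equality in the triangle inequality shows this in \<open>touch\<close>.\<close>
    define R where "R = dist x1 y / 2"
    have d1: "dist x1 y < r" using y(2)[OF x0K] x1 by (simp add: dist_commute)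
    have "x1 \<noteq> y" using ne yS by auto
    then have R: "R > 0" by (simp add: R_def)
    define z where "z = x1 + (1/2) *\<^sub>R (y - x1)"
    have zy: "norm (y - z) = R"
    proof -
      have "y - z = (1/2) *\<^sub>R (y - x1)" by (simp add: z_def algebra_simps) (simp flip: scaleR_add_left)
      then show ?thesis by (simp add: R_def dist_norm norm_minus_commute)
    qed
    have touch: "p = y" if p: "norm (p - z) \<le> R" "p \<in> S" "F p = m" for p
    proof -
      define e where "e = (1/2) *\<^sub>R (y - x1)"
      have ne: "norm e = R" by (simp add: e_def R_def dist_norm norm_minus_commute)
      have pe: "p - x1 = (p - z) + e" by (simp add: z_def e_def)
      have "norm (p - x1) \<le> 2 * R"
        unfolding pe using norm_triangle_ineq[of "p - z" e] ne p(1) by linarith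
      then have "dist x0 p \<le> r0"
        using dist_triangle[of x0 p x1] x1 d1 by (simp add: R_def r_def dist_norm norm_minus_commute)
      then have "p \<in> K" using p by (simp add: K_def)
      then have "2 * R \<le> norm (p - x1)"
        using y(2)[of p] by (simp add: R_def dist_norm norm_minus_commute)
      then have "norm (p - z) = R" "norm ((p - z) + e) = norm (p - z) + norm e"
        unfolding pe using norm_triangle_ineq[of "p - z" e] ne p(1) by linarith+
      then have "R *\<^sub>R e = R *\<^sub>R (p - z)" using norm_triangle_eq[of "p - z" e] ne by simp
      then have "e = p - z" using R by simp
      then have "p = z + e" by simp
      also have "\<dots> = x1 + (1/2 + 1/2) *\<^sub>R (y - x1)"
        unfolding z_def e_def scaleR_add_left by (simp only: add.assoc)
      finally show ?thesis by simp
    qed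
    obtain s0 where s0: "s0 > 0" "cball y s0 \<subseteq> S" using S yS open_contains_cball by blast
    \<comment> \<open>The bound \<open>R / 2\<close> keeps \<open>z\<close> out of \<open>N\<close>,
      so that \<open>x - z\<close> never vanishes there and \<open>q\<close> has a positive
      minimum.\<close>
    define s where "s = min s0 (R / 2)"
    define N where "N = cball y s"
    have s: "s > 0" using s0 R by (simp add: s_def)
    have NS: "N \<subseteq> S" using s0 by (auto simp: N_def s_def)
    have N: "compact N" "y \<in> N" "N \<noteq> {}" using s by (auto simp: N_def)
    have nz: "x - z \<noteq> 0" if "x \<in> N" for x
    proof
      assume "x - z = 0"
      then have "norm (y - z) \<le> s" using that by (simp add: N_def dist_norm)
      then show False using zy R by (simp add: s_def)
    qed
    \<comment> \<open>The operator applied to the Gaussian is 4 \<alpha>^2 q - 2 \<alpha> t times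
      the Gaussian.\<close>
    define q where "q x = (\<Sum>j\<in>Basis. \<Sum>k\<in>Basis. a j k x * (((x - z) \<bullet> j) * ((x - z) \<bullet> k)))" for x
    define t where "t x = (\<Sum>j\<in>Basis. \<Sum>k\<in>Basis. a j k x * (j \<bullet> k)) + (\<Sum>j\<in>Basis. b j x * ((x - z) \<bullet> j))" for x
    have "continuous_on N q" "continuous_on N t"
      unfolding q_def[abs_def] t_def[abs_def]
      by (intro continuous_intros continuous_on_subset[OF a_cont NS] continuous_on_subset[OF b_cont NS])+
    then obtain xq xt where xq: "xq \<in> N" "\<And>x. x \<in> N \<Longrightarrow> q xq \<le> q x"
      and xt: "xt \<in> N" "\<And>x. x \<in> N \<Longrightarrow> t x \<le> t xt"
      using continuous_attains_inf[OF N(1,3)] continuous_attains_sup[OF N(1,3)] by metis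
    have q_pos: "q xq > 0" unfolding q_def using a_pos[of xq "xq - z"] nz xq(1) NS by blast
    \<comment> \<open>Large enough that \<alpha> q is at least |t| + 1 at the extreme values, hence
      2 \<alpha> q - t is positive on all of \<open>N\<close>.\<close>
    define \<alpha> where "\<alpha> = (\<bar>t xt\<bar> + 1) / q xq"
    have \<alpha>: "\<alpha> > 0" using q_pos by (simp add: \<alpha>_def add_nonneg_pos)
    have key: "4 * \<alpha>\<^sup>2 * q x - 2 * \<alpha> * t x > 0" if x: "x \<in> N" for x
    proof -
      have "\<alpha> * q xq = \<bar>t xt\<bar> + 1" using q_pos by (simp add: \<alpha>_def)
      moreover have "\<alpha> * q xq \<le> \<alpha> * q x" using xq(2)[OF x] \<alpha> by simp
      ultimately have "2 * \<alpha> * q x - t x > 0" using xt(2)[OF x] by linarith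
      then have "2 * \<alpha> * (2 * \<alpha> * q x - t x) > 0" using \<alpha> by simp
      then show ?thesis by (simp add: power2_eq_square algebra_simps)
    qed
    define h where "h x = exp (- (\<alpha> * ((x - z) \<bullet> (x - z))))" for x
    have h: "h x > 0" "h x \<le> 1" for x using \<alpha> by (auto simp: h_def)
    have h_less: "h x < h y" if "norm (x - z) > R" for x
    proof -
      have "(y - z) \<bullet> (y - z) < (x - z) \<bullet> (x - z)"
        using that zy R power_strict_mono[of R "norm (x - z)" 2] by (simp add: dot_square_norm)
      then show ?thesis using \<alpha> by (simp add: h_def)
    qed
    \<comment> \<open>The sphere around \<open>y\<close> is treated in two parts: on the part in the
      closed tangent ball, compactness keeps \<open>F\<close> away from \<open>m\<close>; on the
      rest the barrier is smaller than at \<open>y\<close>.\<close>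
    define P where "P = sphere y s \<inter> cball z R"
    have P: "compact P" by (simp add: P_def compact_Int_closed)
    have PS: "P \<subseteq> S" using NS by (auto simp: P_def N_def)
    have "\<exists>\<delta>>0. \<forall>p\<in>P. F p \<le> m - \<delta>"
    proof (cases "P = {}")
      case False
      then obtain p where p: "p \<in> P" "\<And>p'. p' \<in> P \<Longrightarrow> F p' \<le> F p"
        using continuous_attains_sup[OF P False continuous_on_subset[OF contF PS]] by blast
      have "p \<noteq> y" using p(1) s by (auto simp: P_def)
      moreover have "p \<in> S" "norm (p - z) \<le> R"
        using p(1) PS by (auto simp: P_def dist_norm norm_minus_commute)
      ultimately have "F p < m" using touch[of p] m[of p] by force
      then show ?thesis using p(2) by (intro exI[of _ "m - F p"]) auto
    qed (auto intro: exI[of _ 1])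
    then obtain \<delta> where \<delta>: "\<delta> > 0" "\<And>p. p \<in> P \<Longrightarrow> F p \<le> m - \<delta>" by blast
    \<comment> \<open>The gap doubles as the coefficient of the barrier: the Gaussian lies in (0,
      1], so on \<open>P\<close> the function \<open>w\<close> is at most \<open>m\<close>, which is
      less than \<open>w y\<close>.\<close>
    define w where "w x = F x + \<delta> * h x" for x
    have bd: "w x < w y" if x: "x \<in> sphere y s" for x
    proof (cases "x \<in> P")
      case True
      have "w x \<le> m - \<delta> + \<delta> * 1"
        unfolding w_def using \<delta>(2)[OF True] h(2)[of x] \<delta>(1) by (intro add_mono mult_left_mono) auto
      also have "\<dots> < w y" using yS h(1)[of y] \<delta>(1) by (simp add: w_def)
      finally show ?thesis .
    next
      case False
      then have "norm (x - z) > R" using x by (auto simp: P_def dist_norm norm_minus_commute)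
      from h_less[OF this] have "\<delta> * h x < \<delta> * h y" using \<delta>(1) by simp
      moreover have "F x \<le> m" using m[of x] x NS by (auto simp: N_def)
      ultimately show ?thesis using yS by (simp add: w_def)
    qed
    have hdiff: "twice_differentiable_on S' h" for S' unfolding h_def[abs_def] by (rule gaussian_derivatives)
    note wd = twice_differentiable_on_add_scaled[OF F hdiff S, where \<epsilon> = \<delta>,
        folded w_def[abs_def]]
    have "continuous_on N w"
      using twice_differentiable_onD(1)[OF wd(1)] NS
      by (intro continuous_at_imp_continuous_on) (auto simp: differentiable_imp_continuous_within)
    then obtain p where p: "p \<in> N" "\<And>x. x \<in> N \<Longrightarrow> w x \<le> w p"
      using continuous_attains_sup[OF N(1,3)] by blast
    have "p \<notin> sphere y s" using bd[of p] p(2)[OF N(2)] by auto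
    then have pb: "p \<in> ball y s" using p(1) by (auto simp: N_def)
    have pS: "p \<in> S" using p NS by auto
    have wb: "twice_differentiable_on (ball y s) w"
      by (rule twice_differentiable_on_subset[OF wd(1)]) (use NS in \<open>auto simp: N_def\<close>)
    have pmax: "w x \<le> w p" if "x \<in> ball y s" for x using p(2)[of x] that by (auto simp: N_def)
    have grad0: "partial v w p = 0" for v
      by (rule interior_max_derivatives(1)[OF open_ball wb pb pmax])
    have "(\<Sum>j\<in>Basis. \<Sum>k\<in>Basis. a j k p * partial j (partial k w) p) \<le> 0"
    proof (rule second_order_nonpos_at_max[OF open_ball wb pb pmax])
      show "a j k p = a k j p" for j k by (rule a_sym[OF pS])
      fix c :: "'a \<Rightarrow> real"
      let ?v = "\<Sum>j\<in>Basis. c j *\<^sub>R j"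
      have "(\<Sum>j\<in>Basis. \<Sum>k\<in>Basis. a j k p * (c j * c k))
        = (\<Sum>j\<in>Basis. \<Sum>k\<in>Basis. a j k p * ((?v \<bullet> j) * (?v \<bullet> k)))"
        by (intro sum.cong refl) simp
      also have "\<dots> \<ge> 0"
      proof (cases "?v = 0")
        case False then show ?thesis using a_pos[OF pS False] by simp
      qed (simp only: inner_zero_left mult_zero_left mult_zero_right sum.neutral_const)
      finally show "(\<Sum>j\<in>Basis. \<Sum>k\<in>Basis. a j k p * (c j * c k)) \<ge> 0" .
    qed
    then have "0 \<ge> (\<Sum>j\<in>Basis. \<Sum>k\<in>Basis. a j k p * partial j (partial k w) p)
        + (\<Sum>j\<in>Basis. b j p * partial j w p)" by (simp add: grad0)
    also have "(\<Sum>j\<in>Basis. \<Sum>k\<in>Basis. a j k p * partial j (partial k w) p)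
        + (\<Sum>j\<in>Basis. b j p * partial j w p)
      = ((\<Sum>j\<in>Basis. \<Sum>k\<in>Basis. a j k p * partial j (partial k F) p) + (\<Sum>j\<in>Basis. b j p * partial j F p))
        + \<delta> * ((\<Sum>j\<in>Basis. \<Sum>k\<in>Basis. a j k p * partial j (partial k h) p)
          + (\<Sum>j\<in>Basis. b j p * partial j h p))"
      by (simp only: wd(2,3)[OF pS] distrib_left sum.distrib sum_distrib_left) (simp add: mult_ac)
    also have "(\<Sum>j\<in>Basis. \<Sum>k\<in>Basis. a j k p * partial j (partial k h) p) + (\<Sum>j\<in>Basis. b j p * partial j h p)
      = (4 * \<alpha>\<^sup>2 * q p - 2 * \<alpha> * t p) * h p"
      unfolding h_def[abs_def] gaussian_derivatives(1,2) q_def t_def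
      by (simp only: left_diff_distrib right_diff_distrib distrib_left sum_subtractf sum_distrib_left
          sum_distrib_right sum_negf minus_mult_left[symmetric] minus_mult_right[symmetric])
         (simp add: mult_ac sum_negf sum_distrib_left distrib_left)
    finally have "(4 * \<alpha>\<^sup>2 * q p - 2 * \<alpha> * t p) * h p * \<delta> \<le> 0" using L[OF pS] by (simp add: mult_ac)
    moreover have "(4 * \<alpha>\<^sup>2 * q p - 2 * \<alpha> * t p) * h p * \<delta> > 0"
      using key[OF p(1)] h(1)[of p] \<delta>(1) by simp
    ultimately show False by simp
  qed
  moreover have "ball x0 r \<subseteq> S" using r0 by (auto simp: r_def subset_iff)
  ultimately show "\<exists>e>0. ball x0 e \<subseteq> {x\<in>S. F x = m}" using r by blast
qed

section \<open>Application to the Laplacian of a metric\<close>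

lemma sum_inv_metric_pos:
  assumes B: "inner_form (G x)"
  shows "v \<noteq> 0 \<Longrightarrow> (\<Sum>j\<in>Basis. \<Sum>k\<in>Basis. inv_metric G j k x * ((v \<bullet> j) * (v \<bullet> k))) > 0"
    and "(\<Sum>j\<in>Basis. \<Sum>k\<in>Basis. inv_metric G j k x * (c j * c k)) \<ge> 0"
proof -
  note ls = linear_sharp[OF B]
  have eq: "(\<Sum>j\<in>Basis. \<Sum>k\<in>Basis. inv_metric G j k x * ((v \<bullet> j) * (v \<bullet> k))) = G x (sharp (G x) v) (sharp (G x) v)" for v
  proof -
    have "(\<Sum>j\<in>Basis. \<Sum>k\<in>Basis. inv_metric G j k x * ((v \<bullet> j) * (v \<bullet> k)))
        = (\<Sum>j\<in>Basis. (v \<bullet> j) * ((\<Sum>k\<in>Basis. (v \<bullet> k) *\<^sub>R sharp (G x) k) \<bullet> j))"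
      by (simp add: inv_metric_eq_sharp inner_sum_left sum_distrib_left mult_ac del: inner_sum_left_Basis)
    also have "(\<Sum>k\<in>Basis. (v \<bullet> k) *\<^sub>R sharp (G x) k) = sharp (G x) (\<Sum>k\<in>Basis. (v \<bullet> k) *\<^sub>R k)"
      by (simp only: linear_sum[OF ls] linear_scale[OF ls])
    also have "\<dots> = sharp (G x) v" by (simp only: euclidean_representation)
    also have "(\<Sum>j\<in>Basis. (v \<bullet> j) * (sharp (G x) v \<bullet> j)) = v \<bullet> sharp (G x) v"
      by (rule euclidean_inner[symmetric])
    finally show ?thesis by (simp add: sharp[OF B])
  qed
  show pos: "(\<Sum>j\<in>Basis. \<Sum>k\<in>Basis. inv_metric G j k x * ((v \<bullet> j) * (v \<bullet> k))) > 0" if "v \<noteq> 0" for v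
  proof -
    have "sharp (G x) v \<noteq> 0"
    proof
      assume "sharp (G x) v = 0"
      then have "v \<bullet> v = 0" using sharp[OF B, of v v] linear_0[OF inner_formD(5)[OF B]] by simp
      then show False using that by simp
    qed
    then show ?thesis unfolding eq by (rule inner_formD(3)[OF B])
  qed
  let ?v = "\<Sum>j\<in>Basis. c j *\<^sub>R j"
  have "(\<Sum>j\<in>Basis. \<Sum>k\<in>Basis. inv_metric G j k x * (c j * c k))
    = (\<Sum>j\<in>Basis. \<Sum>k\<in>Basis. inv_metric G j k x * ((?v \<bullet> j) * (?v \<bullet> k)))"
    by (intro sum.cong refl) simp
  also have "\<dots> \<ge> 0"
  proof (cases "?v = 0")
    case False then show ?thesis using pos[of ?v] by simp
  qed (simp only: inner_zero_left mult_zero_left mult_zero_right sum.neutral_const)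
  finally show "(\<Sum>j\<in>Basis. \<Sum>k\<in>Basis. inv_metric G j k x * (c j * c k)) \<ge> 0" .
qed

text \<open>The Christoffel terms of the Laplacian multiply first derivatives, which vanish at the
  maximum; the second-order part is controlled by positivity of the inverse metric.\<close>

lemma laplacian_nonpos_at_max:
  assumes G: "metric_on S G" and F: "twice_differentiable_on S F" and x: "x \<in> S"
    and max: "\<And>y. y \<in> S \<Longrightarrow> F y \<le> F x"
  shows "laplacian G F x \<le> 0" "grad_sq G F x = 0"
proof -
  note B = metric_onD(2)[OF G x]
  have g: "partial v F x = 0" for v
    by (rule interior_max_derivatives(1)[OF metric_onD(1)[OF G] F x max])
  then show "grad_sq G F x = 0" by (simp add: grad_sq_def)
  have "(\<Sum>j\<in>Basis. \<Sum>k\<in>Basis. inv_metric G j k x * partial j (partial k F) x) \<le> 0"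
    by (rule second_order_nonpos_at_max[OF metric_onD(1)[OF G] F x max])
       (simp_all add: sum_inv_metric_pos(2)[of G x, OF B] inv_metric_sym[of G x, OF B])
  then show "laplacian G F x \<le> 0" by (simp add: laplacian_def hess_def g)
qed

text \<open>The coefficients of the linear operator are built from \<open>F\<close> itself:
  \<open>F > 0\<close> makes 2 F times the inverse metric elliptic, and the drift collects \<kappa>
  times the gradient and the Christoffel terms of the Hessian. Both are continuous because
  \<open>F\<close> and the metric have two derivatives.\<close>

lemma strong_maximum_principle_laplacian:
  assumes G: "metric_on S G" and F: "twice_differentiable_on S F" and pos: "\<And>x. x \<in> S \<Longrightarrow> F x > 0"
    and L: "\<And>x. x \<in> S \<Longrightarrow> 2 * F x * laplacian G F x + \<kappa> * grad_sq G F x \<ge> 0"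
    and m: "\<And>x. x \<in> S \<Longrightarrow> F x \<le> m"
  shows "open {x\<in>S. F x = m}"
proof (rule strong_maximum_principle[OF metric_onD(1)[OF G] F])
  let ?a = "\<lambda>j k x. 2 * F x * inv_metric G j k x"
  let ?b = "\<lambda>i x. \<kappa> * grad_comp G F i x
    - 2 * F x * (\<Sum>j\<in>Basis. \<Sum>k\<in>Basis. inv_metric G j k x * christoffel G i j k x)"
  have cont: "continuous_on S h" if "\<And>x. x \<in> S \<Longrightarrow> h differentiable (at x)" for h :: "'a \<Rightarrow> real"
    using that by (intro continuous_at_imp_continuous_on) (auto simp: differentiable_imp_continuous_within)
  note diff = twice_differentiable_onD(1)[OF F] inv_metric_differentiable[OF G] christoffel_differentiable[OF G]
    grad_comp_differentiable[OF G F]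
  show "continuous_on S (?a j k)" for j k
    by (rule cont) (intro differentiable_mult differentiable_const diff)
  show "continuous_on S (?b i)" for i
    by (rule cont) (intro differentiable_diff differentiable_mult differentiable_const differentiable_sum
        ballI finite_Basis diff)
  show "?a j k x = ?a k j x" if "x \<in> S" for j k x
    using inv_metric_sym[of G x, OF metric_onD(2)[OF G that]] by simp
  show "(\<Sum>j\<in>Basis. \<Sum>k\<in>Basis. ?a j k x * ((v \<bullet> j) * (v \<bullet> k))) > 0" if "x \<in> S" "v \<noteq> 0" for x v
  proof -
    have "(\<Sum>j\<in>Basis. \<Sum>k\<in>Basis. ?a j k x * ((v \<bullet> j) * (v \<bullet> k)))
      = 2 * F x * (\<Sum>j\<in>Basis. \<Sum>k\<in>Basis. inv_metric G j k x * ((v \<bullet> j) * (v \<bullet> k)))"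
      by (simp only: sum_distrib_left mult.assoc)
    then show ?thesis
      using sum_inv_metric_pos(1)[of G x, OF metric_onD(2)[OF G that(1)] that(2)] pos[OF that(1)] by simp
  qed
  show "(\<Sum>j\<in>Basis. \<Sum>k\<in>Basis. ?a j k x * partial j (partial k F) x)
      + (\<Sum>i\<in>Basis. ?b i x * partial i F x) \<ge> 0" if "x \<in> S" for x
  proof -
    have "(\<Sum>i\<in>Basis. (\<Sum>j\<in>Basis. \<Sum>k\<in>Basis. inv_metric G j k x * christoffel G i j k x) * partial i F x)
      = (\<Sum>j\<in>Basis. \<Sum>k\<in>Basis. inv_metric G j k x * (\<Sum>i\<in>Basis. christoffel G i j k x * partial i F x))"
      unfolding sum_distrib_left sum_distrib_right
      by (subst sum.swap, rule sum.cong[OF refl], subst sum.swap) (simp add: mult.assoc)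
    then have "(\<Sum>j\<in>Basis. \<Sum>k\<in>Basis. ?a j k x * partial j (partial k F) x) + (\<Sum>i\<in>Basis. ?b i x * partial i F x)
      = 2 * F x * ((\<Sum>j\<in>Basis. \<Sum>k\<in>Basis. inv_metric G j k x * partial j (partial k F) x)
          - (\<Sum>j\<in>Basis. \<Sum>k\<in>Basis. inv_metric G j k x * (\<Sum>i\<in>Basis. christoffel G i j k x * partial i F x)))
        + \<kappa> * (\<Sum>i\<in>Basis. partial i F x * grad_comp G F i x)"
      by (simp only: left_diff_distrib right_diff_distrib sum_subtractf mult.assoc sum_distrib_left[symmetric])
         (simp add: mult_ac)
    also have "\<dots> = 2 * F x * laplacian G F x + \<kappa> * grad_sq G F x"
      by (simp add: laplacian_def hess_def grad_sq_eq right_diff_distrib sum_subtractf)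
    finally show ?thesis using L[OF that] by simp
  qed
qed (rule m)

section \<open>Charts\<close>

lemma smooth_onD:
  assumes "smooth_on S f"
  shows "continuous_on S f" "x \<in> S \<Longrightarrow> f differentiable (at x)"
    "smooth_on S (\<lambda>x. frechet_derivative f (at x) v)"
proof -
  have Ck: "Ck_on k S f" for k using assms by (simp add: smooth_on_def)
  show "continuous_on S f" using Ck[of 0] by simp
  show "f differentiable (at x)" if "x \<in> S" using Ck[of "Suc 0"] that by simp
  show "smooth_on S (\<lambda>x. frechet_derivative f (at x) v)"
    unfolding smooth_on_def using Ck[of "Suc _"] by simp
qed

lemma smooth_on_partial: "smooth_on S f \<Longrightarrow> smooth_on S (partial v f)"
  using smooth_onD(3)[of S f v] by (simp add: partial_def[abs_def])

lemma smooth_on_imp_twice_differentiable_on: "smooth_on S f \<Longrightarrow> twice_differentiable_on S f"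
  unfolding twice_differentiable_on_def using smooth_onD(2) smooth_on_partial by blast

text \<open>Slice derivatives are derivatives in the directions \<open>(v, 0)\<close> and
  \<open>(0, v)\<close>. Smoothness on the product is given only in product charts; this turns it
  into regularity of \<open>u\<close> and \<open>w\<close> on the single factors.\<close>

lemma twice_differentiable_on_slice:
  fixes F :: "'a::euclidean_space \<times> 'b::euclidean_space \<Rightarrow> real"
  assumes F: "smooth_on (S \<times> T) F"
  shows "y \<in> T \<Longrightarrow> open S \<Longrightarrow> twice_differentiable_on S (\<lambda>x. F (x, y))"
    and "x \<in> S \<Longrightarrow> open T \<Longrightarrow> twice_differentiable_on T (\<lambda>y. F (x, y))"
proof -
  have d1: "((\<lambda>x. h (x, y)) has_derivative (\<lambda>v. partial (v, 0) h (x, y))) (at x)"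
    and d2: "((\<lambda>y. h (x, y)) has_derivative (\<lambda>v. partial (0, v) h (x, y))) (at y)"
    if "smooth_on (S \<times> T) h" "x \<in> S" "y \<in> T" for h :: "'a \<times> 'b \<Rightarrow> real" and x y
  proof -
    have h: "(h has_derivative (\<lambda>v. partial v h (x, y))) (at (x, y))"
      using has_derivative_partial smooth_onD(2)[OF that(1)] that(2,3) by blast
    have "((\<lambda>x. (x, y)) has_derivative (\<lambda>v. (v, 0))) (at x)"
      "((\<lambda>y. (x, y)) has_derivative (\<lambda>v. (0, v))) (at y)"
      by (auto intro!: derivative_eq_intros)
    from this[THEN has_derivative_compose, OF h]
    show "((\<lambda>x. h (x, y)) has_derivative (\<lambda>v. partial (v, 0) h (x, y))) (at x)"
      "((\<lambda>y. h (x, y)) has_derivative (\<lambda>v. partial (0, v) h (x, y))) (at y)" .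
  qed
  show "twice_differentiable_on S (\<lambda>x. F (x, y))" if y: "y \<in> T" and S: "open S"
    unfolding twice_differentiable_on_def
  proof (intro ballI conjI allI)
    fix x v assume x: "x \<in> S"
    show "(\<lambda>x. F (x, y)) differentiable (at x)"
      using d1[OF F x y] unfolding differentiable_def by blast
    have "(\<lambda>x. partial (v, 0) F (x, y)) differentiable (at x)"
      using d1[OF smooth_on_partial[OF F] x y] unfolding differentiable_def by blast
    then show "partial v (\<lambda>x. F (x, y)) differentiable (at x)"
      using differentiable_cong_open[OF S x, of "partial v (\<lambda>x. F (x, y))" "\<lambda>x. partial (v, 0) F (x, y)"]
        partial_eqI[OF d1[OF F _ y]] by blast
  qed
  show "twice_differentiable_on T (\<lambda>y. F (x, y))" if x: "x \<in> S" and T: "open T"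
    unfolding twice_differentiable_on_def
  proof (intro ballI conjI allI)
    fix y v assume y: "y \<in> T"
    show "(\<lambda>y. F (x, y)) differentiable (at y)"
      using d2[OF F x y] unfolding differentiable_def by blast
    have "(\<lambda>y. partial (0, v) F (x, y)) differentiable (at y)"
      using d2[OF smooth_on_partial[OF F] x y] unfolding differentiable_def by blast
    then show "partial v (\<lambda>y. F (x, y)) differentiable (at y)"
      using differentiable_cong_open[OF T y, of "partial v (\<lambda>y. F (x, y))" "\<lambda>y. partial (0, v) F (x, y)"]
        partial_eqI[OF d2[OF F x]] by blast
  qed
qed

section \<open>Transition maps and coordinate expressions of the metric\<close>

lemma is_chartD:
  assumes "is_chart c"
  shows "open (cdom c)" "open (cimage c)" "continuous_on (cdom c) (cmap c)" "continuous_on (cimage c) (cinv c)"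
    "p \<in> cdom c \<Longrightarrow> cinv c (cmap c p) = p"
    "x \<in> cimage c \<Longrightarrow> cmap c (cinv c x) = x" "x \<in> cimage c \<Longrightarrow> cinv c x \<in> cdom c"
  using assms by (auto simp: is_chart_def homeomorphism_def)

abbreviation overlap :: "('m, 'a) chart \<Rightarrow> ('m, 'a) chart \<Rightarrow> 'a set" where
  "overlap c d \<equiv> cmap c ` (cdom c \<inter> cdom d)"

lemma open_overlap:
  assumes c: "is_chart c" and d: "is_chart d"
  shows "open (overlap c d)"
proof -
  have "overlap c d = cimage c \<inter> cinv c -` cdom d" using is_chartD(5)[OF c] by auto
  then show ?thesis
    using continuous_open_preimage[OF is_chartD(4,2)[OF c] is_chartD(1)[OF d]] by simp
qed

lemma smooth_manifoldD:
  assumes "smooth_manifold M"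
  shows "c \<in> atlas M \<Longrightarrow> is_chart c" "chart_at M p \<in> atlas M" "p \<in> cdom (chart_at M p)"
    "c \<in> atlas M \<Longrightarrow> d \<in> atlas M \<Longrightarrow> smooth_on (overlap c d) (cmap d \<circ> cinv c)"
  using assms by (auto simp: smooth_manifold_def)

text \<open>The reverse transition map undoes this one on the open overlap, so the chain rule
  supplies a left inverse of the differential; equality of dimensions gives surjectivity.\<close>

lemma transition:
  assumes M: "smooth_manifold M" and c: "c \<in> atlas M" and d: "d \<in> atlas M" and y: "y \<in> overlap c d"
  shows "(cmap d \<circ> cinv c) y \<in> overlap d c"
    and "((cmap d \<circ> cinv c) has_derivative frechet_derivative (cmap d \<circ> cinv c) (at y)) (at y)"
    and "inj (frechet_derivative (cmap d \<circ> cinv c) (at y))"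
    and "surj (frechet_derivative (cmap d \<circ> cinv c) (at y))"
proof -
  note C = is_chartD[OF smooth_manifoldD(1)[OF M c]] and D = is_chartD[OF smooth_manifoldD(1)[OF M d]]
  let ?f = "cmap d \<circ> cinv c" and ?g = "cmap c \<circ> cinv d"
  show fy: "?f y \<in> overlap d c" using y C(5) by auto
  show df: "(?f has_derivative frechet_derivative ?f (at y)) (at y)"
    using smooth_onD(2)[OF smooth_manifoldD(4)[OF M c d] y] by (simp add: frechet_derivative_works)
  have dg: "(?g has_derivative frechet_derivative ?g (at (?f y))) (at (?f y))"
    using smooth_onD(2)[OF smooth_manifoldD(4)[OF M d c] fy] by (simp add: frechet_derivative_works)
  have "((\<lambda>y. ?g (?f y)) has_derivative (\<lambda>v. frechet_derivative ?g (at (?f y)) (frechet_derivative ?f (at y) v))) (at y)"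
    by (rule has_derivative_compose[OF df dg])
  moreover have "?g (?f z) = z" if "z \<in> overlap c d" for z using that C(5) D(5) by auto
  ultimately have "((\<lambda>y. y) has_derivative (\<lambda>v. frechet_derivative ?g (at (?f y)) (frechet_derivative ?f (at y) v))) (at y)"
    by (rule has_derivative_transform_within_open[OF _
        open_overlap[OF smooth_manifoldD(1)[OF M c] smooth_manifoldD(1)[OF M d]] y])
  then have "(\<lambda>v. frechet_derivative ?g (at (?f y)) (frechet_derivative ?f (at y) v)) = (\<lambda>v. v)"
    by (rule has_derivative_unique) (rule has_derivative_ident)
  then have "frechet_derivative ?g (at (?f y)) (frechet_derivative ?f (at y) v) = v" for v by (rule fun_cong)
  then show inj: "inj (frechet_derivative ?f (at y))" by (rule inj_on_inverseI)
  show "surj (frechet_derivative ?f (at y))"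
    by (rule linear_inj_imp_surj[OF has_derivative_linear[OF df] inj])
qed

text \<open>Both sides evaluate \<open>g\<close> at the same point in the same preferred chart
  \<open>e\<close>; differentiating the cocycle identity of the transition maps at \<open>y\<close>
  relates the arguments.\<close>

lemma metric_in_transition:
  assumes M: "smooth_manifold M" and c: "c \<in> atlas M" and d: "d \<in> atlas M" and y: "y \<in> overlap c d"
  shows "metric_in M g c y v w = metric_in M g d ((cmap d \<circ> cinv c) y)
    (frechet_derivative (cmap d \<circ> cinv c) (at y) v) (frechet_derivative (cmap d \<circ> cinv c) (at y) w)"
proof -
  note C = is_chartD[OF smooth_manifoldD(1)[OF M c]] and D = is_chartD[OF smooth_manifoldD(1)[OF M d]]
  let ?f = "cmap d \<circ> cinv c"
  define p where "p = cinv c y"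
  have p: "p \<in> cdom c" "p \<in> cdom d" "cmap c p = y" using y C(5) by (auto simp: p_def)
  have pf: "cinv d (?f y) = p" using p D(5) by (simp add: p_def[symmetric])
  define e where "e = chart_at M p"
  have e: "e \<in> atlas M" "p \<in> cdom e" unfolding e_def using smooth_manifoldD(2,3)[OF M] by auto
  have fy: "?f y \<in> overlap d e" using p e D(5) by (auto simp: p_def[symmetric])
  have "((\<lambda>z. (cmap e \<circ> cinv d) (?f z)) has_derivative
      (\<lambda>v. frechet_derivative (cmap e \<circ> cinv d) (at (?f y)) (frechet_derivative ?f (at y) v))) (at y)"
    by (rule has_derivative_compose[OF transition(2)[OF M c d y] transition(2)[OF M d e(1) fy]])
  moreover have "(cmap e \<circ> cinv d) (?f z) = (cmap e \<circ> cinv c) z" if "z \<in> overlap c d" for z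
    using that C(5) D(5) by auto
  ultimately have "((cmap e \<circ> cinv c) has_derivative
      (\<lambda>v. frechet_derivative (cmap e \<circ> cinv d) (at (?f y)) (frechet_derivative ?f (at y) v))) (at y)"
    by (rule has_derivative_transform_within_open[OF _
        open_overlap[OF smooth_manifoldD(1)[OF M c] smooth_manifoldD(1)[OF M d]] y])
  from frechet_derivative_at[OF this] show ?thesis
    unfolding metric_in_def Let_def pf p_def[symmetric] e_def[symmetric] by metis
qed

lemma metric_on_metric_in:
  assumes M: "riemannian_manifold M g" and c: "c \<in> atlas M"
  shows "metric_on (cimage c) (metric_in M g c)"
proof -
  have sm: "smooth_manifold M" and g: "riemannian_metric M g"
    using M by (auto simp: riemannian_manifold_def)
  note C = is_chartD[OF smooth_manifoldD(1)[OF sm c]]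
  have "inner_form (metric_in M g c x)" if x: "x \<in> cimage c" for x
  proof -
    define p where "p = cinv c x"
    define T where "T = frechet_derivative (cmap (chart_at M p) \<circ> cinv c) (at x)"
    have eq: "metric_in M g c x = (\<lambda>v w. g p (T v) (T w))"
      by (simp add: metric_in_def Let_def p_def T_def fun_eq_iff)
    have "x \<in> overlap c (chart_at M p)"
      using C(6,7)[OF x] smooth_manifoldD(3)[OF sm, of p] by (auto simp: p_def image_iff intro!: bexI[of _ p])
    note tr = transition[OF sm c smooth_manifoldD(2)[OF sm] this]
    have T: "linear T" "inj T" unfolding T_def using has_derivative_linear[OF tr(2)] tr(3) by auto
    have bil: "bilinear (g p)" using g by (simp add: riemannian_metric_def)
    then have "bilinear (metric_in M g c x)"
      unfolding eq bilinear_def using linear_compose[OF T(1)] by (auto simp: o_def)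
    moreover have "T v \<noteq> 0" if "v \<noteq> 0" for v
      using T that linear_0[OF T(1)] by (metis injD)
    ultimately show ?thesis
      using g unfolding inner_form_def by (auto simp: riemannian_metric_def eq)
  qed
  moreover have "twice_differentiable_on (cimage c) (\<lambda>x. metric_in M g c x v w)" for v w
    using g c by (intro smooth_on_imp_twice_differentiable_on) (simp add: riemannian_metric_def)
  ultimately show ?thesis
    using C(2) by (simp add: metric_on_def twice_differentiable_on_def)
qed

section \<open>Independence of the chart\<close>

lemma laplacian_cong:
  assumes "open S" "x \<in> S" "\<And>y. y \<in> S \<Longrightarrow> F y = H y"
  shows "laplacian G F x = laplacian G H x" "grad_sq G F x = grad_sq G H x"
proof -
  have 1: "partial v F y = partial v H y" if "y \<in> S" for y v
    by (rule partial_cong[OF assms(1) that assms(3)])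
  have 2: "partial v (partial w F) x = partial v (partial w H) x" for v w
    by (rule partial_cong[OF assms(1,2) 1])
  show "laplacian G F x = laplacian G H x" "grad_sq G F x = grad_sq G H x"
    by (simp_all add: laplacian_def hess_def grad_sq_def 1[OF assms(2)] 2)
qed

lemma laplacian_const:
  fixes x :: "'a::euclidean_space"
  shows "laplacian G (\<lambda>x. k) x = 0" "grad_sq G (\<lambda>x. k) x = 0"
proof -
  have "partial v (\<lambda>x. k) = (\<lambda>x. 0)" for v :: 'a and k by (simp add: partial_def fun_eq_iff)
  then show "laplacian G (\<lambda>x. k) x = 0" "grad_sq G (\<lambda>x. k) x = 0"
    by (simp_all add: laplacian_def hess_def grad_sq_def)
qed

lemma symmetric_second_derivative_smooth:
  fixes f :: "'a::euclidean_space \<Rightarrow> 'b::euclidean_space"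
  assumes S: "open S" "x \<in> S" and f: "smooth_on S f"
  shows "frechet_derivative (\<lambda>y. frechet_derivative f (at y) v) (at x) u
       = frechet_derivative (\<lambda>y. frechet_derivative f (at y) u) (at x) v"
proof (rule euclidean_eqI)
  fix b :: 'b assume "b \<in> Basis"
  let ?D = "\<lambda>y v. frechet_derivative f (at y) v"
  have inner: "((\<lambda>y. h y \<bullet> b) has_derivative (\<lambda>v. frechet_derivative h (at y) v \<bullet> b)) (at y)"
    if "smooth_on S h" "y \<in> S" for h :: "'a \<Rightarrow> 'b" and y
    using smooth_onD(2)[OF that]
    by (intro has_derivative_inner_left) (simp add: frechet_derivative_works)
  have p: "partial v (\<lambda>y. f y \<bullet> b) y = ?D y v \<bullet> b" if "y \<in> S" for v y
    by (rule partial_eqI[OF inner[OF f that]])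
  have p2: "partial u (partial v (\<lambda>y. f y \<bullet> b)) y = frechet_derivative (\<lambda>y. ?D y v) (at y) u \<bullet> b"
    if "y \<in> S" for u v y
    by (rule trans[OF partial_cong[OF S(1) that] partial_eqI[OF inner[OF smooth_onD(3)[OF f] that]]])
       (rule p)
  have d: "partial v (\<lambda>y. f y \<bullet> b) differentiable (at y)" if "y \<in> S" for v y
  proof -
    have "(\<lambda>y. ?D y v \<bullet> b) differentiable (at y)"
      using inner[OF smooth_onD(3)[OF f] that] unfolding differentiable_def by blast
    then show ?thesis
      using differentiable_cong_open[OF S(1) that, of "partial v (\<lambda>y. f y \<bullet> b)" "\<lambda>y. ?D y v \<bullet> b"] p by blast
  qed
  have cont: "isCont (partial u (partial v (\<lambda>y. f y \<bullet> b))) x" for u v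
  proof -
    have "continuous_on S (\<lambda>y. frechet_derivative (\<lambda>y. ?D y v) (at y) u \<bullet> b)"
      by (intro continuous_intros smooth_onD(1) smooth_onD(3) f)
    then have "continuous_on S (partial u (partial v (\<lambda>y. f y \<bullet> b)))"
      by (rule continuous_on_eq) (simp add: p2)
    then show ?thesis using S continuous_on_eq_continuous_at by blast
  qed
  have "partial u (partial v (\<lambda>y. f y \<bullet> b)) x = partial v (partial u (\<lambda>y. f y \<bullet> b)) x"
  proof (rule symmetric_second_derivative[OF S])
    show "(\<lambda>y. f y \<bullet> b) differentiable (at y)" if "y \<in> S" for y
      using inner[OF f that] unfolding differentiable_def by blast
  qed (simp_all add: d cont)
  then show "frechet_derivative (\<lambda>y. ?D y v) (at x) u \<bullet> b = frechet_derivative (\<lambda>y. ?D y u) (at x) v \<bullet> b"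
    by (simp add: p2[OF S(2)])
qed

lemma metric_on_subset: "metric_on S G \<Longrightarrow> open S' \<Longrightarrow> S' \<subseteq> S \<Longrightarrow> metric_on S' G"
  by (auto simp: metric_on_def)

text \<open>This lets an inequality that is known at every point in the preferred chart of that
  point be read in one fixed chart around a given point.\<close>

lemma laplacian_chart_independent:
  assumes M: "riemannian_manifold M g" and c: "c \<in> atlas M" and d: "d \<in> atlas M"
    and p: "p \<in> cdom c" "p \<in> cdom d" and u: "twice_differentiable_on (cimage d) (u \<circ> cinv d)"
  shows "laplacian (metric_in M g c) (u \<circ> cinv c) (cmap c p)
      = laplacian (metric_in M g d) (u \<circ> cinv d) (cmap d p)"
    and "grad_sq (metric_in M g c) (u \<circ> cinv c) (cmap c p)
      = grad_sq (metric_in M g d) (u \<circ> cinv d) (cmap d p)"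
proof -
  have sm: "smooth_manifold M" using M by (auto simp: riemannian_manifold_def)
  note C = is_chartD[OF smooth_manifoldD(1)[OF sm c]] and E = is_chartD[OF smooth_manifoldD(1)[OF sm d]]
  let ?f = "cmap d \<circ> cinv c" and ?x = "cmap c p"
  have x: "?x \<in> overlap c d" using p by auto
  have op: "open (overlap c d)" by (rule open_overlap[OF smooth_manifoldD(1)[OF sm c] smooth_manifoldD(1)[OF sm d]])
  have f: "smooth_on (overlap c d) ?f" by (rule smooth_manifoldD(4)[OF sm c d])
  interpret coordinate_change "overlap c d" "cimage d" ?f "metric_in M g c" "metric_in M g d" "u \<circ> cinv d" ?x
    "\<lambda>y. frechet_derivative ?f (at y)"
    "\<lambda>u v. frechet_derivative (\<lambda>y. frechet_derivative ?f (at y) v) (at ?x) u"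
  proof
    show "metric_on (overlap c d) (metric_in M g c)"
      by (rule metric_on_subset[OF metric_on_metric_in[OF M c] op]) auto
    show "metric_on (cimage d) (metric_in M g d)" by (rule metric_on_metric_in[OF M d])
    show "twice_differentiable_on (cimage d) (u \<circ> cinv d)" by (rule u)
    show "?f y \<in> cimage d" if "y \<in> overlap c d" for y using transition(1)[OF sm c d that] by auto
    show "?x \<in> overlap c d" by (rule x)
    show "(?f has_derivative frechet_derivative ?f (at y)) (at y)" if "y \<in> overlap c d" for y
      by (rule transition(2)[OF sm c d that])
    show "((\<lambda>y. frechet_derivative ?f (at y) v) has_derivative
        (\<lambda>u. frechet_derivative (\<lambda>y. frechet_derivative ?f (at y) v) (at ?x) u)) (at ?x)" for v
      using smooth_onD(2)[OF smooth_onD(3)[OF f] x] by (simp add: frechet_derivative_works)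
    show "frechet_derivative (\<lambda>y. frechet_derivative ?f (at y) v) (at ?x) u
        = frechet_derivative (\<lambda>y. frechet_derivative ?f (at y) u) (at ?x) v" for u v
      by (rule symmetric_second_derivative_smooth[OF op x f])
    show "surj (frechet_derivative ?f (at ?x))" by (rule transition(4)[OF sm c d x])
    show "metric_in M g c y v w = metric_in M g d (?f y) (frechet_derivative ?f (at y) v)
        (frechet_derivative ?f (at y) w)" if "y \<in> overlap c d" for y v w
      by (rule metric_in_transition[OF sm c d that])
  qed
  have eq: "(u \<circ> cinv d) (?f y) = (u \<circ> cinv c) y" if "y \<in> overlap c d" for y
    using that C(5) E(5) by auto
  have fx: "?f ?x = cmap d p" using C(5) p by simp
  show "laplacian (metric_in M g c) (u \<circ> cinv c) (cmap c p)
      = laplacian (metric_in M g d) (u \<circ> cinv d) (cmap d p)"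
    using laplacian_pullback fx laplacian_cong(1)[OF op x, of "\<lambda>y. (u \<circ> cinv d) (?f y)" "u \<circ> cinv c"] eq
    by simp
  show "grad_sq (metric_in M g c) (u \<circ> cinv c) (cmap c p)
      = grad_sq (metric_in M g d) (u \<circ> cinv d) (cmap d p)"
    using grad_sq_pullback fx laplacian_cong(2)[OF op x, of "\<lambda>y. (u \<circ> cinv d) (?f y)" "u \<circ> cinv c"] eq
    by simp
qed

section \<open>Closed manifolds\<close>

lemma scalar_curvature_eq_scal:
  "scalar_curvature M g p = scal (metric_in M g (chart_at M p)) (cmap (chart_at M p) p)"
  by (simp add: scalar_curvature_def scal_def Let_def)

text \<open>One of the two summands of \<open>u\<^sup>2 w\<^sup>2 R\<close>; \<open>n\<close> is the dimension of the other factor.\<close>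

definition reduced_curvature ::
  "('m, 'a::euclidean_space) manifold \<Rightarrow> ('m, 'a) tensor2 \<Rightarrow> real \<Rightarrow> ('m \<Rightarrow> real) \<Rightarrow> 'm \<Rightarrow> real" where
  "reduced_curvature M g n u p =
     (let c = chart_at M p; G = metric_in M g c; x = cmap c p
      in (u p)\<^sup>2 * scalar_curvature M g p - 2 * n * u p * laplacian G (u \<circ> cinv c) x
         - n * (n - 1) * grad_sq G (u \<circ> cinv c) x)"

text \<open>Compactness supplies the maximum point for the first claim. For the second, the maximum
  principle is local: it shows in charts that the set where \<open>u\<close> attains its maximum is
  open, and connectedness makes it the whole manifold.\<close>

lemma
  fixes M :: "('m::{t2_space, second_countable_topology}, 'a::euclidean_space) manifold"
  assumes M: "riemannian_manifold M g" and compact: "compact (UNIV :: 'm set)"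
    and R: "\<And>p. scalar_curvature M g p \<ge> 0" and n: "n > 0"
    and u: "\<And>c. c \<in> atlas M \<Longrightarrow> twice_differentiable_on (cimage c) (u \<circ> cinv c)"
    and u_pos: "\<And>p. u p > 0"
  shows reduced_curvature_nonneg_somewhere: "\<exists>p. reduced_curvature M g n u p \<ge> 0"
    and reduced_curvature_eq_0: "connected (UNIV :: 'm set) \<Longrightarrow>
      (\<And>p. reduced_curvature M g n u p \<le> 0) \<Longrightarrow> reduced_curvature M g n u p = 0"
proof -
  have sm: "smooth_manifold M" using M by (simp add: riemannian_manifold_def)
  note charts = smooth_manifoldD(2,3)[OF sm]
  note C = is_chartD[OF smooth_manifoldD(1)[OF sm]]
  have u_cont: "continuous_on UNIV u"
  proof (intro continuous_at_imp_continuous_on ballI)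
    fix p :: 'm
    let ?c = "chart_at M p"
    note C = C[OF charts(1)[of p]]
    have "continuous_on (cimage ?c) (u \<circ> cinv ?c)"
      using twice_differentiable_onD(1)[OF u[OF charts(1)]] 
      by (intro continuous_at_imp_continuous_on) (auto simp: differentiable_imp_continuous_within)
    from continuous_on_compose[OF C(3) this] have "continuous_on (cdom ?c) u"
      by (rule continuous_on_eq) (simp add: C(5))
    then show "isCont u p" using C(1) charts(2) continuous_on_eq_continuous_at by blast
  qed
  obtain p0 where p0: "\<And>p. u p \<le> u p0"
    using continuous_attains_sup[OF compact _ u_cont] by auto
  show "\<exists>p. reduced_curvature M g n u p \<ge> 0"
  proof
    let ?c = "chart_at M p0"
    note C = C[OF charts(1)[of p0]]
    have x: "cmap ?c p0 \<in> cimage ?c" using charts(2) by blast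
    have "(u \<circ> cinv ?c) y \<le> (u \<circ> cinv ?c) (cmap ?c p0)" for y using p0 C(5) charts(2) by simp
    note max = laplacian_nonpos_at_max[OF metric_on_metric_in[OF M charts(1)] u[OF charts(1)] x this]
    have "2 * n * u p0 * laplacian (metric_in M g ?c) (u \<circ> cinv ?c) (cmap ?c p0) \<le> 0"
      "grad_sq (metric_in M g ?c) (u \<circ> cinv ?c) (cmap ?c p0) = 0"
      using n u_pos[of p0] by (simp_all add: max mult_nonneg_nonpos del: o_apply)
    moreover have "(u p0)\<^sup>2 * scalar_curvature M g p0 \<ge> 0" using R by simp
    ultimately show "reduced_curvature M g n u p0 \<ge> 0"
      by (simp add: reduced_curvature_def Let_def)
  qed
  assume conn: "connected (UNIV :: 'm set)" and nonpos: "\<And>p. reduced_curvature M g n u p \<le> 0"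
  \<comment> \<open>The curvature term is dropped by its sign and the positive factor
    \<open>n\<close> divided out, so the maximum principle is applied with \<kappa> = n - 1.\<close>
  have L: "2 * u p * laplacian (metric_in M g (chart_at M p)) (u \<circ> cinv (chart_at M p)) (cmap (chart_at M p) p)
    + (n - 1) * grad_sq (metric_in M g (chart_at M p)) (u \<circ> cinv (chart_at M p)) (cmap (chart_at M p) p) \<ge> 0"
    (is "2 * u p * ?l + (n - 1) * ?q \<ge> 0") for p
  proof -
    have "(u p)\<^sup>2 * scalar_curvature M g p \<ge> 0" using R by simp
    moreover have "(u p)\<^sup>2 * scalar_curvature M g p - 2 * n * u p * ?l - n * (n - 1) * ?q \<le> 0"
      using nonpos[of p] by (simp add: reduced_curvature_def Let_def)
    ultimately have "n * (2 * u p * ?l + (n - 1) * ?q) \<ge> 0" by (simp add: algebra_simps)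
    then show ?thesis using n by (simp add: zero_le_mult_iff)
  qed
  have "open {p. u p = u p0}"
  proof (subst open_subopen, intro ballI)
    fix p assume "p \<in> {p. u p = u p0}"
    then have p: "u p = u p0" by simp
    define c where "c = chart_at M p"
    have c: "c \<in> atlas M" "p \<in> cdom c" unfolding c_def using charts by auto
    note C = C[OF c(1)]
    have op: "open {x\<in>cimage c. (u \<circ> cinv c) x = u p0}"
    proof (rule strong_maximum_principle_laplacian[OF metric_on_metric_in[OF M c(1)] u[OF c(1)]])
      fix x assume "x \<in> cimage c"
      define q where "q = cinv c x"
      have q: "q \<in> cdom c" "cmap c q = x" using C(6,7)[OF \<open>x \<in> cimage c\<close>] by (auto simp: q_def)
      \<comment> \<open>The chart \<open>c\<close> is kept fixed around \<open>p\<close>, while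
        \<open>L\<close> at \<open>q\<close> refers to the preferred chart of
        \<open>q\<close>.\<close>
      note laplacian_chart_independent[OF M c(1) charts(1) q(1) charts(2) u[OF charts(1)], unfolded q(2)]
      then show "2 * (u \<circ> cinv c) x * laplacian (metric_in M g c) (u \<circ> cinv c) x
          + (n - 1) * grad_sq (metric_in M g c) (u \<circ> cinv c) x \<ge> 0"
        using L[of q] by (simp add: q_def)
    qed (use u_pos p0 in auto)
    have "open (cdom c \<inter> cmap c -` {x\<in>cimage c. (u \<circ> cinv c) x = u p0})"
      by (rule continuous_open_preimage[OF C(3,1) op])
    moreover have "cdom c \<inter> cmap c -` {x\<in>cimage c. (u \<circ> cinv c) x = u p0} \<subseteq> {p. u p = u p0}"
      using C(5) by fastforce
    moreover have "p \<in> cdom c \<inter> cmap c -` {x\<in>cimage c. (u \<circ> cinv c) x = u p0}"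
      using c(2) C(5) p by auto
    ultimately show "\<exists>T. open T \<and> p \<in> T \<and> T \<subseteq> {p. u p = u p0}" by blast
  qed
  moreover have "closed {p. u p = u p0}"
    using continuous_closed_preimage_constant[OF u_cont closed_UNIV] by simp
  moreover have "p0 \<in> {p. u p = u p0}" by simp
  ultimately have "{p. u p = u p0} = UNIV"
    using conn unfolding connected_clopen by (auto simp: openin_open_eq closedin_closed_eq)
  then have const: "u = (\<lambda>_. u p0)" by auto
  have "reduced_curvature M g n u p = (u p)\<^sup>2 * scalar_curvature M g p"
  proof -
    have "u \<circ> cinv (chart_at M p) = (\<lambda>_. u p0)" by (subst const) (simp add: fun_eq_iff)
    then show ?thesis by (simp add: reduced_curvature_def Let_def laplacian_const)
  qed
  moreover have "(u p)\<^sup>2 * scalar_curvature M g p \<ge> 0" using R by simp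
  ultimately show "reduced_curvature M g n u p = 0" using nonpos[of p] by simp
qed

text \<open>The transition map between product charts is a product map, so its differential acts on
  the two components separately and commutes with the projections used in
  \<open>warped_sum\<close>.\<close>

lemma metric_in_prod:
  assumes M1: "smooth_manifold M1" and M2: "smooth_manifold M2" and c: "c \<in> atlas M1" and d: "d \<in> atlas M2"
    and z: "fst z \<in> cimage c" "snd z \<in> cimage d"
  shows "metric_in (prod_manifold M1 M2) (warped_sum f1 g1 f2 g2) (prod_chart c d) z v w
    = (f1 (cinv c (fst z), cinv d (snd z)))\<^sup>2 * metric_in M1 g1 c (fst z) (fst v) (fst w)
    + (f2 (cinv c (fst z), cinv d (snd z)))\<^sup>2 * metric_in M2 g2 d (snd z) (snd v) (snd w)"
proof -
  obtain s t where st: "z = (s, t)" by (cases z)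
  define p where "p = cinv c s"
  define q where "q = cinv d t"
  let ?e = "chart_at M1 p" and ?f = "chart_at M2 q"
  note C = is_chartD[OF smooth_manifoldD(1)[OF M1 c]] and E = is_chartD[OF smooth_manifoldD(1)[OF M2 d]]
  have "s \<in> overlap c ?e"
    using C(6,7)[of s] z smooth_manifoldD(3)[OF M1, of p] by (auto simp: p_def st image_iff intro!: bexI[of _ p])
  note D1 = transition(2)[OF M1 c smooth_manifoldD(2)[OF M1] this]
  have "t \<in> overlap d ?f"
    using E(6,7)[of t] z smooth_manifoldD(3)[OF M2, of q] by (auto simp: q_def st image_iff intro!: bexI[of _ q])
  note D2 = transition(2)[OF M2 d smooth_manifoldD(2)[OF M2] this]
  have "((\<lambda>z. ((cmap ?e \<circ> cinv c) (fst z), (cmap ?f \<circ> cinv d) (snd z))) has_derivative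
      (\<lambda>v. (frechet_derivative (cmap ?e \<circ> cinv c) (at s) (fst v), frechet_derivative (cmap ?f \<circ> cinv d) (at t) (snd v))))
      (at (s, t))"
    by (intro has_derivative_Pair has_derivative_compose[of fst fst "(s, t)", unfolded fst_conv, OF has_derivative_fst[OF has_derivative_ident] D1]
        has_derivative_compose[of snd snd "(s, t)", unfolded snd_conv, OF has_derivative_snd[OF has_derivative_ident] D2])
  then have "((map_prod (cmap ?e) (cmap ?f) \<circ> map_prod (cinv c) (cinv d)) has_derivative
      (\<lambda>v. (frechet_derivative (cmap ?e \<circ> cinv c) (at s) (fst v), frechet_derivative (cmap ?f \<circ> cinv d) (at t) (snd v))))
      (at (s, t))"
    by (simp add: o_def map_prod_def case_prod_beta)
  note T = frechet_derivative_at[OF this, symmetric]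
  show ?thesis
    by (simp add: metric_in_def Let_def st prod_manifold_def prod_chart_def T warped_sum_def p_def[symmetric]
        q_def[symmetric])
qed

theorem theorem1p3:
  fixes M1 :: "('m::{t2_space, second_countable_topology}, 'a::euclidean_space) manifold"
    and M2 :: "('n::{t2_space, second_countable_topology}, 'b::euclidean_space) manifold"
    and g1 :: "('m, 'a) tensor2"
    and g2 :: "('n, 'b) tensor2"
    and f1 f2 :: "'m \<times> 'n \<Rightarrow> real"
  assumes "riemannian_manifold M1 g1"
    and "compact (UNIV :: 'm set)"
    and "connected (UNIV :: 'm set)"
    and "riemannian_manifold M2 g2"
    and "compact (UNIV :: 'n set)"
    and "connected (UNIV :: 'n set)"
    and "\<And>x. scalar_curvature M1 g1 x \<ge> 0"
    and "\<And>y. scalar_curvature M2 g2 y \<ge> 0"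
    and "smooth_function (prod_manifold M1 M2) f1"
    and "smooth_function (prod_manifold M1 M2) f2"
    and "\<And>z. f1 z > 0"
    and "\<And>z. f2 z > 0"
    and "\<And>x x' y. f1 (x, y) = f1 (x', y)"
    and "\<And>x y y'. f2 (x, y) = f2 (x, y')"
  shows "\<not> ((\<forall>z. scalar_curvature (prod_manifold M1 M2) (warped_sum f1 g1 f2 g2) z \<le> 0) \<and>
            (\<exists>z. scalar_curvature (prod_manifold M1 M2) (warped_sum f1 g1 f2 g2) z < 0))"
proof -
  note M1 = assms(1) and M2 = assms(4)
  have sm: "smooth_manifold M1" "smooth_manifold M2"
    using M1 M2 by (simp_all add: riemannian_manifold_def)
  \<comment> \<open>\<open>undefined\<close> serves as a base point of the other factor; its choice
    is immaterial, as \<open>f2\<close> is constant along that factor.\<close>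
  define u where "u p = f2 (p, undefined)" for p
  define w where "w q = f1 (undefined, q)" for q
  have f2: "f2 (p, q) = u p" and f1: "f1 (p, q) = w q" for p q
    unfolding u_def w_def by (rule assms(14), rule assms(13))
  have u_pos: "u p > 0" and w_pos: "w q > 0" for p q
    unfolding u_def w_def by (rule assms(12), rule assms(11))
  have smooth: "smooth_on (cimage c \<times> cimage d) (\<lambda>z. u (cinv c (fst z)))"
    "smooth_on (cimage c \<times> cimage d) (\<lambda>z. w (cinv d (snd z)))" if "c \<in> atlas M1" "d \<in> atlas M2" for c d
  proof -
    have im: "cimage (prod_chart c d) = cimage c \<times> cimage d"
      by (auto simp: prod_chart_def map_prod_def)
    have "prod_chart c d \<in> atlas (prod_manifold M1 M2)"
      using that by (auto simp: prod_manifold_def)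
    then have "smooth_on (cimage c \<times> cimage d) (f2 \<circ> cinv (prod_chart c d))"
      "smooth_on (cimage c \<times> cimage d) (f1 \<circ> cinv (prod_chart c d))"
      using assms(9,10) im unfolding smooth_function_def by metis+
    then show "smooth_on (cimage c \<times> cimage d) (\<lambda>z. u (cinv c (fst z)))"
      "smooth_on (cimage c \<times> cimage d) (\<lambda>z. w (cinv d (snd z)))"
      by (simp_all add: o_def prod_chart_def map_prod_def case_prod_beta f1 f2)
  qed
  have u: "twice_differentiable_on (cimage c) (u \<circ> cinv c)" if c: "c \<in> atlas M1" for c
  proof -
    let ?d = "chart_at M2 undefined"
    have "cmap ?d undefined \<in> cimage ?d" using smooth_manifoldD(3)[OF sm(2)] by blast
    from twice_differentiable_on_slice(1)[OF smooth(1)[OF c smooth_manifoldD(2)[OF sm(2)]] this]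
      is_chartD(2)[OF smooth_manifoldD(1)[OF sm(1) c]]
    show ?thesis by (simp add: o_def)
  qed
  have w: "twice_differentiable_on (cimage d) (w \<circ> cinv d)" if d: "d \<in> atlas M2" for d
  proof -
    let ?c = "chart_at M1 undefined"
    have "cmap ?c undefined \<in> cimage ?c" using smooth_manifoldD(3)[OF sm(1)] by blast
    from twice_differentiable_on_slice(2)[OF smooth(2)[OF smooth_manifoldD(2)[OF sm(1)] d] this]
      is_chartD(2)[OF smooth_manifoldD(1)[OF sm(2) d]]
    show ?thesis by (simp add: o_def)
  qed
  let ?R = "scalar_curvature (prod_manifold M1 M2) (warped_sum f1 g1 f2 g2)"
  let ?A = "reduced_curvature M1 g1 (real DIM('b)) u" and ?B = "reduced_curvature M2 g2 (real DIM('a)) w"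
  have formula: "(u p)\<^sup>2 * (w q)\<^sup>2 * ?R (p, q) = ?A p + ?B q" for p q
  proof -
    define c where "c = chart_at M1 p"
    define d where "d = chart_at M2 q"
    have c: "c \<in> atlas M1" "p \<in> cdom c" and d: "d \<in> atlas M2" "q \<in> cdom d"
      unfolding c_def d_def using smooth_manifoldD(2,3)[OF sm(1)] smooth_manifoldD(2,3)[OF sm(2)] by auto
    note C = is_chartD[OF smooth_manifoldD(1)[OF sm(1) c(1)]] and E = is_chartD[OF smooth_manifoldD(1)[OF sm(2) d(1)]]
    \<comment> \<open>The product of the preferred charts at \<open>p\<close> and \<open>q\<close>
      is the preferred chart at \<open>(p, q)\<close>, so \<open>scal_split\<close> there speaks
      about \<open>scalar_curvature\<close> itself. The roles are crossed: \<open>w\<close>, a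
      function on the second factor, scales \<open>g1\<close>.\<close>
    interpret split_metric "\<lambda>v. (v, 0)" fst "\<lambda>v. (0, v)" snd
      "metric_in (prod_manifold M1 M2) (warped_sum f1 g1 f2 g2) (prod_chart c d)"
      "metric_in M1 g1 c" "metric_in M2 g2 d" "u \<circ> cinv c" "w \<circ> cinv d" "cimage c" "cimage d"
    proof
      show "sum f Basis = (\<Sum>i\<in>Basis. f (i, 0)) + (\<Sum>i\<in>Basis. f (0, i))" for f :: "'a \<times> 'b \<Rightarrow> real"
        unfolding Basis_prod_def
        by (subst sum.union_disjoint) (auto simp: sum.reindex inj_on_def)
      show "metric_in (prod_manifold M1 M2) (warped_sum f1 g1 f2 g2) (prod_chart c d) z v w'
        = ((w \<circ> cinv d) (snd z))\<^sup>2 * metric_in M1 g1 c (fst z) (fst v) (fst w')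
        + ((u \<circ> cinv c) (fst z))\<^sup>2 * metric_in M2 g2 d (snd z) (snd v) (snd w')"
        if "fst z \<in> cimage c" "snd z \<in> cimage d" for z v w'
        unfolding metric_in_prod[OF sm c(1) d(1) that] f1 f2 by simp
    qed (auto simp: metric_on_metric_in[OF M1 c(1)] metric_on_metric_in[OF M2 d(1)] u[OF c(1)] w[OF d(1)]
        u_pos w_pos inner_prod_def)
    have "(cmap c p, cmap d q) \<in> Z" using c d by (auto simp: Z_def)
    from scal_split[OF this] show ?thesis
      using C(5)[OF c(2)] E(5)[OF d(2)]
      by (simp add: reduced_curvature_def Let_def scalar_curvature_eq_scal c_def[symmetric] d_def[symmetric]
          prod_manifold_def) (simp add: prod_chart_def)
  qed
  show ?thesis
  proof
    assume *: "(\<forall>z. ?R z \<le> 0) \<and> (\<exists>z. ?R z < 0)"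
    then obtain p' q' where neg: "?R (p', q') < 0" by auto
    have le: "?A p + ?B q \<le> 0" for p q
      unfolding formula[symmetric] using * by (intro mult_nonneg_nonpos) auto
    have dim: "real DIM('b) > 0" "real DIM('a) > 0" by simp_all
    obtain p0 where p0: "?A p0 \<ge> 0"
      using reduced_curvature_nonneg_somewhere[OF M1 assms(2,7) dim(1) u u_pos] by auto
    obtain q0 where q0: "?B q0 \<ge> 0"
      using reduced_curvature_nonneg_somewhere[OF M2 assms(5,8) dim(2) w w_pos] by auto
    have "?A p \<le> 0" for p using le[of p q0] q0 by simp
    then have "?A p' = 0"
      by (intro reduced_curvature_eq_0[OF M1 assms(2,7) dim(1) u u_pos assms(3)]) auto
    moreover have "?B q \<le> 0" for q using le[of p0 q] p0 by simp
    then have "?B q' = 0"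
      by (intro reduced_curvature_eq_0[OF M2 assms(5,8) dim(2) w w_pos assms(6)]) auto
    ultimately have "(u p')\<^sup>2 * (w q')\<^sup>2 * ?R (p', q') = 0" using formula by simp
    then show False using neg u_pos[of p'] w_pos[of q'] by simp
  qed
qed

end
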